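(* Let $1<p<\infty$, $d>0$, $u_0\in L^2(\mathbb{H}^n)$, and let $T_m$ be the Fourier multiplier operator on $L^2(\mathbb{H}^n)$ associated with a bounded measurable function $m:\Omega\to\mathbb{C}$ satisfying $$\sup_{\alpha>0}\ \alpha\left(\int_{\{a\in\Omega:\,|m(a)|>\alpha\}}d\mu(a)\right)^{\frac12-\frac1{2p}}<\infty.$$ Then each of the two Cauchy problems $$u_\tau=|T_mu|^p,\quad u(0)=u_0,\qquad\text{and}\qquad u_\tau+\mathcal{L}u+du=|T_mu|^p,\quad u(0)=u_0,$$ admits a local solution. That is, for the first problem there are $T^*>0$ and $u\in L^\infty(0,T^*;L^2(\mathbb{H}^n))$ with $$u(\tau)=u_0+\int_0^\tau|T_mu(s)|^p\,ds\qquad\text{on }(0,T^* ),$$ and for the second problem there are $T^*>0$ and $u\in L^\infty(0,T^*;L^2(\mathbb{H}^n))$ with $$u(\tau)=e^{-\tau(\mathcal{L}+dI)}u_0+\int_0^\tau e^{-(\tau-s)(\mathcal{L}+dI)}|T_mu(s)|^p\,ds\qquad\text{on }(0,T^* ).$$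
   Context: Let $n\ge 1$. The Heisenberg group $\mathbb{H}^n=\mathbb{C}^n\times\mathbb{R}$ has group law $(z,t)(w,s)=(z+w,\,t+s+\tfrac12\operatorname{Im}(z\cdot\overline{w}))$ (so $(z,t)^{-1}=(-z,-t)$) and Haar measure $dz\,dt$ (Lebesgue measure); $L^p(\mathbb{H}^n)$ is taken with respect to it. The time variable is denoted $\tau$. With $z=x+iy$, let $X_i=\frac{\partial}{\partial x_i}+\frac12y_i\frac{\partial}{\partial t}$, $Y_i=\frac{\partial}{\partial y_i}-\frac12x_i\frac{\partial}{\partial t}$ ($1\le i\le n$); the sublaplacian is the nonnegative operator $\mathcal{L}=-\sum_{i=1}^n(X_i^2+Y_i^2)$, and $e^{-\tau(\mathcal{L}+dI)}$, $\tau\ge 0$, is the associated contraction semigroup on $L^2(\mathbb{H}^n)$. Write $\mathbb{R}^*=\mathbb{R}\setminus\{0\}$. Laguerre functions: for $\lambda\in\mathbb{R}^*$ and $k\in\{0,1,2,\dots\}$, $\varphi^{n-1}_{k,\lambda}(z)=L^{n-1}_k\big(\tfrac12|\lambda||z|^2\big)e^{-\frac14|\lambda||z|^2}$, where $L_k^{\delta}(t)=\frac{t^{-\delta}e^t}{k!}\big(\frac{d}{dt}\big)^k(e^{-t}t^{k+\delta})$ is the Laguerre polynomial of type $\delta$ and degree $k$. Heisenberg fan: $\Omega=\bigcup_{k\ge 0}R_k\cup R_\infty\subset\mathbb{R}^2$, where $R_k=\{(\lambda,(2k+n)|\lambda|):\lambda\in\mathbb{R}^*\}$ and $R_\infty=\{(0,\sigma):\sigma\ge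 0\}$. For $a=(\lambda,(2k+n)|\lambda|)\in R_k$ put $e_a(z,t)=e^{i\lambda t}\varphi^{n-1}_{k,\lambda}(z)$ and $c_{n,k}=\frac{k!\,(n-1)!}{(k+n-1)!}$. Normalized Strichartz Fourier transform: for $f\in L^1\cap L^2(\mathbb{H}^n)$, $a\in R_k$, $w\in\mathbb{C}^n$, $$\mathcal{F}(f)(a,w)=c_{n,k}\int_{\mathbb{H}^n}f(z,t)\,e_a\big((z,t)^{-1}(w,0)\big)\,dz\,dt.$$ (Values on $R_\infty$ are irrelevant here, since $R_\infty$ is a null set for the measures below.) The measures $\nu_2$ and $\mu$ on $\Omega$ are $$\int_\Omega\phi\,d\nu_2=(2\pi)^{-2n-1}\int_{-\infty}^\infty\Big(\sum_{k=0}^\infty c_{n,k}^{-2}\,\phi(\lambda,(2k+n)|\lambda|)\Big)|\lambda|^{2n}\,d\lambda,\qquad d\mu(a)=|\lambda|^{-n}\,d\nu_2(a).$$ The Plancherel identity $\|f\|_{L^2(\mathbb{H}^n)}^2=\int_\Omega\int_{\mathbb{C}^n}|\mathcal{F}(f)(a,w)|^2\,dw\,d\nu_2(a)$ holds, and $\mathcal{F}$ extends to an isometry from $L^2(\mathbb{H}^n)$ into $L^2(\Omega\times\mathbb{C}^n,d\nu_2\,dw)$ whose range is stable under multiplication by bounded measurable functions of $a$ alone. The Fourier multiplier operator $T_m$ maps $f\in L^2(\mathbb{H}^n)$ to the unique $T_mf\in L^2(\mathbb{H}^n)$ with $\mathcal{F}(T_mf)(a,w)=m(a)\,\mathcal{F}(f)(a,w)$.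 *)

theory Defs
  imports "HOL-Analysis.Analysis"
begin

section \<open>The Hilbert space of complex square-integrable functions\<close>

definition L2_fun :: "('a::euclidean_space \<Rightarrow> complex) set" where
  "L2_fun = {f \<in> borel_measurable lborel. integrable lborel (\<lambda>x. (norm (f x))\<^sup>2)}"

definition L2_rel :: "('a::euclidean_space \<Rightarrow> complex) \<Rightarrow> ('a \<Rightarrow> complex) \<Rightarrow> bool" where
  "L2_rel f g \<longleftrightarrow> f \<in> L2_fun \<and> g \<in> L2_fun \<and> (AE x in lborel. f x = g x)"

lemma L2_funD [measurable_dest]: "f \<in> L2_fun \<Longrightarrow> f \<in> borel_measurable lborel"
  by (simp add: L2_fun_def)

lemma L2_fun_zero: "(\<lambda>x. 0) \<in> L2_fun"
  by (simp add: L2_fun_def)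

lemma L2_rel_refl: "f \<in> L2_fun \<Longrightarrow> L2_rel f f"
  by (simp add: L2_rel_def)

lemma part_equivp_L2_rel: "part_equivp L2_rel"
proof (rule part_equivpI)
  show "\<exists>f::'a \<Rightarrow> complex. L2_rel f f"
    using L2_rel_refl L2_fun_zero by blast
  show "symp (L2_rel :: ('a \<Rightarrow> complex) \<Rightarrow> _)"
    by (auto simp: symp_def L2_rel_def)
  show "transp (L2_rel :: ('a \<Rightarrow> complex) \<Rightarrow> _)"
    by (auto simp: transp_def L2_rel_def)
qed

text \<open>Almost-everywhere classes of Borel square-integrable functions; \<open>L2_of f\<close> is the class of
  \<^term>\<open>f\<close>, and is meaningful only for \<^term>\<open>f \<in> L2_fun\<close>. As a separable Banach space the type supports
  the Bochner integral of \<open>L\<^sup>2\<close>-valued functions.\<close>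

quotient_type (overloaded) 'a L2 = "'a::euclidean_space \<Rightarrow> complex" / partial: L2_rel
  morphisms rep_L2 L2_of
  by (rule part_equivp_L2_rel)

lemma L2_fun_cmult:
  assumes "f \<in> L2_fun"
  shows "(\<lambda>x. c * f x) \<in> L2_fun"
  using assms by (auto simp: L2_fun_def norm_mult power_mult_distrib)

lemma L2_fun_add:
  assumes "f \<in> L2_fun" "g \<in> L2_fun"
  shows "(\<lambda>x. f x + g x) \<in> L2_fun"
proof -
  have [measurable]: "f \<in> borel_measurable lborel" "g \<in> borel_measurable lborel"
    using assms by (auto simp: L2_fun_def)
  have "integrable lborel (\<lambda>x. (norm (f x + g x))\<^sup>2)"
  proof (rule Bochner_Integration.integrable_bound)
    show "integrable lborel (\<lambda>x. 2 * (norm (f x))\<^sup>2 + 2 * (norm (g x))\<^sup>2)"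
      using assms by (auto simp: L2_fun_def)
    have "(norm (f x + g x))\<^sup>2 \<le> 2 * (norm (f x))\<^sup>2 + 2 * (norm (g x))\<^sup>2" for x
    proof -
      have "(norm (f x + g x))\<^sup>2 \<le> (norm (f x) + norm (g x))\<^sup>2"
        by (intro power_mono norm_triangle_ineq) auto
      also have "\<dots> \<le> 2 * (norm (f x))\<^sup>2 + 2 * (norm (g x))\<^sup>2"
        using sum_squares_bound[of "norm (f x)" "norm (g x)"] by (simp add: power2_sum)
      finally show ?thesis .
    qed
    then show "AE x in lborel. norm ((norm (f x + g x))\<^sup>2) \<le> norm (2 * (norm (f x))\<^sup>2 + 2 * (norm (g x))\<^sup>2)"
      by (intro AE_I2) (auto intro: order_trans)
  qed auto
  then show ?thesis by (auto simp: L2_fun_def)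
qed

lemma L2_fun_uminus: "f \<in> L2_fun \<Longrightarrow> (\<lambda>x. - f x) \<in> L2_fun"
  using L2_fun_cmult[of f "-1"] by simp

lemma L2_fun_diff: "f \<in> L2_fun \<Longrightarrow> g \<in> L2_fun \<Longrightarrow> (\<lambda>x. f x - g x) \<in> L2_fun"
  using L2_fun_add[of f "\<lambda>x. - g x"] L2_fun_uminus[of g] by simp

lemma L2_fun_scaleR: "f \<in> L2_fun \<Longrightarrow> (\<lambda>x. r *\<^sub>R f x) \<in> L2_fun"
  using L2_fun_cmult[of f "of_real r"] by (simp add: scaleR_conv_of_real)

lemma integrable_L2_inner:
  assumes "f \<in> L2_fun" "g \<in> L2_fun"
  shows "integrable lborel (\<lambda>x. f x \<bullet> g x)"
proof -
  have [measurable]: "f \<in> borel_measurable lborel" "g \<in> borel_measurable lborel"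
    using assms by (auto simp: L2_fun_def)
  show ?thesis
  proof (rule Bochner_Integration.integrable_bound)
    show "integrable lborel (\<lambda>x. (norm (f x))\<^sup>2 + (norm (g x))\<^sup>2)"
      using assms by (auto simp: L2_fun_def)
    have "\<bar>f x \<bullet> g x\<bar> \<le> (norm (f x))\<^sup>2 + (norm (g x))\<^sup>2" for x
    proof -
      have "\<bar>f x \<bullet> g x\<bar> \<le> norm (f x) * norm (g x)" by (rule Cauchy_Schwarz_ineq2)
      also have "\<dots> \<le> (norm (f x))\<^sup>2 + (norm (g x))\<^sup>2"
        using sum_squares_bound[of "norm (f x)" "norm (g x)"]
          mult_nonneg_nonneg[OF norm_ge_zero norm_ge_zero, of "f x" "g x"]
        by linarith
      finally show ?thesis .
    qed
    then show "AE x in lborel. norm (f x \<bullet> g x) \<le> norm ((norm (f x))\<^sup>2 + (norm (g x))\<^sup>2)"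
      by (intro AE_I2) auto
  qed measurable
qed

instantiation L2 :: (euclidean_space) real_inner
begin

lift_definition zero_L2 :: "'a L2" is "\<lambda>x. 0"
  by (simp add: L2_rel_refl L2_fun_zero)

lift_definition plus_L2 :: "'a L2 \<Rightarrow> 'a L2 \<Rightarrow> 'a L2" is "\<lambda>f g x. f x + g x"
  by (auto simp: L2_rel_def intro: L2_fun_add)

lift_definition minus_L2 :: "'a L2 \<Rightarrow> 'a L2 \<Rightarrow> 'a L2" is "\<lambda>f g x. f x - g x"
  by (auto simp: L2_rel_def intro: L2_fun_diff)

lift_definition uminus_L2 :: "'a L2 \<Rightarrow> 'a L2" is "\<lambda>f x. - f x"
  by (auto simp: L2_rel_def intro: L2_fun_uminus)

lift_definition scaleR_L2 :: "real \<Rightarrow> 'a L2 \<Rightarrow> 'a L2" is "\<lambda>r f x. r *\<^sub>R f x"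
  by (auto simp: L2_rel_def intro: L2_fun_scaleR)

lift_definition inner_L2 :: "'a L2 \<Rightarrow> 'a L2 \<Rightarrow> real" is "\<lambda>f g. integral\<^sup>L lborel (\<lambda>x. f x \<bullet> g x)"
  by (rule integral_cong_AE) (auto simp: L2_rel_def L2_fun_def)

definition norm_L2 :: "'a L2 \<Rightarrow> real" where
  "norm_L2 f = sqrt (f \<bullet> f)"

definition dist_L2 :: "'a L2 \<Rightarrow> 'a L2 \<Rightarrow> real" where
  "dist_L2 f g = norm (f - g)"

definition sgn_L2 :: "'a L2 \<Rightarrow> 'a L2" where
  "sgn_L2 f = inverse (norm f) *\<^sub>R f"

definition uniformity_L2 :: "('a L2 \<times> 'a L2) filter" where
  "uniformity_L2 = (INF e\<in>{0 <..}. principal {(x, y). dist x y < e})"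

definition open_L2 :: "'a L2 set \<Rightarrow> bool" where
  "open_L2 S = (\<forall>x\<in>S. \<forall>\<^sub>F (x', y) in uniformity. x' = x \<longrightarrow> y \<in> S)"

instance
proof
  fix f g h :: "'a L2" and r s :: real
  show "f + g + h = f + (g + h)"
    by transfer (auto simp: L2_rel_def algebra_simps intro!: L2_fun_add)
  show "f + g = g + f"
    by transfer (auto simp: L2_rel_def algebra_simps intro!: L2_fun_add)
  show "0 + f = f"
    by transfer (auto simp: L2_rel_def)
  show "- f + f = 0"
    by transfer (auto simp: L2_rel_def L2_fun_zero)
  show "f - g = f + - g"
    by transfer (auto simp: L2_rel_def intro: L2_fun_diff)
  show "r *\<^sub>R (f + g) = r *\<^sub>R f + r *\<^sub>R g"
    by transfer (auto simp: L2_rel_def scaleR_add_right intro!: L2_fun_scaleR L2_fun_add)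
  show "(r + s) *\<^sub>R f = r *\<^sub>R f + s *\<^sub>R f"
    by transfer (auto simp: L2_rel_def scaleR_add_left intro!: L2_fun_scaleR L2_fun_add)
  show "r *\<^sub>R s *\<^sub>R f = (r * s) *\<^sub>R f"
    by transfer (auto simp: L2_rel_def intro: L2_fun_scaleR)
  show "1 *\<^sub>R f = f"
    by transfer (auto simp: L2_rel_def)
  show "dist f g = norm (f - g)" by (rule dist_L2_def)
  show "sgn f = inverse (norm f) *\<^sub>R f" by (simp add: sgn_L2_def)
  show "uniformity = (INF e\<in>{0<..}. principal {(x, y). dist (x::'a L2) y < e})"
    by (rule uniformity_L2_def)
  show "open U = (\<forall>x\<in>U. \<forall>\<^sub>F (x', y) in uniformity. x' = x \<longrightarrow> y \<in> U)" for U :: "'a L2 set"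
    by (rule open_L2_def)
  show "f \<bullet> g = g \<bullet> f"
    by transfer (simp add: inner_commute)
  show "(f + g) \<bullet> h = f \<bullet> h + g \<bullet> h"
    by transfer (auto simp: L2_rel_def inner_add_left intro!: Bochner_Integration.integral_add integrable_L2_inner)
  show "(r *\<^sub>R f) \<bullet> g = r * (f \<bullet> g)"
    by transfer (simp add: L2_rel_def integrable_L2_inner)
  show "0 \<le> f \<bullet> f"
    by transfer (auto intro!: integral_nonneg_AE)
  show "f \<bullet> f = 0 \<longleftrightarrow> f = 0"
  proof transfer
    fix f :: "'a \<Rightarrow> complex"
    assume "L2_rel f f"
    then have f: "f \<in> L2_fun" by (simp add: L2_rel_def)
    have "(LINT x|lborel. f x \<bullet> f x) = 0 \<longleftrightarrow> (AE x in lborel. f x \<bullet> f x = 0)"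
      by (rule integral_nonneg_eq_0_iff_AE) (auto intro: integrable_L2_inner f)
    then show "(LINT x|lborel. f x \<bullet> f x) = 0 \<longleftrightarrow> L2_rel f (\<lambda>x. 0)"
      using f by (simp add: L2_rel_def L2_fun_zero)
  qed
  show "norm f = sqrt (f \<bullet> f)" by (rule norm_L2_def)
qed

end


lemma L2_of_rep [simp]: "L2_of (rep_L2 f) = f"
  by (rule Quotient3_abs_rep[OF Quotient3_L2])

lemma rep_L2_fun: "rep_L2 f \<in> L2_fun"
  using Quotient3_rep_reflp[OF Quotient3_L2, of f] by (simp add: L2_rel_def)

lemma L2_of_eq_iff:
  assumes "f \<in> L2_fun" "g \<in> L2_fun"
  shows "L2_of f = L2_of g \<longleftrightarrow> (AE x in lborel. f x = g x)"
  using Quotient3_rel[OF Quotient3_L2, of f g] assms by (simp add: L2_rel_def)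

lemma L2_of_zero: "L2_of (\<lambda>x. 0) = 0"
  by (simp add: zero_L2_def)

lemma L2_of_add: "f \<in> L2_fun \<Longrightarrow> g \<in> L2_fun \<Longrightarrow> L2_of (\<lambda>x. f x + g x) = L2_of f + L2_of g"
  by (simp add: plus_L2.abs_eq L2_rel_refl)

lemma L2_of_diff: "f \<in> L2_fun \<Longrightarrow> g \<in> L2_fun \<Longrightarrow> L2_of (\<lambda>x. f x - g x) = L2_of f - L2_of g"
  by (simp add: minus_L2.abs_eq L2_rel_refl)

lemma L2_of_scaleR: "f \<in> L2_fun \<Longrightarrow> L2_of (\<lambda>x. r *\<^sub>R f x) = r *\<^sub>R L2_of f"
  by (simp add: scaleR_L2.abs_eq L2_rel_refl)

lemma norm_L2_of:
  assumes "f \<in> L2_fun"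
  shows "(norm (L2_of f))\<^sup>2 = (\<integral>x. (norm (f x))\<^sup>2 \<partial>lborel)"
  using assms by (simp add: power2_norm_eq_inner inner_L2.abs_eq L2_rel_refl)

lemma norm_L2_of_nn:
  assumes "f \<in> L2_fun"
  shows "ennreal ((norm (L2_of f))\<^sup>2) = (\<integral>\<^sup>+x. ennreal ((norm (f x))\<^sup>2) \<partial>lborel)"
  unfolding norm_L2_of[OF assms]
  using assms by (intro nn_integral_eq_integral[symmetric]) (auto simp: L2_fun_def)

lemma L2_funI_nn:
  assumes [measurable]: "f \<in> borel_measurable lborel"
    and "(\<integral>\<^sup>+x. ennreal ((norm (f x))\<^sup>2) \<partial>lborel) < \<infinity>"
  shows "f \<in> L2_fun"
  using assms by (auto simp: L2_fun_def integrable_iff_bounded)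

instance L2 :: (euclidean_space) banach
proof
  fix X :: "nat \<Rightarrow> 'a L2"
  assume X: "Cauchy X"
  have "\<exists>r. \<forall>n. (\<forall>i\<ge>r n. \<forall>j\<ge>r n. (norm (X i - X j))\<^sup>2 < (1/8) ^ n) \<and> r n < r (Suc n)"
  proof (rule dependent_nat_choice)
    have *: "\<exists>N. \<forall>i\<ge>N. \<forall>j\<ge>N. (norm (X i - X j))\<^sup>2 < (1/8) ^ n" for n :: nat
    proof -
      obtain N where N: "\<And>i j. i \<ge> N \<Longrightarrow> j \<ge> N \<Longrightarrow> norm (X i - X j) < sqrt ((1/8) ^ n)"
        using X[unfolded Cauchy_def, rule_format, of "sqrt ((1/8) ^ n)"] by (auto simp: dist_norm)
      have "(norm (X i - X j))\<^sup>2 < (1/8) ^ n" if "i \<ge> N" "j \<ge> N" for i j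
      proof -
        have "(norm (X i - X j))\<^sup>2 < (sqrt ((1/8) ^ n))\<^sup>2"
          using N[OF that] by (intro power_strict_mono) auto
        then show ?thesis by simp
      qed
      then show ?thesis by blast
    qed
    show "\<exists>x. \<forall>i\<ge>x. \<forall>j\<ge>x. (norm (X i - X j))\<^sup>2 < (1/8) ^ 0" using *[of 0] .
    fix x n :: nat
    obtain N where "\<forall>i\<ge>N. \<forall>j\<ge>N. (norm (X i - X j))\<^sup>2 < (1/8) ^ Suc n" using *[of "Suc n"] by blast
    then show "\<exists>y. (\<forall>i\<ge>y. \<forall>j\<ge>y. (norm (X i - X j))\<^sup>2 < (1/8) ^ Suc n) \<and> x < y"
      by (intro exI[of _ "max N (Suc x)"]) auto
  qed
  then obtain r where r: "\<And>n i j. i \<ge> r n \<Longrightarrow> j \<ge> r n \<Longrightarrow> (norm (X i - X j))\<^sup>2 < (1/8) ^ n"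
    and r_less: "\<And>n. r n < r (Suc n)"
    by blast
  have "strict_mono r" using r_less by (simp add: strict_mono_Suc_iff)
  define F where "F n = rep_L2 (X (r n))" for n
  have F_fun: "F n \<in> L2_fun" for n by (simp add: F_def rep_L2_fun)
  then have [measurable]: "F n \<in> borel_measurable lborel" for n by (simp add: L2_fun_def)
  have F_norm: "(\<integral>\<^sup>+x. ennreal ((norm (F i x - F j x))\<^sup>2) \<partial>lborel) = ennreal ((norm (X (r i) - X (r j)))\<^sup>2)" for i j
    using norm_L2_of_nn[OF L2_fun_diff[OF F_fun F_fun], of i j]
    by (simp add: L2_of_diff F_fun) (simp add: F_def)
  have "AE x in lborel. Cauchy (\<lambda>n. F n x)"
  proof -
    let ?g = "\<lambda>x. \<Sum>n. ennreal (4 ^ n * (norm (F (Suc n) x - F n x))\<^sup>2)"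
    have "(\<integral>\<^sup>+x. ?g x \<partial>lborel) = (\<Sum>n. \<integral>\<^sup>+x. ennreal (4 ^ n * (norm (F (Suc n) x - F n x))\<^sup>2) \<partial>lborel)"
      by (rule nn_integral_suminf) measurable
    also have "\<dots> = (\<Sum>n. ennreal (4 ^ n * (norm (X (r (Suc n)) - X (r n)))\<^sup>2))"
      by (simp add: ennreal_mult nn_integral_cmult F_norm)
    also have "\<dots> \<le> (\<Sum>n. ennreal ((1/2) ^ n))"
    proof (intro suminf_le ennreal_leI)
      fix n
      have "(norm (X (r (Suc n)) - X (r n)))\<^sup>2 \<le> (1/8) ^ n"
        using r_less[of n] by (intro r[THEN less_imp_le]) auto
      then have "4 ^ n * (norm (X (r (Suc n)) - X (r n)))\<^sup>2 \<le> 4 ^ n * (1/8) ^ n"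
        by (intro mult_left_mono) auto
      also have "\<dots> = ((1::real)/2) ^ n" by (simp flip: power_mult_distrib)
      finally show "4 ^ n * (norm (X (r (Suc n)) - X (r n)))\<^sup>2 \<le> (1/2) ^ n" .
    qed auto
    also have "\<dots> < \<infinity>"
      by (subst suminf_ennreal2) (auto simp: summable_geometric)
    finally have "AE x in lborel. ?g x \<noteq> \<infinity>"
      by (intro nn_integral_PInf_AE) auto
    then show ?thesis
    proof (rule AE_mp, intro AE_I2 impI)
      fix x assume fin: "?g x \<noteq> \<infinity>"
      define C where "C = enn2real (?g x)"
      have "C \<ge> 0" by (simp add: C_def)
      have b: "norm (F (Suc n) x - F n x) \<le> sqrt C * (1/2) ^ n" for n
      proof -
        have "sum (\<lambda>n. ennreal (4 ^ n * (norm (F (Suc n) x - F n x))\<^sup>2)) {n} \<le> ?g x"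
          by (rule sum_le_suminf) auto
        also have "?g x = ennreal C"
          unfolding C_def using fin by (intro ennreal_enn2real[symmetric]) (auto simp: less_top)
        finally have "4 ^ n * (norm (F (Suc n) x - F n x))\<^sup>2 \<le> C" using \<open>C \<ge> 0\<close> by simp
        moreover have "4 ^ n * (norm (F (Suc n) x - F n x))\<^sup>2 = (2 ^ n * norm (F (Suc n) x - F n x))\<^sup>2"
        proof -
          have "(4::real) ^ n = (2 ^ n)\<^sup>2" by (simp add: power_even_eq[symmetric] power_mult)
          then show ?thesis by (simp only: power_mult_distrib)
        qed
        ultimately have "(2 ^ n * norm (F (Suc n) x - F n x))\<^sup>2 \<le> C" by simp
        then have "2 ^ n * norm (F (Suc n) x - F n x) \<le> sqrt C"
          by (rule real_le_rsqrt)
        then show ?thesis by (simp add: field_simps power_divide)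
      qed
      have "summable (\<lambda>n. F (Suc n) x - F n x)"
        by (rule summable_comparison_test'[where N = 0 and g = "\<lambda>n. sqrt C * (1/2) ^ n"])
          (use b in \<open>auto intro!: summable_mult summable_geometric\<close>)
      then have "convergent (\<lambda>n. F n x - F 0 x)"
        by (simp only: summable_iff_convergent sum_lessThan_telescope[of "\<lambda>n. F n x"])
      then show "Cauchy (\<lambda>n. F n x)"
        by (simp add: convergent_diff_const_right_iff convergent_Cauchy)
    qed
  qed
  then have conv: "AE x in lborel. convergent (\<lambda>n. F n x)"
    by (simp add: Cauchy_convergent_iff)
  define f where "f x = lim (\<lambda>n. F n x)" for x
  have [measurable]: "f \<in> borel_measurable lborel"
    unfolding f_def by (rule borel_measurable_lim_metric) measurable
  have lim_f: "AE x in lborel. (\<lambda>n. F n x) \<longlonglongrightarrow> f x"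
    using conv by eventually_elim (simp add: f_def convergent_LIMSEQ_iff)
  have close: "(\<integral>\<^sup>+x. ennreal ((norm (F n x - f x))\<^sup>2) \<partial>lborel) \<le> ennreal ((1/8) ^ n)" for n
  proof -
    have "(\<integral>\<^sup>+x. ennreal ((norm (F n x - f x))\<^sup>2) \<partial>lborel)
        = (\<integral>\<^sup>+x. liminf (\<lambda>m. ennreal ((norm (F n x - F m x))\<^sup>2)) \<partial>lborel)"
    proof (rule nn_integral_cong_AE)
      show "AE x in lborel. ennreal ((norm (F n x - f x))\<^sup>2) = liminf (\<lambda>m. ennreal ((norm (F n x - F m x))\<^sup>2))"
        using lim_f
      proof eventually_elim
        case (elim x)
        then have "(\<lambda>m. ennreal ((norm (F n x - F m x))\<^sup>2)) \<longlonglongrightarrow> ennreal ((norm (F n x - f x))\<^sup>2)"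
          by (intro tendsto_intros) auto
        from lim_imp_Liminf[OF trivial_limit_sequentially this] show ?case by (rule sym)
      qed
    qed
    also have "\<dots> \<le> liminf (\<lambda>m. \<integral>\<^sup>+x. ennreal ((norm (F n x - F m x))\<^sup>2) \<partial>lborel)"
      by (rule nn_integral_liminf) measurable
    also have "\<dots> \<le> ennreal ((1/8) ^ n)"
    proof (rule Liminf_le)
      show "\<forall>\<^sub>F m in sequentially. (\<integral>\<^sup>+x. ennreal ((norm (F n x - F m x))\<^sup>2) \<partial>lborel) \<le> ennreal ((1/8) ^ n)"
        using eventually_ge_at_top[of n]
      proof eventually_elim
        case (elim m)
        then show ?case
          unfolding F_norm using \<open>strict_mono r\<close>
          by (intro ennreal_leI r[THEN less_imp_le]) (auto simp: strict_mono_less_eq)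
      qed
    qed auto
    finally show ?thesis .
  qed
  have "(\<lambda>x. F 0 x - f x) \<in> L2_fun"
    by (rule L2_funI_nn) (use close[of 0] in \<open>auto simp: top.not_eq_extremum intro: le_less_trans\<close>)
  from L2_fun_diff[OF F_fun[of 0] this] have f_fun: "f \<in> L2_fun" by simp
  have "(\<lambda>n. X (r n)) \<longlonglongrightarrow> L2_of f"
  proof (rule LIMSEQ_I)
    fix e :: real assume "e > 0"
    then obtain N where N: "(1/8::real) ^ N < e\<^sup>2"
      using real_arch_pow_inv[of "e\<^sup>2" "1/8"] by auto
    have "norm (X (r n) - L2_of f) < e" if "n \<ge> N" for n
    proof -
      have "L2_of (\<lambda>x. F n x - f x) = X (r n) - L2_of f"
        by (simp add: L2_of_diff F_fun f_fun) (simp add: F_def)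
      then have "ennreal ((norm (X (r n) - L2_of f))\<^sup>2) \<le> ennreal ((1/8) ^ n)"
        using close[of n] norm_L2_of_nn[OF L2_fun_diff[OF F_fun f_fun], of n] by metis
      then have "(norm (X (r n) - L2_of f))\<^sup>2 \<le> (1/8) ^ n" by simp
      also have "\<dots> \<le> (1/8) ^ N" using that by (intro power_decreasing) auto
      also note N
      finally show ?thesis using \<open>e > 0\<close> by (simp add: power2_less_imp_less)
    qed
    then show "\<exists>no. \<forall>n\<ge>no. norm (X (r n) - L2_of f) < e" by blast
  qed
  then have "X \<longlonglongrightarrow> L2_of f"
    using X \<open>strict_mono r\<close> Cauchy_converges_subseq[of X r "L2_of f"] by (simp add: o_def)
  then show "convergent X" by (auto simp: convergent_def)
qed

lemma L2_fun_indicator: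
  assumes "A \<in> sets lborel" "emeasure lborel A < \<infinity>"
  shows "(\<lambda>x::'a::euclidean_space. c * indicator A x) \<in> L2_fun"
proof -
  have [measurable]: "A \<in> sets lborel" by fact
  have "(\<lambda>x. (norm (c * indicator A x))\<^sup>2) = (\<lambda>x. (norm c)\<^sup>2 * indicator A x)"
    by (auto simp: indicator_def norm_mult)
  then show ?thesis
    using assms by (auto simp: L2_fun_def)
qed

lemma norm_L2_indicator_diff:
  fixes A V U :: "'a::euclidean_space set"
  assumes [measurable]: "A \<in> sets lborel" "V \<in> sets lborel" "U \<in> sets lborel"
    and "A \<subseteq> U" "V \<subseteq> U" "emeasure lborel U < \<infinity>"
  shows "(norm (L2_of (\<lambda>x. c * indicator A x) - L2_of (\<lambda>x. c * indicator V x)))\<^sup>2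
    \<le> (norm c)\<^sup>2 * (measure lborel (U - A) + measure lborel (U - V))"
proof -
  have fin: "emeasure lborel X < \<infinity>" if "X \<subseteq> U" for X :: "'a set"
    using that assms by (meson assms(3) emeasure_mono le_less_trans)
  have L: "(\<lambda>x. c * indicator A x) \<in> L2_fun" "(\<lambda>x. c * indicator V x) \<in> L2_fun"
    using assms fin by (auto intro!: L2_fun_indicator)
  have UAV: "U - A \<in> sets lborel" "U - V \<in> sets lborel" by measurable
  have i: "integrable lborel (\<lambda>x. (indicator X x :: real))" if "X \<in> sets lborel" "X \<subseteq> U" for X
    using that fin[of X] by (simp add: integrable_indicator_iff)
  have "(norm (L2_of (\<lambda>x. c * indicator A x) - L2_of (\<lambda>x. c * indicator V x)))\<^sup>2
      = (\<integral>x. (norm (c * indicator A x - c * indicator V x))\<^sup>2 \<partial>lborel)"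
    using norm_L2_of[OF L2_fun_diff[OF L]] by (simp add: L2_of_diff L)
  also have "\<dots> \<le> (\<integral>x. (norm c)\<^sup>2 * (indicator (U - A) x + indicator (U - V) x) \<partial>lborel)"
  proof (rule integral_mono)
    show "integrable lborel (\<lambda>x. (norm (c * indicator A x - c * indicator V x))\<^sup>2)"
      using L2_fun_diff[OF L] by (simp add: L2_fun_def)
    show "integrable lborel (\<lambda>x. (norm c)\<^sup>2 * (indicator (U - A) x + indicator (U - V) x))"
      using UAV by (intro integrable_mult_right Bochner_Integration.integrable_add i) auto
    show "(norm (c * indicator A x - c * indicator V x))\<^sup>2
        \<le> (norm c)\<^sup>2 * (indicator (U - A) x + indicator (U - V) x)" for x
      using assms(4,5) by (auto simp: indicator_def)
  qed
  also have "\<dots> = (norm c)\<^sup>2 * (measure lborel (U - A) + measure lborel (U - V))"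
    using UAV by (subst integral_mult_right_zero, subst Bochner_Integration.integral_add) (auto intro!: i)
  finally show ?thesis .
qed

lemma L2_separable: "\<exists>D :: 'a::euclidean_space L2 set. countable D \<and> closure D = UNIV"
proof -
  obtain \<B> :: "'a set set" where \<B>: "countable \<B>" "topological_basis \<B>"
    using ex_countable_basis by blast
  define G :: "'a L2 set"
    where "G = (\<lambda>(c, F). L2_of (\<lambda>x. c * indicator (\<Union>F) x)) ` ({1, \<i>} \<times> {F. finite F \<and> F \<subseteq> \<B>})"
  define D where "D = (\<lambda>ps. \<Sum>(q, g)\<leftarrow>ps. q *\<^sub>R g) ` lists (\<rat> \<times> G)"
  have "countable G"
    unfolding G_def using \<B>(1)
    by (intro countable_image countable_SIGMA countable_Collect_finite_subset) auto
  then have "countable D"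
    unfolding D_def by (intro countable_image countable_lists countable_SIGMA countable_rat)
  define K where "K = closure D"
  have "closed K" by (simp add: K_def)
  have D_add: "x + y \<in> D" if "x \<in> D" "y \<in> D" for x y
  proof -
    obtain xs ys where "xs \<in> lists (\<rat> \<times> G)" "ys \<in> lists (\<rat> \<times> G)"
      "x = (\<Sum>(q, g)\<leftarrow>xs. q *\<^sub>R g)" "y = (\<Sum>(q, g)\<leftarrow>ys. q *\<^sub>R g)"
      using \<open>x \<in> D\<close> \<open>y \<in> D\<close> unfolding D_def by blast
    then show ?thesis unfolding D_def by (intro image_eqI[of _ _ "xs @ ys"]) auto
  qed
  have D_scale: "r *\<^sub>R x \<in> D" if "r \<in> \<rat>" "x \<in> D" for r x
  proof -
    obtain xs where xs: "xs \<in> lists (\<rat> \<times> G)" "x = (\<Sum>(q, g)\<leftarrow>xs. q *\<^sub>R g)"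
      using \<open>x \<in> D\<close> unfolding D_def by blast
    have "r *\<^sub>R (\<Sum>(q, g)\<leftarrow>xs. q *\<^sub>R g) = (\<Sum>(q, g)\<leftarrow>map (\<lambda>(q, g). (r * q, g)) xs. q *\<^sub>R g)"
      by (induction xs) (auto simp: scaleR_add_right)
    moreover have "map (\<lambda>(q, g). (r * q, g)) xs \<in> lists (\<rat> \<times> G)"
      using xs(1) \<open>r \<in> \<rat>\<close> by (induction xs) auto
    ultimately show ?thesis unfolding D_def xs(2) by (rule image_eqI)
  qed
  have G_K: "g \<in> K" if "g \<in> G" for g
  proof -
    have "g \<in> D" unfolding D_def using that by (intro image_eqI[of _ _ "[(1, g)]"]) auto
    then show ?thesis unfolding K_def using closure_subset by blast
  qed
  have K_add: "x + y \<in> K" if xy: "x \<in> K" "y \<in> K" for x y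
  proof -
    obtain u v where "\<And>n. u n \<in> D" "u \<longlonglongrightarrow> x" "\<And>n. v n \<in> D" "v \<longlonglongrightarrow> y"
      using xy unfolding K_def closure_sequential by blast
    then show ?thesis unfolding K_def closure_sequential
      by (intro exI[of _ "\<lambda>n. u n + v n"]) (auto intro: D_add tendsto_add)
  qed
  have K_scale: "r *\<^sub>R x \<in> K" if x: "x \<in> K" for r x
  proof -
    obtain u where u: "\<And>n. u n \<in> D" "u \<longlonglongrightarrow> x"
      using x unfolding K_def closure_sequential by blast
    have "r \<in> closure \<rat>" using Rats_closure_real by simp
    then obtain q where q: "\<And>n. q n \<in> \<rat>" "q \<longlonglongrightarrow> r"
      unfolding closure_sequential by blast
    show ?thesis unfolding K_def closure_sequential
      by (intro exI[of _ "\<lambda>n. q n *\<^sub>R u n"]) (auto intro: D_scale tendsto_scaleR u q)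
  qed
  have K_indicator: "L2_of (\<lambda>x. c * indicator A x) \<in> K"
    if A: "A \<in> sets lborel" "emeasure lborel A < \<infinity>" and c: "c \<in> {1, \<i>}" for A c
  proof -
    have "\<exists>y\<in>K. dist y (L2_of (\<lambda>x. c * indicator A x)) < e" if "e > 0" for e
    proof -
      obtain U where U: "open U" "A \<subseteq> U" "U - A \<in> lmeasurable" "emeasure lebesgue (U - A) < ennreal (e\<^sup>2 / 2)"
        using sets_lebesgue_outer_open[of A "e\<^sup>2 / 2"] A \<open>e > 0\<close> by auto
      have [measurable]: "U \<in> sets lborel" "A \<in> sets lborel" using U(1) A by auto
      have "U - A \<in> sets lborel" by measurable
      have UA: "emeasure lborel (U - A) < ennreal (e\<^sup>2 / 2)"
        using U(4) \<open>U - A \<in> sets lborel\<close> by simp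
      have "emeasure lborel U = emeasure lborel (U - A) + emeasure lborel A"
        using U(2) A(1) \<open>U - A \<in> sets lborel\<close> by (subst plus_emeasure) (auto intro!: arg_cong[of _ _ "emeasure lborel"])
      also have "\<dots> < \<infinity>"
        using UA A(2) by (auto simp: less_top[symmetric] top_unique)
      finally have U_fin: "emeasure lborel U < \<infinity>" .
      have UA': "measure lborel (U - A) < e\<^sup>2 / 2"
      proof -
        have "emeasure lborel (U - A) = ennreal (measure lborel (U - A))"
          using UA by (intro emeasure_eq_ennreal_measure) auto
        then show ?thesis using UA by (simp add: ennreal_less_iff)
      qed
      obtain \<B>' where \<B>': "\<B>' \<subseteq> \<B>" "\<Union>\<B>' = U"
        using \<B>(2) U(1) unfolding topological_basis_def by blast
      have "countable (insert {} \<B>')" using \<B>(1) \<B>'(1) by (auto intro: countable_subset)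
      then obtain b :: "nat \<Rightarrow> 'a set" where b: "range b = insert {} \<B>'"
        using range_from_nat_into[of "insert {} \<B>'"] by (metis insert_not_empty)
      define V where "V n = (\<Union>i<n. b i)" for n :: nat
      have b_in: "b i \<in> insert {} \<B>'" for i using b by blast
      then have b_sub: "b i \<subseteq> U" for i using \<B>'(2) by blast
      have b_open: "open (b i)" for i
        using b_in[of i] \<B>'(1) topological_basis_open[OF \<B>(2)] by auto
      have V_sets [measurable]: "V n \<in> sets lborel" for n
        using b_open by (auto simp: V_def intro!: borel_open open_UN)
      have VU: "V n \<subseteq> U" for n
        using b_sub by (auto simp: V_def)
      have UN_V: "(\<Union>n. V n) = U"
      proof -
        have "(\<Union>n. V n) = \<Union>(range b)" by (auto simp: V_def)
        then show ?thesis using b \<B>'(2) by simp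
      qed
      have "(\<lambda>n. measure lborel (V n)) \<longlonglongrightarrow> measure lborel (\<Union>n. V n)"
      proof (rule Lim_measure_incseq)
        show "range V \<subseteq> sets lborel" using V_sets by blast
        show "incseq V" unfolding incseq_def V_def by (fastforce intro: less_le_trans)
        show "emeasure lborel (\<Union>n. V n) \<noteq> \<infinity>" using U_fin UN_V by simp
      qed
      then have "\<forall>\<^sub>F n in sequentially. measure lborel U - e\<^sup>2 / 2 < measure lborel (V n)"
        unfolding UN_V using \<open>e > 0\<close> by (intro order_tendstoD(1)) auto
      then obtain n where n: "measure lborel U - e\<^sup>2 / 2 < measure lborel (V n)"
        by (auto simp: eventually_sequentially)
      have "measure lborel (U - V n) = measure lborel U - measure lborel (V n)"
        using U_fin VU[of n] by (intro measure_Diff) (use V_sets \<open>U \<in> sets lborel\<close> in \<open>auto simp: less_top\<close>)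
      then have UV: "measure lborel (U - V n) < e\<^sup>2 / 2" using n by simp
      have "V n = \<Union>((b ` {..<n}) - {{}})" by (auto simp: V_def)
      moreover have "(b ` {..<n}) - {{}} \<subseteq> \<B>" using b_in \<B>'(1) by blast
      ultimately have "L2_of (\<lambda>x. c * indicator (V n) x) \<in> G"
        unfolding G_def using c by (intro image_eqI[of _ _ "(c, (b ` {..<n}) - {{}})"]) auto
      moreover have "(dist (L2_of (\<lambda>x. c * indicator (V n) x)) (L2_of (\<lambda>x. c * indicator A x)))\<^sup>2 < e\<^sup>2"
      proof -
        have "norm c = 1" using c by auto
        then have "(norm (L2_of (\<lambda>x. c * indicator A x) - L2_of (\<lambda>x. c * indicator (V n) x)))\<^sup>2
            \<le> measure lborel (U - A) + measure lborel (U - V n)"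
          using norm_L2_indicator_diff[OF A(1) V_sets[of n] \<open>U \<in> sets lborel\<close> U(2) VU[of n] U_fin, of c]
          by simp
        then show ?thesis using UA' UV by (simp add: dist_norm norm_minus_commute)
      qed
      then have "dist (L2_of (\<lambda>x. c * indicator (V n) x)) (L2_of (\<lambda>x. c * indicator A x)) < e"
        by (rule power2_less_imp_less) (use \<open>e > 0\<close> in simp)
      ultimately show ?thesis using G_K by blast
    qed
    then have "L2_of (\<lambda>x. c * indicator A x) \<in> closure K"
      unfolding closure_approachable by blast
    then show ?thesis using \<open>closed K\<close> by simp
  qed
  have K_indicator': "L2_of (\<lambda>x. c * indicator A x) \<in> K"
    if A: "A \<in> sets lborel" "emeasure lborel A < \<infinity>" for A c
  proof -
    have "(\<lambda>x. c * indicator A x) =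
        (\<lambda>x. Re c *\<^sub>R (1 * indicator A x) + Im c *\<^sub>R (\<i> * indicator A x))"
      by (auto simp: fun_eq_iff indicator_def complex_eq_iff)
    then have "L2_of (\<lambda>x. c * indicator A x) =
        L2_of (\<lambda>x. Re c *\<^sub>R (1 * indicator A x) + Im c *\<^sub>R (\<i> * indicator A x))"
      by (rule arg_cong)
    also have "\<dots> = Re c *\<^sub>R L2_of (\<lambda>x. 1 * indicator A x) + Im c *\<^sub>R L2_of (\<lambda>x. \<i> * indicator A x)"
      by (simp only: L2_of_add L2_of_scaleR L2_fun_scaleR L2_fun_indicator[OF A])
    also have "\<dots> \<in> K"
      by (intro K_add K_scale K_indicator A) auto
    finally show ?thesis .
  qed
  have zero_K: "0 \<in> K" using K_indicator'[of "{}" 0] by (simp add: L2_of_zero)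
  have K_sum: "(\<lambda>x. \<Sum>y\<in>Y. y * indicator (A y) x) \<in> L2_fun \<and> L2_of (\<lambda>x. \<Sum>y\<in>Y. y * indicator (A y) x) \<in> K"
    if "finite Y" "\<And>y. y \<in> Y \<Longrightarrow> A y \<in> sets lborel" "\<And>y. y \<in> Y \<Longrightarrow> emeasure lborel (A y) < \<infinity>"
    for Y :: "complex set" and A
    using that
  proof (induction Y rule: finite_induct)
    case empty
    then show ?case by (simp add: L2_fun_zero L2_of_zero zero_K)
  next
    case (insert y Y)
    have "(\<lambda>x. y * indicator (A y) x) \<in> L2_fun" "L2_of (\<lambda>x. y * indicator (A y) x) \<in> K"
      using insert.prems by (auto intro: L2_fun_indicator K_indicator')
    moreover have "(\<lambda>x. \<Sum>y\<in>Y. y * indicator (A y) x) \<in> L2_fun"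
        "L2_of (\<lambda>x. \<Sum>y\<in>Y. y * indicator (A y) x) \<in> K"
      using insert.IH insert.prems by auto
    ultimately show ?case
      unfolding sum.insert[OF insert.hyps] by (simp only: L2_fun_add L2_of_add K_add simp_thms)
  qed
  have "g \<in> K" for g
  proof -
    define f where "f = rep_L2 g"
    have f: "f \<in> L2_fun" by (simp add: f_def rep_L2_fun)
    then have [measurable]: "f \<in> borel_measurable lborel" by (simp add: L2_fun_def)
    obtain F where F: "\<And>i. simple_function lborel (F i)" "\<And>x. (\<lambda>i. F i x) \<longlonglongrightarrow> f x"
      "\<And>i x. norm (F i x) \<le> 2 * norm (f x)"
      using borel_measurable_implies_sequence_metric[of f lborel 0] by auto
    have [measurable]: "F i \<in> borel_measurable lborel" for i
      using F(1) by (rule borel_measurable_simple_function)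
    have f_int: "integrable lborel (\<lambda>x. (norm (f x))\<^sup>2)" using f by (simp add: L2_fun_def)
    have F_fun: "F i \<in> L2_fun" for i
    proof -
      have "integrable lborel (\<lambda>x. (norm (F i x))\<^sup>2)"
      proof (rule Bochner_Integration.integrable_bound)
        show "integrable lborel (\<lambda>x. 4 * (norm (f x))\<^sup>2)" using f_int by simp
        have "(norm (F i x))\<^sup>2 \<le> 4 * (norm (f x))\<^sup>2" for x
          using power_mono[OF F(3)[of i x] norm_ge_zero, of 2] by (simp add: power_mult_distrib)
        then show "AE x in lborel. norm ((norm (F i x))\<^sup>2) \<le> norm (4 * (norm (f x))\<^sup>2)"
          by (intro AE_I2) auto
      qed measurable
      then show ?thesis by (simp add: L2_fun_def)
    qed
    have F_K: "L2_of (F i) \<in> K" for i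
    proof -
      let ?Y = "F i ` UNIV - {0}" and ?A = "\<lambda>y. F i -` {y}"
      have "finite ?Y" using F(1)[of i] by (simp add: simple_function_def)
      moreover have "?A y \<in> sets lborel" for y
        using measurable_sets[of "F i" lborel borel "{y}"] by auto
      moreover have "emeasure lborel (?A y) < \<infinity>" if "y \<in> ?Y" for y
      proof -
        have "emeasure lborel (?A y) * ennreal ((norm y)\<^sup>2) = (\<integral>\<^sup>+x. ennreal ((norm y)\<^sup>2) * indicator (?A y) x \<partial>lborel)"
          using \<open>?A y \<in> sets lborel\<close> by (simp add: nn_integral_cmult_indicator mult.commute)
        also have "\<dots> \<le> (\<integral>\<^sup>+x. ennreal ((norm (F i x))\<^sup>2) \<partial>lborel)"
          by (intro nn_integral_mono) (auto simp: indicator_def)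
        also have "\<dots> < \<infinity>" using F_fun[of i] by (simp add: L2_fun_def integrable_iff_bounded)
        finally show ?thesis using that
          by (auto simp: ennreal_mult_eq_top_iff less_top[symmetric])
      qed
      ultimately have "L2_of (\<lambda>x. \<Sum>y\<in>?Y. y * indicator (?A y) x) \<in> K"
        using K_sum[of ?Y ?A] by blast
      moreover have "(\<lambda>x. \<Sum>y\<in>?Y. y * indicator (?A y) x) = F i"
      proof
        fix x
        have "(\<Sum>y\<in>?Y. y * indicator (?A y) x) = (\<Sum>y\<in>?Y. if F i x = y then y else 0)"
          by (rule sum.cong) (simp_all add: indicator_def)
        also have "\<dots> = F i x"
          using \<open>finite ?Y\<close> by (subst sum.delta') auto
        finally show "(\<Sum>y\<in>?Y. y * indicator (?A y) x) = F i x" .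
      qed
      ultimately show ?thesis by simp
    qed
    have "(\<lambda>i. \<integral>x. (norm (F i x - f x))\<^sup>2 \<partial>lborel) \<longlonglongrightarrow> integral\<^sup>L lborel (\<lambda>x::'a. 0)"
    proof (rule integral_dominated_convergence[where w = "\<lambda>x. 9 * (norm (f x))\<^sup>2"])
      show "integrable lborel (\<lambda>x. 9 * (norm (f x))\<^sup>2)" using f_int by simp
      show "AE x in lborel. (\<lambda>i. (norm (F i x - f x))\<^sup>2) \<longlonglongrightarrow> 0"
      proof (rule AE_I2)
        fix x
        have "(\<lambda>i. (norm (F i x - f x))\<^sup>2) \<longlonglongrightarrow> (norm (f x - f x))\<^sup>2"
          by (intro tendsto_intros F)
        then show "(\<lambda>i. (norm (F i x - f x))\<^sup>2) \<longlonglongrightarrow> 0" by simp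
      qed
      show "AE x in lborel. norm ((norm (F i x - f x))\<^sup>2) \<le> 9 * (norm (f x))\<^sup>2" for i
      proof (rule AE_I2)
        fix x
        have "norm (F i x - f x) \<le> 3 * norm (f x)"
          using norm_triangle_ineq4[of "F i x" "f x"] F(3)[of i x] by simp
        from power_mono[OF this norm_ge_zero, of 2]
        show "norm ((norm (F i x - f x))\<^sup>2) \<le> 9 * (norm (f x))\<^sup>2" by (simp add: power_mult_distrib)
      qed
    qed measurable
    moreover have "(\<integral>x. (norm (F i x - f x))\<^sup>2 \<partial>lborel) = (norm (L2_of (F i) - g))\<^sup>2" for i
      using norm_L2_of[OF L2_fun_diff[OF F_fun f], of i]
      by (simp add: L2_of_diff F_fun f) (simp add: f_def)
    ultimately have "(\<lambda>i. (norm (L2_of (F i) - g))\<^sup>2) \<longlonglongrightarrow> 0" by simp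
    then have "(\<lambda>i. sqrt ((norm (L2_of (F i) - g))\<^sup>2)) \<longlonglongrightarrow> sqrt 0" by (rule tendsto_real_sqrt)
    then have "(\<lambda>i. L2_of (F i)) \<longlonglongrightarrow> g" by (simp add: LIM_zero_iff tendsto_norm_zero_iff)
    then show "g \<in> K"
      using closed_sequentially[OF \<open>closed K\<close>, of "\<lambda>i. L2_of (F i)" g] F_K by simp
  qed
  then have "closure D = UNIV" by (auto simp: K_def)
  with \<open>countable D\<close> show ?thesis by blast
qed

instance L2 :: (euclidean_space) second_countable_topology
proof
  obtain D :: "'a L2 set" where D: "countable D" "closure D = UNIV"
    using L2_separable by blast
  define B where "B = (\<lambda>(d, n). ball d (1 / real (Suc n))) ` (D \<times> (UNIV :: nat set))"
  have "topological_basis B"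
  proof (rule topological_basisI)
    show "open U" if "U \<in> B" for U
      using that by (auto simp: B_def)
    fix U :: "'a L2 set" and x
    assume "open U" "x \<in> U"
    then obtain e where e: "e > 0" "ball x e \<subseteq> U" by (auto simp: open_contains_ball)
    obtain n where n: "1 / real (Suc n) < e / 2"
      using nat_approx_posE[of "e / 2"] \<open>e > 0\<close> by auto
    obtain d where d: "d \<in> D" "dist d x < 1 / real (Suc n)"
      using D(2) closure_approachable[of x D] by (auto dest: spec[of _ "1 / real (Suc n)"])
    have "ball d (1 / real (Suc n)) \<subseteq> ball x e"
    proof
      fix y assume "y \<in> ball d (1 / real (Suc n))"
      then show "y \<in> ball x e"
        using d n dist_triangle[of x y d] by (simp add: dist_commute)
    qed
    then show "\<exists>V\<in>B. x \<in> V \<and> V \<subseteq> U"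
      using d e by (intro bexI[of _ "ball d (1 / real (Suc n))"]) (auto simp: B_def)
  qed
  moreover have "countable B" using D(1) by (simp add: B_def)
  ultimately show "\<exists>B::'a L2 set set. countable B \<and> open = generate_topology B"
    by (blast intro: topological_basis_imp_subbasis)
qed

definition cscale_L2 :: "complex \<Rightarrow> 'a::euclidean_space L2 \<Rightarrow> 'a L2" where
  "cscale_L2 c f = L2_of (\<lambda>x. c * rep_L2 f x)"

definition abs_powr :: "real \<Rightarrow> ('a \<Rightarrow> complex) \<Rightarrow> 'a \<Rightarrow> complex" where
  "abs_powr p f = (\<lambda>x. complex_of_real (norm (f x) powr p))"

text \<open>Borel measurability is strong measurability here, the type being separable.\<close>

definition Linfty_L2 :: "real \<Rightarrow> (real \<Rightarrow> 'a::euclidean_space L2) \<Rightarrow> bool" where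
  "Linfty_L2 b u \<longleftrightarrow> u \<in> borel_measurable (restrict_space lborel {0<..<b}) \<and>
     (\<exists>C. AE s in lborel. s \<in> {0<..<b} \<longrightarrow> norm (u s) \<le> C)"


section \<open>Laguerre polynomials\<close>

text \<open>Rodrigues' formula is only meaningful for \<^term>\<open>t > 0\<close> (it divides by \<^term>\<open>t ^ \<delta>\<close>);
  the polynomial is determined by its values there.\<close>

definition laguerre :: "nat \<Rightarrow> nat \<Rightarrow> real poly" where
  "laguerre \<delta> k = (THE q. \<forall>t>0. poly q t =
     exp t / (t ^ \<delta> * fact k) * (deriv ^^ k) (\<lambda>s. exp (- s) * s ^ (k + \<delta>)) t)"

lemma poly_laguerre:
  assumes "t > 0"
  shows "poly (laguerre \<delta> k) t =
    exp t / (t ^ \<delta> * fact k) * (deriv ^^ k) (\<lambda>s::real. exp (- s) * s ^ (k + \<delta>)) t"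
proof -
  let ?P = "\<lambda>q. \<forall>t>0. poly q t =
     exp t / (t ^ \<delta> * fact k) * (deriv ^^ k) (\<lambda>s::real. exp (- s) * s ^ (k + \<delta>)) t"
  have "\<exists>r. (deriv ^^ j) (\<lambda>s::real. exp (- s) * s ^ (k + \<delta>)) = (\<lambda>s::real. exp (- s) * poly (monom 1 (k + \<delta> - j) * r) s)"
    if "j \<le> k" for j
    using that
  proof (induction j)
    case 0
    show ?case by (intro exI[of _ 1]) (simp add: poly_monom)
  next
    case (Suc j)
    from Suc.IH[OF Suc_leD[OF Suc.prems]] obtain r where r: "(deriv ^^ j) (\<lambda>s::real. exp (- s) * s ^ (k + \<delta>)) =
        (\<lambda>s::real. exp (- s) * poly (monom 1 (k + \<delta> - j) * r) s)"
      ..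
    define N where "N = k + \<delta> - Suc j"
    have N: "k + \<delta> - j = Suc N" using Suc.prems by (simp add: N_def)
    let ?q = "monom 1 (Suc N) * r"
    have "deriv (\<lambda>s::real. exp (- s) * poly ?q s) s = exp (- s) * poly (pderiv ?q - ?q) s" for s :: real
      by (rule DERIV_imp_deriv)
        (auto intro!: derivative_eq_intros poly_DERIV simp: pderiv_mult algebra_simps)
    moreover have "poly (pderiv ?q - ?q) s =
        poly (monom 1 N * (smult (of_nat (Suc N)) r + [:0, 1:] * pderiv r - [:0, 1:] * r)) s" for s
      by (simp add: pderiv_mult pderiv_monom poly_monom) (simp add: algebra_simps)
    ultimately have "(deriv ^^ Suc j) (\<lambda>s::real. exp (- s) * s ^ (k + \<delta>)) =
        (\<lambda>s::real. exp (- s) * poly (monom 1 N * (smult (of_nat (Suc N)) r + [:0, 1:] * pderiv r - [:0, 1:] * r)) s)"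
      unfolding funpow.simps o_apply r N by presburger
    then show ?case unfolding N_def by blast
  qed
  from this[OF order_refl] obtain r where r: "(deriv ^^ k) (\<lambda>s::real. exp (- s) * s ^ (k + \<delta>)) =
      (\<lambda>s::real. exp (- s) * poly (monom 1 \<delta> * r) s)"
    unfolding add_diff_cancel_left' ..
  have "?P (smult (1 / fact k) r)"
    unfolding r by (simp add: poly_monom exp_minus)
  moreover have "p = q" if "?P p" "?P q" for p q
  proof -
    have "{0<..} \<subseteq> {t. poly (p - q) t = 0}" using that by auto
    then have "infinite {t. poly (p - q) t = 0}"
      using infinite_Ioi finite_subset by blast
    then show ?thesis using poly_roots_finite[of "p - q"] by auto
  qed
  ultimately have "\<exists>!q. ?P q" by blast
  then have "?P (laguerre \<delta> k)"
    unfolding laguerre_def by (rule theI')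
  then show ?thesis using assms by blast
qed


section \<open>The Heisenberg group and its sublaplacian\<close>

type_synonym 'n heis = "(complex ^ 'n) \<times> real"

definition heis_mult :: "'n::finite heis \<Rightarrow> 'n heis \<Rightarrow> 'n heis" where
  "heis_mult p q = (fst p + fst q,
     snd p + snd q + 1/2 * Im (\<Sum>i\<in>UNIV. fst p $ i * cnj (fst q $ i)))"

definition heis_inv :: "'n::finite heis \<Rightarrow> 'n heis" where
  "heis_inv p = (- fst p, - snd p)"

definition dderiv :: "'a::real_normed_vector \<Rightarrow> ('a \<Rightarrow> complex) \<Rightarrow> 'a \<Rightarrow> complex" where
  "dderiv v f p = frechet_derivative f (at p) v"

definition smooth :: "('a::real_normed_vector \<Rightarrow> complex) \<Rightarrow> bool" where
  "smooth f \<longleftrightarrow> (\<forall>vs p. foldr dderiv vs f differentiable (at p))"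

definition test_fun :: "('a::real_normed_vector \<Rightarrow> complex) \<Rightarrow> bool" where
  "test_fun f \<longleftrightarrow> smooth f \<and> compact (closure {p. f p \<noteq> 0})"

definition field_X :: "'n \<Rightarrow> ('n::finite heis \<Rightarrow> complex) \<Rightarrow> 'n heis \<Rightarrow> complex" where
  "field_X i f p = dderiv (axis i 1, 0) f p + of_real (1/2 * Im (fst p $ i)) * dderiv (0, 1) f p"

definition field_Y :: "'n \<Rightarrow> ('n::finite heis \<Rightarrow> complex) \<Rightarrow> 'n heis \<Rightarrow> complex" where
  "field_Y i f p = dderiv (axis i \<i>, 0) f p - of_real (1/2 * Re (fst p $ i)) * dderiv (0, 1) f p"

definition sublaplacian :: "('n::finite heis \<Rightarrow> complex) \<Rightarrow> 'n heis \<Rightarrow> complex" where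
  "sublaplacian f p = - (\<Sum>i\<in>UNIV. field_X i (field_X i f) p + field_Y i (field_Y i f) p)"

text \<open>The sublaplacian is essentially self-adjoint on the smooth compactly supported functions;
  as an unbounded operator on \<open>L\<^sup>2\<close> it is the closure given by the following graph.\<close>

definition sublaplacian_graph :: "('n::finite heis L2 \<times> 'n heis L2) set" where
  "sublaplacian_graph = closure {(L2_of f, L2_of (sublaplacian f)) | f. test_fun f}"

definition contraction_semigroup :: "(real \<Rightarrow> 'a::euclidean_space L2 \<Rightarrow> 'a L2) \<Rightarrow> bool" where
  "contraction_semigroup S \<longleftrightarrow>
     (\<forall>s\<ge>0. linear (S s) \<and> (\<forall>c f. S s (cscale_L2 c f) = cscale_L2 c (S s f)) \<and>
        (\<forall>f. norm (S s f) \<le> norm f)) \<and>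
     (\<forall>f. S 0 f = f) \<and>
     (\<forall>s\<ge>0. \<forall>t\<ge>0. \<forall>f. S (s + t) f = S s (S t f)) \<and>
     (\<forall>f. ((\<lambda>s. S s f) \<longlongrightarrow> f) (at_right 0))"

definition generator_graph :: "(real \<Rightarrow> 'a::euclidean_space L2 \<Rightarrow> 'a L2) \<Rightarrow> ('a L2 \<times> 'a L2) set" where
  "generator_graph S = {(f, g). ((\<lambda>h. (1 / h) *\<^sub>R (S h f - f)) \<longlongrightarrow> g) (at_right 0)}"

text \<open>\<open>S s\<close> is \<open>exp (- s (L + d I))\<close>, with \<open>L\<close> the sublaplacian.\<close>

definition sublaplacian_semigroup :: "real \<Rightarrow> (real \<Rightarrow> 'n::finite heis L2 \<Rightarrow> 'n heis L2) \<Rightarrow> bool" where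
  "sublaplacian_semigroup d S \<longleftrightarrow> contraction_semigroup S \<and>
     generator_graph S = {(f, - (g + d *\<^sub>R f)) | f g. (f, g) \<in> sublaplacian_graph}"


section \<open>The Strichartz Fourier transform on the Heisenberg fan\<close>

definition fan_ray :: "nat \<Rightarrow> nat \<Rightarrow> (real \<times> real) set" where
  "fan_ray n k = {(l, (2 * real k + real n) * \<bar>l\<bar>) | l. l \<noteq> 0}"

definition fan_limit_ray :: "(real \<times> real) set" where
  "fan_limit_ray = {0} \<times> {0..}"

definition heis_fan :: "nat \<Rightarrow> (real \<times> real) set" where
  "heis_fan n = (\<Union>k. fan_ray n k) \<union> fan_limit_ray"

definition fan_index :: "nat \<Rightarrow> real \<times> real \<Rightarrow> nat" where
  "fan_index n a = (THE k. a \<in> fan_ray n k)"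

definition fan_const :: "nat \<Rightarrow> nat \<Rightarrow> real" where
  "fan_const n k = fact k * fact (n - 1) / fact (k + n - 1)"

definition laguerre_fun :: "nat \<Rightarrow> real \<Rightarrow> complex ^ 'n::finite \<Rightarrow> real" where
  "laguerre_fun k l z =
     poly (laguerre (CARD('n) - 1) k) (1/2 * \<bar>l\<bar> * (norm z)\<^sup>2) * exp (- (1/4) * \<bar>l\<bar> * (norm z)\<^sup>2)"

definition fan_char :: "real \<times> real \<Rightarrow> 'n::finite heis \<Rightarrow> complex" where
  "fan_char a p = exp (\<i> * of_real (fst a * snd p)) *
     of_real (laguerre_fun (fan_index CARD('n) a) (fst a) (fst p))"

text \<open>The value on the limit ray is a junk value; that ray is a null set for both measures below.\<close>

definition strichartz :: "('n::finite heis \<Rightarrow> complex) \<Rightarrow> real \<times> real \<Rightarrow> complex ^ 'n \<Rightarrow> complex" where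
  "strichartz f a w =
     (if a \<in> fan_limit_ray then 0
      else of_real (fan_const CARD('n) (fan_index CARD('n) a)) *
        (\<integral>p. f p * fan_char a (heis_mult (heis_inv p) (w, 0)) \<partial>lborel))"

definition fan_nu2 :: "nat \<Rightarrow> (real \<times> real) measure" where
  "fan_nu2 n = distr
     (density (lborel \<Otimes>\<^sub>M count_space UNIV)
       (\<lambda>(l, k). ennreal (1 / (2 * pi) ^ (2 * n + 1) * (1 / (fan_const n k)\<^sup>2) * \<bar>l\<bar> ^ (2 * n))))
     (restrict_space borel (heis_fan n))
     (\<lambda>(l, k). (l, (2 * real k + real n) * \<bar>l\<bar>))"

lemma nn_integral_fan_nu2:
  assumes "\<phi> \<in> borel_measurable (restrict_space borel (heis_fan n))"
  shows "(\<integral>\<^sup>+a. \<phi> a \<partial>fan_nu2 n) = (\<integral>\<^sup>+l. (\<Sum>k.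
     ennreal (1 / (2 * pi) ^ (2 * n + 1) * (1 / (fan_const n k)\<^sup>2) * \<bar>l\<bar> ^ (2 * n)) *
     \<phi> (l, (2 * real k + real n) * \<bar>l\<bar>)) \<partial>lborel)"
proof -
  interpret C: sigma_finite_measure "count_space (UNIV :: nat set)"
    by (rule sigma_finite_measure_count_space)
  have [measurable]: "(\<lambda>(l, k). (l, (2 * real k + real n) * \<bar>l\<bar>))
      \<in> lborel \<Otimes>\<^sub>M count_space UNIV \<rightarrow>\<^sub>M restrict_space borel (heis_fan n)"
  proof (rule measurable_restrict_space2)
    show "(\<lambda>(l, k). (l, (2 * real k + real n) * \<bar>l\<bar>))
        \<in> space (lborel \<Otimes>\<^sub>M count_space UNIV) \<rightarrow> heis_fan n"
      by (force simp: heis_fan_def fan_ray_def fan_limit_ray_def)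
  qed measurable
  have [measurable]: "(\<lambda>(l, k). ennreal (1 / (2 * pi) ^ (2 * n + 1) * (1 / (fan_const n k)\<^sup>2) * \<bar>l\<bar> ^ (2 * n)))
      \<in> borel_measurable (lborel \<Otimes>\<^sub>M count_space UNIV)"
    by measurable
  note assms[measurable]
  show ?thesis
    unfolding fan_nu2_def
    by (subst nn_integral_distr, measurable, simp, subst nn_integral_density, measurable,
        subst C.nn_integral_fst[symmetric], measurable,
        simp add: nn_integral_count_space_nat case_prod_beta)
qed

definition fan_mu :: "nat \<Rightarrow> (real \<times> real) measure" where
  "fan_mu n = density (fan_nu2 n) (\<lambda>a. ennreal (1 / \<bar>fst a\<bar> ^ n))"

text \<open>\<open>G\<close> is a representative of the transform of \<open>f\<close>, where the transform is extended by continuity from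
  \<open>L\<^sup>1 \<inter> L\<^sup>2\<close> to a map of \<open>L\<^sup>2\<close> into \<open>L\<^sup>2(d\<nu>\<^sub>2 dw)\<close>.\<close>

definition strichartz_L2 ::
    "'n::finite heis L2 \<Rightarrow> ((real \<times> real) \<times> (complex ^ 'n) \<Rightarrow> complex) \<Rightarrow> bool" where
  "strichartz_L2 f G \<longleftrightarrow>
     G \<in> borel_measurable (fan_nu2 CARD('n) \<Otimes>\<^sub>M lborel) \<and>
     (\<integral>\<^sup>+x. ennreal ((norm (G x))\<^sup>2) \<partial>(fan_nu2 CARD('n) \<Otimes>\<^sub>M lborel)) < \<infinity> \<and>
     (\<exists>\<phi>. (\<forall>j. \<phi> j \<in> L2_fun \<and> integrable lborel (\<phi> j)) \<and>
        (\<lambda>j. L2_of (\<phi> j)) \<longlonglongrightarrow> f \<and>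
        (\<lambda>j. \<integral>\<^sup>+x. ennreal ((norm (strichartz (\<phi> j) (fst x) (snd x) - G x))\<^sup>2)
               \<partial>(fan_nu2 CARD('n) \<Otimes>\<^sub>M lborel)) \<longlonglongrightarrow> (0::ennreal))"

definition fourier_multiplier_op ::
    "(real \<times> real \<Rightarrow> complex) \<Rightarrow> ('n::finite heis L2 \<Rightarrow> 'n heis L2) \<Rightarrow> bool" where
  "fourier_multiplier_op m T \<longleftrightarrow>
     (\<forall>f. \<exists>G. strichartz_L2 f G \<and> strichartz_L2 (T f) (\<lambda>x. m (fst x) * G x))"

end

theory Submission
  imports Defs "HOL-Probability.Characteristic_Functions"
begin

text \<open>The multiplier \<open>T\<close> maps \<open>L\<^sup>2\<close> boundedly into \<open>L\<^bsup>2p\<^esup>\<close>, so \<open>u \<mapsto> \<bar>T u\<bar>\<^bsup>p\<^esup>\<close> is locally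
  Lipschitz on \<open>L\<^sup>2\<close> and both equations are solved by Picard iteration. By duality and Parseval, boundedness
  of \<open>T\<close> means that \<open>g \<mapsto> m F g\<close> maps \<open>L\<^bsup>(2p)'\<^esup>\<close> into \<open>L\<^sup>2(d\<nu>\<^sub>2 dw)\<close>. This follows by real
  interpolation from Plancherel and from the bound
  \<open>\<integral> \<bar>F g(a, w)\<bar>\<^sup>2 dw \<le> (2\<pi> / \<bar>\<lambda>\<bar>)\<^bsup>n\<^esup> \<parallel>g\<parallel>\<^sub>1\<^sup>2\<close>, which turns \<open>\<nu>\<^sub>2\<close> into \<open>\<mu>\<close>.

  Plancherel reduces to the twisted convolutions with the Laguerre functions \<open>\<phi>\<^sub>k\<close>. Their generating
  function (in \<open>r\<close>) is the Mehler kernel, a Gaussian; comparing coefficients in its semigroup law shows that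
  convolution with \<open>\<phi>\<^sub>k\<close> is a multiple of an orthogonal projection, and completeness follows because
  the Mehler kernel is an approximate identity as \<open>r \<rightarrow> 1\<close>.\<close>

section \<open>Laguerre polynomials\<close>

text \<open>The hypothesis places \<open>m\<close> in weak L^(2p/(p-1)) of \<mu>, since 1/2 - 1/(2p)
  = (p-1)/(2p). This is why the interpolation is of Marcinkiewicz type, carried out on the
  superlevel sets of |m|. The Mehler kernel is used at both ends of its parameter. Near r = 0 the
  Laguerre series is dominated by a Gaussian, which permits termwise integration and identifies
  coefficients. As r tends to 1 this domination is lost. There the sharp bound of a Laguerre
  function by its value at 0, itself a consequence of idempotency, dominates the series against
  compactly supported functions, and positivity of the squared norms removes the Abel factor r^k. As
  the value at 0 is 1 / c_{n,k}, the same bound makes the normalized kernel bounded by 1, so the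
  transform is pointwise continuous on L^1. On L^2 the transform is given only as a limit, and T
  only through it. Hence Parseval is proved against functions in both L^1 and L^2, and the L^(2p)
  norm is tested against bounded functions of bounded support.\<close>

lemma coeff_iterate_pderiv_minus:
  "coeff (((\<lambda>q. pderiv q - q) ^^ j) (monom (1::real) m)) l =
     (if l \<le> m then (-1) ^ (l + j + m) * real (j choose (m - l)) * fact m / fact l else 0)"
proof (induction j arbitrary: l)
  case 0
  then show ?case by (auto simp: mult_2[symmetric])
next
  case (Suc j)
  consider "l < m" | "l = m" | "l > m" by linarith
  then show ?case
  proof cases
    case 1
    then have "m - l = Suc (m - Suc l)" by simp
    then show ?thesis using 1
      by (simp add: coeff_pderiv Suc.IH field_simps del: of_nat_Suc fact_Suc)
         (simp add: field_simps)
  qed (auto simp: coeff_pderiv Suc.IH)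
qed

text \<open>Moving the factor \<open>exp (- s)\<close> out of a derivative replaces d/ds by q -> q'
  - q, so Rodrigues' formula becomes a power of an operator on polynomials, whose coefficients the
  binomial expansion above supplies.\<close>

lemma deriv_exp_minus_poly:
  "(deriv ^^ j) (\<lambda>s::real. exp (- s) * poly q s) =
     (\<lambda>s. exp (- s) * poly (((\<lambda>q. pderiv q - q) ^^ j) q) s)"
proof (induction j)
  case (Suc j)
  have "deriv (\<lambda>s::real. exp (- s) * poly Q s) s = exp (- s) * poly (pderiv Q - Q) s" for Q s
    by (rule DERIV_imp_deriv) (auto intro!: derivative_eq_intros poly_DERIV simp: algebra_simps)
  then show ?case unfolding funpow.simps o_apply Suc.IH by (simp only: fun_eq_iff simp_thms)
qed auto

lemma laguerre_explicit:
  "laguerre \<delta> k = (\<Sum>i\<le>k. monom ((-1) ^ i * real ((k + \<delta>) choose (k - i)) / fact i) i)"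
proof -
  let ?q = "\<Sum>i\<le>k. monom ((-1) ^ i * real ((k + \<delta>) choose (k - i)) / fact i) i"
  let ?D = "((\<lambda>q. pderiv q - q) ^^ k) (monom (1::real) (k + \<delta>))"
  \<comment> \<open>Only \<open>k\<close> derivatives are taken of a monomial of degree
    \<open>k + \<delta>\<close>, so the factor t^\<delta> survives and cancels the division in
    Rodrigues' formula.\<close>
  have D: "?D = monom (fact k) \<delta> * ?q"
  proof (rule poly_eqI)
    fix l
    have q: "coeff ?q i = (if i \<le> k then (-1) ^ i * real ((k + \<delta>) choose (k - i)) / fact i else 0)" for i
      by (simp add: coeff_sum)
    show "coeff ?D l = coeff (monom (fact k) \<delta> * ?q) l"
    proof (cases "\<delta> \<le> l \<and> l \<le> k + \<delta>")
      case True
      then obtain i where i: "l = \<delta> + i" "i \<le> k" by (metis add.commute le_iff_add nat_add_left_cancel_le)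
      have "real (k choose (k - i)) * fact (k + \<delta>) / fact (\<delta> + i) = fact k * real ((k + \<delta>) choose (k - i)) / fact i"
      proof -
        have "k + \<delta> - (k - i) = \<delta> + i" using i by simp
        then show ?thesis
          using i by (simp add: binomial_fact field_simps)
      qed
      moreover have "(-1::real) ^ (\<delta> + i + k + (k + \<delta>)) = (-1) ^ i"
        by (auto simp: minus_one_power_iff)
      ultimately show ?thesis unfolding coeff_iterate_pderiv_minus coeff_monom_mult q using i
        by (simp only: if_True if_False le_add1 add_diff_cancel_left' mult.assoc times_divide_eq_right[symmetric])
          (simp add: mult.left_commute)
    next
      case False
      then show ?thesis unfolding coeff_iterate_pderiv_minus coeff_monom_mult q
        by (auto simp: binomial_eq_0)
    qed
  qed
  have "poly (laguerre \<delta> k) t = poly ?q t" if "t > 0" for t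
  proof -
    have "(\<lambda>s::real. exp (- s) * s ^ (k + \<delta>)) = (\<lambda>s. exp (- s) * poly (monom 1 (k + \<delta>)) s)"
      by (simp add: poly_monom)
    then have "(deriv ^^ k) (\<lambda>s::real. exp (- s) * s ^ (k + \<delta>)) t = exp (- t) * poly ?D t"
      by (metis deriv_exp_minus_poly)
    then have "(deriv ^^ k) (\<lambda>s::real. exp (- s) * s ^ (k + \<delta>)) t = exp (- t) * (fact k * t ^ \<delta> * poly ?q t)"
      unfolding D by (simp add: poly_monom)
    then show ?thesis using that unfolding poly_laguerre[OF that] by (simp add: exp_minus)
  qed
  then have "{0<..} \<subseteq> {t. poly (laguerre \<delta> k - ?q) t = 0}" by auto
  then have "infinite {t. poly (laguerre \<delta> k - ?q) t = 0}"
    using infinite_Ioi finite_subset by blast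
  then show ?thesis using poly_roots_finite[of "laguerre \<delta> k - ?q"] by auto
qed

lemma poly_laguerre_explicit:
  "poly (laguerre \<delta> k) x = (\<Sum>i\<le>k. (- x) ^ i / fact i * real ((k + \<delta>) choose (k - i)))"
  by (simp add: laguerre_explicit poly_sum poly_monom power_minus[of x] mult_ac)

lemma poly_laguerre_0: "poly (laguerre \<delta> k) 0 = real ((k + \<delta>) choose k)"
proof -
  have "poly (laguerre \<delta> k) 0 = (\<Sum>i\<le>k. if i = 0 then real ((k + \<delta>) choose k) else 0)"
    unfolding poly_laguerre_explicit by (rule sum.cong) auto
  then show ?thesis by simp
qed

text \<open>At -x every term of the explicit sum is nonnegative, so the value there is the sum of
  the absolute values. The majorant therefore has the same generating function, evaluated at
  -x.\<close>

lemma abs_poly_laguerre_le: "x \<ge> 0 \<Longrightarrow> \<bar>poly (laguerre \<delta> k) x\<bar> \<le> poly (laguerre \<delta> k) (- x)"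
  unfolding poly_laguerre_explicit
  by (intro order_trans[OF sum_abs] sum_mono) (auto simp: abs_mult)

text \<open>Newton's series with exponent -(N + 1), whose generalized binomial coefficients are
  ordinary ones up to sign.\<close>

lemma sums_binomial_inverse_power:
  assumes "\<bar>r\<bar> < (1::real)"
  shows "(\<lambda>m. real ((m + N) choose m) * r ^ m) sums (1 / (1 - r) ^ Suc N)"
proof -
  have "(\<lambda>m. ((- real (Suc N)) gchoose m) * (- r) ^ m) sums (1 + - r) powr (- real (Suc N))"
    using assms by (intro gen_binomial_real) auto
  moreover have "((- real (Suc N)) gchoose m) * (- r) ^ m = real ((m + N) choose m) * r ^ m" for m
  proof -
    have "((- real (Suc N)) gchoose m) = (-1) ^ m * real ((m + N) choose m)"
      by (subst gbinomial_minus) (simp add: binomial_gbinomial add_ac)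
    then show ?thesis by (simp add: power_minus' minus_one_power_iff)
  qed
  moreover have "(1 + - r) powr (- real (Suc N)) = 1 / (1 - r) ^ Suc N"
    using assms by (simp only: powr_minus powr_realpow) (simp add: field_simps powr_realpow del: of_nat_Suc power_Suc)
  ultimately show ?thesis by simp
qed

text \<open>Writing k = i + m and summing over m first leaves negative binomial series; the
  remaining sum over i is an exponential series in -r x / (1 - r).\<close>

lemma sums_poly_laguerre:
  assumes "\<bar>r\<bar> < (1::real)"
  shows "(\<lambda>k. r ^ k * poly (laguerre \<delta> k) x) sums (exp (- (r * x) / (1 - r)) / (1 - r) ^ Suc \<delta>)"
proof -
  define a where "a x r i m = (- x * r) ^ i / fact i * (real ((m + (i + \<delta>)) choose m) * r ^ m)" for x r :: real and i m
  have inner: "((\<lambda>m. a x r i m) has_sum ((- x * r / (1 - r)) ^ i / fact i / (1 - r) ^ Suc \<delta>)) UNIV"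
    if r: "\<bar>r\<bar> < 1" for x r i
  proof (rule norm_summable_imp_has_sum)
    have *: "(\<lambda>m. a x r i m) sums ((- x * r) ^ i / fact i * (1 / (1 - r) ^ Suc (i + \<delta>)))" if "\<bar>r\<bar> < 1" for x r
      unfolding a_def by (intro sums_mult sums_binomial_inverse_power that)
    have "norm (a x r i m) = a (- \<bar>x\<bar>) \<bar>r\<bar> i m" for m
      by (simp add: a_def abs_mult power_abs)
    then show "summable (\<lambda>m. norm (a x r i m))" using *[of "\<bar>r\<bar>" "- \<bar>x\<bar>"] r by (simp add: sums_iff)
    show "(\<lambda>m. a x r i m) sums ((- x * r / (1 - r)) ^ i / fact i / (1 - r) ^ Suc \<delta>)"
    proof -
      have "(- x * r) ^ i / fact i * (1 / (1 - r) ^ Suc (i + \<delta>)) = (- x * r / (1 - r)) ^ i / fact i / (1 - r) ^ Suc \<delta>"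
        unfolding power_Suc power_add power_divide by (simp only: times_divide_times_eq divide_divide_eq_left mult_ac mult_1)
      then show ?thesis using *[OF r, of x] by simp
    qed
  qed
  have outer: "((\<lambda>i. (- x * r / (1 - r)) ^ i / fact i / (1 - r) ^ Suc \<delta>) has_sum (exp (- (r * x) / (1 - r)) / (1 - r) ^ Suc \<delta>)) UNIV"
    for x r :: real
  proof (rule norm_summable_imp_has_sum)
    have *: "(\<lambda>i. y ^ i / fact i) sums exp y" for y :: real
      using exp_converges[of y] by (simp add: field_simps)
    show "(\<lambda>i. (- x * r / (1 - r)) ^ i / fact i / (1 - r) ^ Suc \<delta>) sums (exp (- (r * x) / (1 - r)) / (1 - r) ^ Suc \<delta>)"
    proof -
      have "- (r * x) / (1 - r) = - x * r / (1 - r)" by simp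
      then show ?thesis using *[of "- x * r / (1 - r)"] by (simp only: sums_divide)
    qed
    have "summable (\<lambda>i. \<bar>- x * r / (1 - r)\<bar> ^ i / fact i / \<bar>1 - r\<bar> ^ Suc \<delta>)"
      using sums_summable[OF *[of "\<bar>- x * r / (1 - r)\<bar>"]] by (rule summable_divide)
    moreover have "norm ((- x * r / (1 - r)) ^ i / fact i / (1 - r) ^ Suc \<delta>) =
        \<bar>- x * r / (1 - r)\<bar> ^ i / fact i / \<bar>1 - r\<bar> ^ Suc \<delta>" for i
      by (simp only: norm_divide norm_power norm_fact) (simp only: real_norm_def abs_divide)
    ultimately show "summable (\<lambda>i. norm ((- x * r / (1 - r)) ^ i / fact i / (1 - r) ^ Suc \<delta>))"
      by presburger
  qed
  \<comment> \<open>Replacing x by -|x| and r by |r| turns each term into its absolute value, so the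
    closed forms \<open>inner\<close> and \<open>outer\<close>, taken at these arguments, give
    absolute summability.\<close>
  have summ: "(\<lambda>(i, m). a x r i m) summable_on UNIV \<times> UNIV"
  proof (rule abs_summable_summable)
    have n: "norm (a x r i m) = a (- \<bar>x\<bar>) \<bar>r\<bar> i m" for i m
      by (simp add: a_def abs_mult power_abs)
    then have nn: "a (- \<bar>x\<bar>) \<bar>r\<bar> i m \<ge> 0" for i m by (metis norm_ge_zero)
    have "(\<lambda>(i, m). a (- \<bar>x\<bar>) \<bar>r\<bar> i m) summable_on UNIV \<times> UNIV"
      by (rule summable_on_SigmaI[where g = "\<lambda>i. (\<bar>x\<bar> * \<bar>r\<bar> / (1 - \<bar>r\<bar>)) ^ i / fact i / (1 - \<bar>r\<bar>) ^ Suc \<delta>"])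
        (use inner[of "\<bar>r\<bar>" "- \<bar>x\<bar>"] outer[of "- \<bar>x\<bar>" "\<bar>r\<bar>"] assms nn in \<open>auto simp: summable_on_def\<close>)
    then show "(\<lambda>im. norm ((\<lambda>(i, m). a x r i m) im)) summable_on UNIV \<times> UNIV"
      by (simp only: case_prod_beta' n)
  qed
  have "((\<lambda>(i, m). a x r i m) has_sum (exp (- (r * x) / (1 - r)) / (1 - r) ^ Suc \<delta>)) (UNIV \<times> UNIV)"
    by (rule has_sum_SigmaI[OF _ outer summ]) (use inner[OF assms] in auto)
  moreover have "bij_betw (\<lambda>(k, i). (i, k - i)) (SIGMA k:UNIV. {..k::nat}) (UNIV \<times> UNIV)"
    by (rule bij_betwI[where g = "\<lambda>(i, m). (i + m, i)"]) auto
  ultimately have "((\<lambda>(k, i). a x r i (k - i)) has_sum (exp (- (r * x) / (1 - r)) / (1 - r) ^ Suc \<delta>)) (SIGMA k:UNIV. {..k})"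
    using has_sum_reindex_bij_betw[of "\<lambda>(k, i). (i, k - i)" "SIGMA k:UNIV. {..k::nat}" "UNIV \<times> UNIV" "\<lambda>(i, m). a x r i m"]
    by (simp add: case_prod_beta')
  then have "((\<lambda>k. \<Sum>i\<le>k. a x r i (k - i)) has_sum (exp (- (r * x) / (1 - r)) / (1 - r) ^ Suc \<delta>)) UNIV"
    by (rule has_sum_SigmaD) (auto intro: has_sum_finite)
  moreover have "(\<Sum>i\<le>k. a x r i (k - i)) = r ^ k * poly (laguerre \<delta> k) x" for k
    unfolding poly_laguerre_explicit sum_distrib_left
  proof (rule sum.cong)
    fix i assume "i \<in> {..k}"
    then have "r ^ k = r ^ i * r ^ (k - i)" by (simp flip: power_add)
    then show "a x r i (k - i) = r ^ k * ((- x) ^ i / fact i * real ((k + \<delta>) choose (k - i)))"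
      using \<open>i \<in> {..k}\<close> by (simp add: a_def power_mult_distrib[of "- x" r, simplified])
  qed simp
  ultimately show ?thesis using has_sum_imp_sums by simp
qed

section \<open>Gaussian integrals\<close>

text \<open>Completing the square in the real part moves the centre to p / (2 \<alpha>) and rescales
  to the standard normal density; what remains is its characteristic function. Keeping the slope p
  and the frequency q as separate real parameters avoids moving a contour.\<close>

lemma gaussian_integral_real:
  fixes \<alpha> p q :: real
  assumes "\<alpha> > 0"
  defines "f \<equiv> \<lambda>x::real. exp (complex_of_real (- \<alpha> * x\<^sup>2 + x * p) + \<i> * of_real (x * q))"
  shows "integrable lborel f"
    and "(\<integral>x. f x \<partial>lborel) =
      of_real (sqrt (pi / \<alpha>)) * exp (of_real ((p\<^sup>2 - q\<^sup>2) / (4 * \<alpha>)) + \<i> * of_real (p * q / (2 * \<alpha>)))"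
proof -
  define s where "s = 1 / sqrt (2 * \<alpha>)"
  define \<mu> where "\<mu> = p / (2 * \<alpha>)"
  define C where "C = exp (complex_of_real (p\<^sup>2 / (4 * \<alpha>)) + \<i> * of_real (p * q / (2 * \<alpha>)))"
  have s: "s > 0" "s\<^sup>2 = 1 / (2 * \<alpha>)" using assms by (auto simp: s_def power_divide)
  have int: "integrable lborel (\<lambda>x. std_normal_density x *\<^sub>R iexp ((q * s) * x))"
    by (rule Bochner_Integration.integrable_bound[OF integrable_normal_density[of 1 0]])
      (auto simp: norm_mult normal_density_nonneg)
  have val: "(\<integral>x. std_normal_density x *\<^sub>R iexp ((q * s) * x) \<partial>lborel) = of_real (exp (- (q * s)\<^sup>2 / 2))"
    using fun_cong[OF char_std_normal_distribution, of "q * s"] unfolding char_def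
    by (subst (asm) integral_density) (auto simp: normal_density_nonneg)
  have eq: "f (\<mu> + s * x) = (of_real (sqrt (2 * pi)) * C) * (std_normal_density x *\<^sub>R iexp ((q * s) * x))" for x
  proof -
    have "- \<alpha> * (\<mu> + s * x)\<^sup>2 + (\<mu> + s * x) * p = p\<^sup>2 / (4 * \<alpha>) - x\<^sup>2 / 2"
    proof -
      have "- \<alpha> * (\<mu> + s * x)\<^sup>2 + (\<mu> + s * x) * p = - \<alpha> * \<mu>\<^sup>2 + \<mu> * p + s * x * (p - 2 * \<alpha> * \<mu>) - \<alpha> * s\<^sup>2 * x\<^sup>2"
        by (simp add: power2_eq_square algebra_simps)
      then show ?thesis unfolding s(2) using assms by (simp add: \<mu>_def power2_eq_square field_simps)
    qed
    moreover have "(\<mu> + s * x) * q = p * q / (2 * \<alpha>) + (q * s) * x" by (simp add: \<mu>_def algebra_simps)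
    ultimately have "f (\<mu> + s * x) = exp (complex_of_real (p\<^sup>2 / (4 * \<alpha>) - x\<^sup>2 / 2) + \<i> * of_real (p * q / (2 * \<alpha>) + (q * s) * x))"
      unfolding f_def by presburger
    also have "\<dots> = C * (exp (of_real (- x\<^sup>2 / 2)) * iexp ((q * s) * x))"
      unfolding C_def exp_add[symmetric] by (simp add: algebra_simps)
    finally show ?thesis
      by (simp add: normal_density_def exp_of_real[symmetric] scaleR_conv_of_real)
  qed
  show "integrable lborel f"
    using integrable_mult_right[OF int, of "of_real (sqrt (2 * pi)) * C"] s lborel_integrable_real_affine_iff[of s f \<mu>]
    unfolding eq by simp
  have "(\<integral>x. f x \<partial>lborel) = s *\<^sub>R (\<integral>x. f (\<mu> + s * x) \<partial>lborel)"
    using s lborel_integral_real_affine[of s f \<mu>] by simp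
  also have "\<dots> = s *\<^sub>R ((of_real (sqrt (2 * pi)) * C) * of_real (exp (- (q * s)\<^sup>2 / 2)))"
    unfolding eq integral_mult_right_zero val ..
  also have "\<dots> = of_real (s * sqrt (2 * pi)) * (C * of_real (exp (- (q * s)\<^sup>2 / 2)))"
    by (simp add: scaleR_conv_of_real)
  also have "s * sqrt (2 * pi) = sqrt (pi / \<alpha>)"
    unfolding s_def using assms by (simp add: real_sqrt_mult real_sqrt_divide)
  also have "C * of_real (exp (- (q * s)\<^sup>2 / 2)) = exp (of_real ((p\<^sup>2 - q\<^sup>2) / (4 * \<alpha>)) + \<i> * of_real (p * q / (2 * \<alpha>)))"
    unfolding C_def power_mult_distrib s(2) exp_of_real[symmetric] exp_add[symmetric]
    by (rule arg_cong[where f = exp]) (use assms in \<open>simp add: field_simps\<close>)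
  finally show "(\<integral>x. f x \<partial>lborel) =
      of_real (sqrt (pi / \<alpha>)) * exp (of_real ((p\<^sup>2 - q\<^sup>2) / (4 * \<alpha>)) + \<i> * of_real (p * q / (2 * \<alpha>)))" .
qed

text \<open>Lebesgue measure on a Euclidean space is by definition the image of a product measure
  over the basis, which reduces the integral to one-variable integrals.\<close>

lemma lborel_integral_prod_Basis:
  fixes f :: "'a::euclidean_space \<Rightarrow> real \<Rightarrow> complex"
  assumes "\<And>b. b \<in> Basis \<Longrightarrow> integrable lborel (f b)"
  shows "integrable lborel (\<lambda>x::'a. \<Prod>b\<in>Basis. f b (x \<bullet> b))"
    and "(\<integral>x. (\<Prod>b\<in>Basis. f b (x \<bullet> b)) \<partial>lborel) = (\<Prod>b\<in>Basis. \<integral>y. f b y \<partial>lborel)"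
proof -
  have lborel_eq: "(lborel :: 'a measure) = distr (Pi\<^sub>M Basis (\<lambda>b. lborel)) borel (\<lambda>g. \<Sum>b\<in>Basis. g b *\<^sub>R b)"
    unfolding lborel_eq_real by (rule lborel_def)
  interpret product_sigma_finite "\<lambda>_::'a. lborel :: real measure" ..
  have [measurable]: "f b \<in> borel_measurable borel" if "b \<in> Basis" for b
    using borel_measurable_integrable[OF assms[OF that]] by simp
  have m: "(\<lambda>x::'a. \<Prod>b\<in>Basis. f b (x \<bullet> b)) \<in> borel_measurable borel" by measurable
  have m': "(\<lambda>g. \<Sum>b\<in>Basis. g b *\<^sub>R b :: 'a) \<in> Pi\<^sub>M Basis (\<lambda>b. lborel) \<rightarrow>\<^sub>M borel"
    by simp
  have eq: "(\<Prod>b\<in>Basis. f b ((\<Sum>c\<in>Basis. g c *\<^sub>R c :: 'a) \<bullet> b)) = (\<Prod>b\<in>Basis. f b (g b))" for g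
    by simp
  show "integrable lborel (\<lambda>x::'a. \<Prod>b\<in>Basis. f b (x \<bullet> b))"
    unfolding lborel_eq integrable_distr_eq[OF m' m] eq
    by (intro product_integrable_prod assms) auto
  show "(\<integral>x. (\<Prod>b\<in>Basis. f b (x \<bullet> b)) \<partial>lborel) = (\<Prod>b\<in>Basis. \<integral>y. f b y \<partial>lborel)"
    unfolding lborel_eq integral_distr[OF m' m] eq
    by (intro product_integral_prod assms) auto
qed

lemma gaussian_integral:
  fixes p q :: "'a::euclidean_space"
  assumes "\<alpha> > 0"
  defines "f \<equiv> \<lambda>x::'a. exp (complex_of_real (- \<alpha> * (norm x)\<^sup>2 + x \<bullet> p) + \<i> * of_real (x \<bullet> q))"
  shows "integrable lborel f"
    and "(\<integral>x. f x \<partial>lborel) =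
      of_real (sqrt (pi / \<alpha>) ^ DIM('a)) *
      exp (of_real (((norm p)\<^sup>2 - (norm q)\<^sup>2) / (4 * \<alpha>)) + \<i> * of_real (p \<bullet> q / (2 * \<alpha>)))"
proof -
  have nsq: "(norm x)\<^sup>2 = (\<Sum>b\<in>Basis. (x \<bullet> b)\<^sup>2)" for x :: 'a
    unfolding power2_norm_eq_inner euclidean_inner[of x x] by (simp add: power2_eq_square)
  define g where "g b x = exp (complex_of_real (- \<alpha> * x\<^sup>2 + x * (p \<bullet> b)) + \<i> * of_real (x * (q \<bullet> b)))" for b and x :: real
  have f: "f x = (\<Prod>b\<in>Basis. g b (x \<bullet> b))" for x
    unfolding f_def g_def exp_sum[OF finite_Basis, symmetric] nsq[of x] euclidean_inner[of x p] euclidean_inner[of x q]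
    by (simp add: sum.distrib sum_distrib_left sum_negf power2_eq_square sum_subtractf)
  have int: "integrable lborel (g b)" for b
    unfolding g_def by (rule gaussian_integral_real[OF assms(1)])
  show "integrable lborel f" unfolding f[abs_def] by (rule lborel_integral_prod_Basis[OF int])
  have "(\<integral>x. f x \<partial>lborel) = (\<Prod>b\<in>(Basis::'a set). of_real (sqrt (pi / \<alpha>)) *
      exp (of_real (((p \<bullet> b)\<^sup>2 - (q \<bullet> b)\<^sup>2) / (4 * \<alpha>)) + \<i> * of_real ((p \<bullet> b) * (q \<bullet> b) / (2 * \<alpha>))))"
    unfolding f lborel_integral_prod_Basis(2)[OF int] unfolding g_def gaussian_integral_real(2)[OF assms(1)] ..
  also have "\<dots> = of_real (sqrt (pi / \<alpha>) ^ DIM('a)) *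
      exp (of_real (((norm p)\<^sup>2 - (norm q)\<^sup>2) / (4 * \<alpha>)) + \<i> * of_real (p \<bullet> q / (2 * \<alpha>)))"
    unfolding prod.distrib exp_sum[OF finite_Basis, symmetric] nsq[of p] nsq[of q] euclidean_inner[of p q]
    by (simp add: sum.distrib sum_distrib_left sum_subtractf diff_divide_distrib sum_divide_distrib)
  finally show "(\<integral>x. f x \<partial>lborel) =
      of_real (sqrt (pi / \<alpha>) ^ DIM('a)) *
      exp (of_real (((norm p)\<^sup>2 - (norm q)\<^sup>2) / (4 * \<alpha>)) + \<i> * of_real (p \<bullet> q / (2 * \<alpha>)))" .
qed

section \<open>Termwise integration and uniqueness of power series coefficients\<close>

lemma sums_lebesgue_dominated:
  fixes f :: "nat \<Rightarrow> 'a \<Rightarrow> 'b::{banach, second_countable_topology}"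
  assumes "\<And>i. integrable M (f i)" "F \<in> borel_measurable M"
    and "\<And>x. (\<lambda>i. f i x) sums F x"
    and "\<And>N x. (\<Sum>i<N. norm (f i x)) \<le> w x" "integrable M w"
  shows "(\<lambda>i. integral\<^sup>L M (f i)) sums integral\<^sup>L M F"
proof -
  have [measurable]: "f i \<in> borel_measurable M" for i using assms(1) by auto
  note assms(2)[measurable]
  have "(\<lambda>N. integral\<^sup>L M (\<lambda>x. \<Sum>i<N. f i x)) \<longlonglongrightarrow> integral\<^sup>L M F"
  proof (rule integral_dominated_convergence[OF _ _ assms(5)])
    show "AE x in M. (\<lambda>N. \<Sum>i<N. f i x) \<longlonglongrightarrow> F x" using assms(3) by (simp add: sums_def)
    show "AE x in M. norm (\<Sum>i<N. f i x) \<le> w x" for N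
      by (intro AE_I2 order_trans[OF norm_sum assms(4)])
  qed measurable
  then show ?thesis using assms(1) by (simp add: sums_def)
qed

text \<open>The two expansions are available only at small positive real r. Dividing their
  difference by the power of r at its first nonzero coefficient and letting r tend to 0 from the
  right forces that coefficient to vanish.\<close>

lemma powser_eqI:
  fixes a b :: "nat \<Rightarrow> complex"
  assumes "\<rho> > 0"
    and "\<And>r::real. 0 < r \<Longrightarrow> r < \<rho> \<Longrightarrow> (\<lambda>k. of_real r ^ k * a k) sums f r"
    and "\<And>r::real. 0 < r \<Longrightarrow> r < \<rho> \<Longrightarrow> (\<lambda>k. of_real r ^ k * b k) sums f r"
  shows "a = b"
proof (rule ccontr)
  assume "a \<noteq> b"
  define c where "c k = a k - b k" for k
  define N where "N = (LEAST k. c k \<noteq> 0)"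
  have "\<exists>k. c k \<noteq> 0" using \<open>a \<noteq> b\<close> by (auto simp: c_def fun_eq_iff)
  then have N: "c N \<noteq> 0" and less: "\<And>k. k < N \<Longrightarrow> c k = 0"
    unfolding N_def by (metis (mono_tags, lifting) LeastI_ex, metis (mono_tags, lifting) not_less_Least)
  have c: "(\<lambda>k. c k * of_real r ^ k) sums 0" if "0 < r" "r < \<rho>" for r :: real
    using sums_diff[OF assms(2,3)[OF that]] by (simp add: c_def algebra_simps)
  have cN: "(\<lambda>k. c (k + N) * of_real r ^ k) sums 0" if "0 < r" "r < \<rho>" for r :: real
  proof -
    have "(\<lambda>k. c (k + N) * of_real r ^ (k + N)) sums (0 - (\<Sum>k<N. c k * of_real r ^ k))"
      by (rule sums_split_initial_segment[OF c[OF that]])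
    then have "(\<lambda>k. of_real r ^ N * (c (k + N) * of_real r ^ k)) sums (of_real r ^ N * 0)"
      using less by (simp add: power_add mult_ac)
    then show ?thesis using that by (subst (asm) sums_mult_iff) auto
  qed
  define g where "g x = (\<Sum>k. c (k + N) * x ^ k)" for x
  have "(g \<longlongrightarrow> c (0 + N)) (at 0)"
  proof (rule powser_limit_0)
    show "\<rho> / 2 > 0" using assms by simp
    \<comment> \<open>Convergence at the real point \<rho> / 2 extends to the complex disc of that
      radius.\<close>
    show "(\<lambda>k. c (k + N) * x ^ k) sums g x" if "norm x < \<rho> / 2" for x
    proof -
      have "summable (\<lambda>k. c (k + N) * x ^ k)"
        by (rule powser_inside[OF sums_summable[OF cN[of "\<rho> / 2"]]]) (use that assms in auto)
      then show ?thesis unfolding g_def by (rule summable_sums)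
    qed
  qed
  moreover have "filterlim complex_of_real (at 0) (at_right 0)"
    unfolding filterlim_at
    by (auto intro!: tendsto_eq_intros eventually_at_rightI[of 0 1])
  ultimately have "((\<lambda>r. g (complex_of_real r)) \<longlongrightarrow> c N) (at_right 0)"
    by (auto dest: filterlim_compose)
  moreover have "((\<lambda>r. g (complex_of_real r)) \<longlongrightarrow> 0) (at_right 0)"
    by (rule tendsto_eventually, rule eventually_at_rightI[of 0 \<rho>])
      (use cN assms in \<open>auto simp: g_def sums_iff\<close>)
  ultimately have "c N = 0" by (rule tendsto_unique[rotated]) auto
  with N show False by simp
qed

section \<open>The Mehler kernel\<close>

definition symp_form :: "complex ^ 'n::finite \<Rightarrow> complex ^ 'n \<Rightarrow> real" where
  "symp_form z w = Im (\<Sum>i\<in>UNIV. z $ i * cnj (w $ i))"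

definition imult :: "complex ^ 'n::finite \<Rightarrow> complex ^ 'n" where
  "imult w = (\<chi> i. \<i> * w $ i)"

text \<open>Multiplication by i takes w to a vector orthogonal to w for the real inner product.
  Hence the twist is a pure frequency orthogonal to w, and twisted Gaussian integrals are instances
  of \<open>gaussian_integral\<close> in which the cross term vanishes.\<close>

lemma symp_form_eq_inner: "symp_form z w = z \<bullet> imult w"
  by (simp add: symp_form_def imult_def inner_vec_def inner_complex_def algebra_simps)

lemma norm_imult [simp]: "norm (imult w) = norm w"
  by (simp add: imult_def norm_vec_def norm_mult)

lemma inner_imult_self [simp]: "w \<bullet> imult w = 0"
  by (simp add: imult_def inner_vec_def inner_complex_def)

lemma symp_form_self [simp]: "symp_form w w = 0"
  by (simp add: symp_form_eq_inner)

lemma symp_form_diff_left: "symp_form (z - y) w = symp_form z w - symp_form y w"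
  by (simp add: symp_form_eq_inner inner_diff_left)

lemma symp_form_add_left: "symp_form (z + y) w = symp_form z w + symp_form y w"
  by (simp add: symp_form_eq_inner inner_add_left)

lemma symp_form_swap: "symp_form w z = - symp_form z w"
  by (simp add: symp_form_def sum_negf[symmetric] mult.commute)

lemma symp_form_add_right: "symp_form w (z + y) = symp_form w z + symp_form w y"
  by (metis symp_form_add_left symp_form_swap minus_add_distrib)

lemma continuous_on_symp_form [continuous_intros]:
  "continuous_on A f \<Longrightarrow> continuous_on A g \<Longrightarrow> continuous_on A (\<lambda>x. symp_form (f x) (g x))"
  unfolding symp_form_def by (intro continuous_intros)

text \<open>With \<beta> = |l| this is the generating function in r of the Laguerre functions. For r
  = exp (-2 \<beta> s) the quotient (1 + r) / (1 - r) is coth (\<beta> s), and the function is, up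
  to a factor free of z, the heat kernel of the twisted Laplacian at time s.\<close>

definition mehler :: "real \<Rightarrow> real \<Rightarrow> complex ^ 'n::finite \<Rightarrow> real" where
  "mehler \<beta> r z = exp (- (\<beta> / 4 * ((1 + r) / (1 - r))) * (norm z)\<^sup>2) / (1 - r) ^ CARD('n)"

lemma laguerre_fun_sums:
  fixes z :: "complex ^ 'n::finite"
  assumes "\<bar>r\<bar> < 1"
  shows "(\<lambda>k. r ^ k * laguerre_fun k l z) sums mehler \<bar>l\<bar> r z"
proof -
  define x where "x = 1/2 * \<bar>l\<bar> * (norm z)\<^sup>2"
  have "(\<lambda>k. r ^ k * poly (laguerre (CARD('n) - 1) k) x * exp (- x / 2)) sums
      (exp (- (r * x) / (1 - r)) / (1 - r) ^ Suc (CARD('n) - 1) * exp (- x / 2))"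
    by (intro sums_mult2 sums_poly_laguerre assms)
  moreover have "exp (- (r * x) / (1 - r)) * exp (- x / 2) = exp (- (\<bar>l\<bar> / 4 * ((1 + r) / (1 - r))) * (norm z)\<^sup>2)"
    unfolding exp_add[symmetric]
    by (rule arg_cong[where f = exp]) (use assms in \<open>simp add: x_def field_simps\<close>)
  moreover have "- (1/4) * \<bar>l\<bar> * (norm z)\<^sup>2 = - x / 2" by (simp add: x_def)
  moreover have "Suc (CARD('n) - 1) = CARD('n)" using zero_less_card_finite[where 'a = 'n] by simp
  ultimately show ?thesis unfolding mehler_def laguerre_fun_def x_def[symmetric]
    by (simp add: mult_ac)
qed

text \<open>With absolute values the generating function costs exp (|r| x / (1 - |r|)), where x =
  |l| |z|^2 / 2. For |r| \<le> 1/5 this exponent is at most x / 4, half of what exp (- x / 2) gains.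
  What is left is the Gaussian on the right, and 5/4 is 1 / (1 - 1/5).\<close>

lemma laguerre_fun_abs_partial_sum:
  fixes z :: "complex ^ 'n::finite"
  assumes "\<bar>r\<bar> \<le> 1/5"
  shows "(\<Sum>k<N. \<bar>r\<bar> ^ k * \<bar>laguerre_fun k l z\<bar>) \<le> (5/4) ^ CARD('n) * exp (- (\<bar>l\<bar> / 8) * (norm z)\<^sup>2)"
proof -
  define x where "x = 1/2 * \<bar>l\<bar> * (norm z)\<^sup>2"
  have "x \<ge> 0" by (simp add: x_def)
  have s: "Suc (CARD('n) - 1) = CARD('n)" using zero_less_card_finite[where 'a = 'n] by simp
  have e: "- (1/4) * \<bar>l\<bar> * (norm z)\<^sup>2 = - x / 2" by (simp add: x_def)
  have sums: "(\<lambda>k. \<bar>r\<bar> ^ k * poly (laguerre (CARD('n) - 1) k) (- x) * exp (- x / 2)) sums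
      (exp (- (\<bar>r\<bar> * - x) / (1 - \<bar>r\<bar>)) / (1 - \<bar>r\<bar>) ^ CARD('n) * exp (- x / 2))"
    by (subst s[symmetric], intro sums_mult2 sums_poly_laguerre) (use assms in auto)
  have nn: "poly (laguerre (CARD('n) - 1) k) (- x) \<ge> 0" for k
    using abs_poly_laguerre_le[OF \<open>x \<ge> 0\<close>, of "CARD('n) - 1" k] by linarith
  have "(\<Sum>k<N. \<bar>r\<bar> ^ k * \<bar>laguerre_fun k l z\<bar>) \<le> (\<Sum>k<N. \<bar>r\<bar> ^ k * poly (laguerre (CARD('n) - 1) k) (- x) * exp (- x / 2))"
    unfolding laguerre_fun_def x_def[symmetric] e
    by (intro sum_mono) (auto simp: abs_mult mult.assoc intro!: mult_left_mono mult_right_mono abs_poly_laguerre_le \<open>x \<ge> 0\<close>)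
  also have "\<dots> \<le> exp (- (\<bar>r\<bar> * - x) / (1 - \<bar>r\<bar>)) / (1 - \<bar>r\<bar>) ^ CARD('n) * exp (- x / 2)"
    unfolding sums_unique[OF sums] by (rule sum_le_suminf[OF sums_summable[OF sums]]) (auto intro!: mult_nonneg_nonneg nn[simplified])
  also have "\<dots> \<le> (5/4) ^ CARD('n) * exp (- (\<bar>l\<bar> / 8) * (norm z)\<^sup>2)"
  proof -
    have "exp (- (\<bar>r\<bar> * - x) / (1 - \<bar>r\<bar>)) * exp (- x / 2) \<le> exp (- (\<bar>l\<bar> / 8) * (norm z)\<^sup>2)"
    proof -
      have "\<bar>r\<bar> / (1 - \<bar>r\<bar>) \<le> 1/4" using assms by (simp add: field_simps)
      from mult_right_mono[OF this \<open>x \<ge> 0\<close>] have "\<bar>r\<bar> * x / (1 - \<bar>r\<bar>) \<le> x / 4" by simp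
      moreover have "- (\<bar>r\<bar> * - x) / (1 - \<bar>r\<bar>) = \<bar>r\<bar> * x / (1 - \<bar>r\<bar>)" by simp
      ultimately have "- (\<bar>r\<bar> * - x) / (1 - \<bar>r\<bar>) + - x / 2 \<le> - x / 4" by linarith
      also have "- x / 4 = - (\<bar>l\<bar> / 8) * (norm z)\<^sup>2" by (simp add: x_def)
      finally show ?thesis unfolding exp_add[symmetric] by (simp only: exp_le_cancel_iff)
    qed
    moreover have "1 / (1 - \<bar>r\<bar>) ^ CARD('n) \<le> (5/4) ^ CARD('n)"
    proof -
      have "1 / (1 - \<bar>r\<bar>) \<le> 5/4" using assms by (simp add: field_simps)
      then have "(1 / (1 - \<bar>r\<bar>)) ^ CARD('n) \<le> (5/4) ^ CARD('n)" using assms by (intro power_mono) auto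
      then show ?thesis by (simp add: power_divide)
    qed
    ultimately have "(1 / (1 - \<bar>r\<bar>) ^ CARD('n)) * (exp (- (\<bar>r\<bar> * - x) / (1 - \<bar>r\<bar>)) * exp (- x / 2))
        \<le> (5/4) ^ CARD('n) * exp (- (\<bar>l\<bar> / 8) * (norm z)\<^sup>2)"
      using assms by (intro mult_mono) auto
    then show ?thesis by (simp add: mult_ac)
  qed
  finally show ?thesis .
qed

text \<open>A single term of the preceding sum at r = 1/5. The constant is crude in k but suffices
  for integrability; the sharp bound comes later from the convolution identity.\<close>

lemma abs_laguerre_fun_le_exp:
  fixes z :: "complex ^ 'n::finite"
  shows "\<bar>laguerre_fun k l z\<bar> \<le> 5 ^ k * (5/4) ^ CARD('n) * exp (- (\<bar>l\<bar> / 8) * (norm z)\<^sup>2)"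
proof -
  have "(1/5) ^ k * \<bar>laguerre_fun k l z\<bar> \<le> (\<Sum>k<Suc k. \<bar>1/5\<bar> ^ k * \<bar>laguerre_fun k l z\<bar>)"
    by (simp add: sum_nonneg)
  also note laguerre_fun_abs_partial_sum
  finally show ?thesis by (simp add: power_divide field_simps)
qed

lemma continuous_on_laguerre_fun [continuous_intros]:
  "continuous_on A f \<Longrightarrow> continuous_on A (\<lambda>x. laguerre_fun k l (f x))"
  unfolding laguerre_fun_def by (intro continuous_intros)

lemma borel_measurable_laguerre_fun [measurable]: "laguerre_fun k l \<in> borel_measurable borel"
  by (intro borel_measurable_continuous_onI continuous_intros)

lemma laguerre_fun_minus [simp]: "laguerre_fun k l (- z) = laguerre_fun k l z"
  by (simp add: laguerre_fun_def)

lemma integrable_exp_norm_square: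
  assumes "a > 0"
  shows "integrable lborel (\<lambda>x::'a::euclidean_space. exp (- a * (norm x)\<^sup>2))"
proof -
  have "integrable lborel (\<lambda>x. norm (exp (complex_of_real (- a * (norm x)\<^sup>2 + x \<bullet> (0::'a))
      + \<i> * of_real (x \<bullet> 0))))"
    by (intro integrable_norm gaussian_integral(1) assms)
  then show ?thesis by simp
qed

lemma integral_exp_norm_square:
  assumes "a > 0"
  shows "(\<integral>x. exp (- a * (norm (x::'a::euclidean_space))\<^sup>2) \<partial>lborel) = sqrt (pi / a) ^ DIM('a)"
proof -
  have "(\<integral>x. complex_of_real (exp (- a * (norm (x::'a))\<^sup>2)) \<partial>lborel) = of_real (sqrt (pi / a) ^ DIM('a))"
    using gaussian_integral(2)[OF assms, of "0::'a" "0::'a"] by (simp add: exp_of_real[symmetric])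
  then show ?thesis by (simp only: integral_complex_of_real of_real_eq_iff)
qed

lemma mehler_nonneg: "r < 1 \<Longrightarrow> mehler \<beta> r z \<ge> 0"
  by (simp add: mehler_def)

lemma continuous_on_mehler [continuous_intros]:
  "continuous_on A f \<Longrightarrow> continuous_on A (\<lambda>x. mehler \<beta> r (f x))"
  unfolding mehler_def by (cases "r = 1") (auto intro!: continuous_intros)

lemma borel_measurable_mehler [measurable]: "mehler \<beta> r \<in> borel_measurable borel"
  by (intro borel_measurable_continuous_onI continuous_intros)

lemma mehler_le: "\<lbrakk>\<beta> \<ge> 0; \<bar>r\<bar> < 1\<rbrakk> \<Longrightarrow> mehler \<beta> r (z :: complex ^ 'n::finite) \<le> 1 / (1 - r) ^ CARD('n)"
  by (auto simp: mehler_def intro!: divide_right_mono)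

text \<open>The integrand is a Gaussian in z with coefficient a + b, slope 2 b w and the orthogonal
  frequency (l / 2) \<open>imult w\<close>. The exponents combine by the addition theorem of the
  hyperbolic cotangent, which makes the parameter multiplicative: r and s give r s.\<close>

lemma mehler_twisted_convolution:
  fixes w :: "complex ^ 'n::finite"
  assumes "l \<noteq> 0" "\<bar>r\<bar> < 1" "\<bar>s\<bar> < 1"
  shows "(\<integral>z. of_real (mehler \<bar>l\<bar> r z) * (of_real (mehler \<bar>l\<bar> s (w - z)) * cis (l / 2 * symp_form z w)) \<partial>lborel)
    = of_real ((2 * pi / \<bar>l\<bar>) ^ CARD('n) * mehler \<bar>l\<bar> (r * s) w)"
proof -
  let ?n = "CARD('n)"
  define a where "a = \<bar>l\<bar> / 4 * ((1 + r) / (1 - r))"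
  define b where "b = \<bar>l\<bar> / 4 * ((1 + s) / (1 - s))"
  define K where "K = 1 / (1 - r) ^ ?n * (1 / (1 - s) ^ ?n)"
  have ab: "a > 0" "b > 0" using assms by (auto simp: a_def b_def)
  have rs: "\<bar>r * s\<bar> < 1" using assms by (metis abs_mult abs_mult_less mult_1)
  have pt: "of_real (mehler \<bar>l\<bar> r z) * (of_real (mehler \<bar>l\<bar> s (w - z)) * cis (l / 2 * symp_form z w)) =
      of_real (K * exp (- b * (norm w)\<^sup>2)) *
      exp (of_real (- (a + b) * (norm z)\<^sup>2 + z \<bullet> ((2 * b) *\<^sub>R w)) + \<i> * of_real (z \<bullet> ((l / 2) *\<^sub>R imult w)))" for z
  proof -
    have nwz: "(norm (w - z))\<^sup>2 = (norm w)\<^sup>2 + (norm z)\<^sup>2 - 2 * (z \<bullet> w)"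
      by (simp add: power2_norm_eq_inner inner_diff_left inner_diff_right inner_commute)
    have e: "exp (- a * (norm z)\<^sup>2) * exp (- b * (norm (w - z))\<^sup>2) =
        exp (- b * (norm w)\<^sup>2) * exp (- (a + b) * (norm z)\<^sup>2 + z \<bullet> ((2 * b) *\<^sub>R w))"
      unfolding nwz exp_add[symmetric] by (simp add: algebra_simps)
    have "mehler \<bar>l\<bar> r z * mehler \<bar>l\<bar> s (w - z) = K * (exp (- a * (norm z)\<^sup>2) * exp (- b * (norm (w - z))\<^sup>2))"
      unfolding mehler_def a_def[symmetric] b_def[symmetric] K_def by simp
    then have "of_real (mehler \<bar>l\<bar> r z) * (of_real (mehler \<bar>l\<bar> s (w - z)) * cis (l / 2 * symp_form z w)) =
        of_real (K * exp (- b * (norm w)\<^sup>2)) *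
        (of_real (exp (- (a + b) * (norm z)\<^sup>2 + z \<bullet> ((2 * b) *\<^sub>R w))) * cis (l / 2 * symp_form z w))"
      unfolding e by (simp flip: of_real_mult mult.assoc)
    then show ?thesis
      unfolding exp_add exp_of_real cis_conv_exp symp_form_eq_inner inner_scaleR_right by (simp add: mult_ac)
  qed
  have "(\<integral>z. of_real (mehler \<bar>l\<bar> r z) * (of_real (mehler \<bar>l\<bar> s (w - z)) * cis (l / 2 * symp_form z w)) \<partial>lborel) =
      of_real (K * exp (- b * (norm w)\<^sup>2)) * (of_real (sqrt (pi / (a + b)) ^ DIM(complex ^ 'n)) *
      exp (of_real (((2 * b * norm w)\<^sup>2 - (l / 2 * norm w)\<^sup>2) / (4 * (a + b)))))"
  proof -
    have "(norm ((2 * b) *\<^sub>R w))\<^sup>2 = (2 * b * norm w)\<^sup>2" "(norm ((l / 2) *\<^sub>R imult w))\<^sup>2 = (l / 2 * norm w)\<^sup>2"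
      by (simp_all add: power_mult_distrib power_divide)
    moreover have "((2 * b) *\<^sub>R w) \<bullet> ((l / 2) *\<^sub>R imult w) = 0" by simp
    moreover have "a + b > 0" using ab by simp
    ultimately show ?thesis
      unfolding pt integral_mult_right_zero
      by (simp only: gaussian_integral(2)) simp
  qed
  also have "\<dots> = of_real (K * exp (- b * (norm w)\<^sup>2) * (sqrt (pi / (a + b)) ^ (2 * ?n) *
      exp (((2 * b * norm w)\<^sup>2 - (l / 2 * norm w)\<^sup>2) / (4 * (a + b)))))"
  proof -
    have "DIM(complex ^ 'n) = 2 * ?n" by simp
    then show ?thesis by (simp only: exp_of_real of_real_mult)
  qed
  also have "K * exp (- b * (norm w)\<^sup>2) * (sqrt (pi / (a + b)) ^ (2 * ?n) *
      exp (((2 * b * norm w)\<^sup>2 - (l / 2 * norm w)\<^sup>2) / (4 * (a + b)))) = (2 * pi / \<bar>l\<bar>) ^ ?n * mehler \<bar>l\<bar> (r * s) w"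
  proof -
    \<comment> \<open>With A = (1 + r) / (1 - r) and B = (1 + s) / (1 - s), \<open>sum\<close> and
      \<open>prod\<close> evaluate A + B and A B + 1, up to powers of |l| / 4; the quotient of the
      second by the first is (1 + r s) / (1 - r s). The summand 1 comes from the twist, through l^2
      / 16.\<close>
    have sum: "a + b = \<bar>l\<bar> / 2 * ((1 - r * s) / ((1 - r) * (1 - s)))"
    proof -
      have "(1 + r) / (1 - r) + (1 + s) / (1 - s) = 2 * ((1 - r * s) / ((1 - r) * (1 - s)))"
        using assms by (simp add: add_frac_eq) (simp add: algebra_simps)
      moreover have "\<bar>l\<bar> / 4 * (2 * X) = \<bar>l\<bar> / 2 * X" for X by simp
      ultimately show ?thesis unfolding a_def b_def distrib_left[symmetric] by presburger
    qed
    have prod: "a * b + l\<^sup>2 / 16 = \<bar>l\<bar> / 2 * (\<bar>l\<bar> / 4 * ((1 + r * s) / ((1 - r) * (1 - s))))"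
    proof -
      have "(1 + r) / (1 - r) * ((1 + s) / (1 - s)) + 1 = 2 * ((1 + r * s) / ((1 - r) * (1 - s)))"
      proof -
        have "(1 - r) * (1 - s) \<noteq> 0" using assms by auto
        then have "(1 + r) * (1 + s) / ((1 - r) * (1 - s)) + 1 = ((1 + r) * (1 + s) + (1 - r) * (1 - s)) / ((1 - r) * (1 - s))"
          by (simp only: add_divide_distrib divide_self_if if_False)
        also have "(1 + r) * (1 + s) + (1 - r) * (1 - s) = 2 * (1 + r * s)" by (simp add: algebra_simps)
        finally show ?thesis by (simp only: times_divide_times_eq times_divide_eq_right[of 2])
      qed
      moreover have "a * b + l\<^sup>2 / 16 = \<bar>l\<bar> / 4 * (\<bar>l\<bar> / 4) * ((1 + r) / (1 - r) * ((1 + s) / (1 - s)) + 1)"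
      proof -
        have "(L / 4 * A) * (L / 4 * B) + L\<^sup>2 / 16 = L / 4 * (L / 4) * (A * B + 1)" for A B L :: real
          by (simp add: power2_eq_square algebra_simps)
        from this[of "\<bar>l\<bar>"] show ?thesis unfolding a_def b_def power2_abs .
      qed
      moreover have "\<bar>l\<bar> / 4 * (\<bar>l\<bar> / 4) * (2 * X) = \<bar>l\<bar> / 2 * (\<bar>l\<bar> / 4 * X)" for X by simp
      ultimately show ?thesis by presburger
    qed
    have "((2 * b * norm w)\<^sup>2 - (l / 2 * norm w)\<^sup>2) / (4 * (a + b)) - b * (norm w)\<^sup>2 = - ((a * b + l\<^sup>2 / 16) / (a + b)) * (norm w)\<^sup>2"
      using ab by (simp add: power_mult_distrib field_simps power2_eq_square)
    also have "(a * b + l\<^sup>2 / 16) / (a + b) = \<bar>l\<bar> / 4 * ((1 + r * s) / (1 - r * s))"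
    proof -
      have "(L / 2 * (L / 4 * (P / D))) / (L / 2 * (Q / D)) = L / 4 * (P / Q)"
        if "L \<noteq> 0" "D \<noteq> 0" "Q \<noteq> 0" for L P D Q :: real
        using that by simp
      then show ?thesis unfolding sum prod by this (use assms rs in auto)
    qed
    finally have e: "exp (- b * (norm w)\<^sup>2) * exp (((2 * b * norm w)\<^sup>2 - (l / 2 * norm w)\<^sup>2) / (4 * (a + b))) =
        exp (- (\<bar>l\<bar> / 4 * ((1 + r * s) / (1 - r * s))) * (norm w)\<^sup>2)"
      unfolding exp_add[symmetric] by simp
    have "sqrt (pi / (a + b)) ^ (2 * ?n) = (pi / (a + b)) ^ ?n"
      using ab by (simp add: power_mult)
    then have "K * sqrt (pi / (a + b)) ^ (2 * ?n) = (1 / (1 - r) * (1 / (1 - s)) * (pi / (a + b))) ^ ?n"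
      unfolding K_def power_mult_distrib by (simp add: power_divide)
    also have "1 / (1 - r) * (1 / (1 - s)) * (pi / (a + b)) = (2 * pi / \<bar>l\<bar>) * (1 / (1 - r * s))"
    proof -
      have "1 / A * (1 / B) * (pi / (L / 2 * (Q / (A * B)))) = 2 * pi / L * (1 / Q)"
        if "L \<noteq> 0" "A \<noteq> 0" "B \<noteq> 0" "Q \<noteq> 0" for L A B Q :: real
        using that by simp
      then show ?thesis unfolding sum by this (use assms rs in auto)
    qed
    finally have "K * sqrt (pi / (a + b)) ^ (2 * ?n) = (2 * pi / \<bar>l\<bar>) ^ ?n * (1 / (1 - r * s) ^ ?n)"
      by (simp add: power_divide power_mult_distrib)
    note Q = this
    have "K * A * (B * D) = (K * B) * (A * D)" for A B D by (simp only: mult_ac)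
    then have "K * exp (- b * (norm w)\<^sup>2) * (sqrt (pi / (a + b)) ^ (2 * ?n) *
        exp (((2 * b * norm w)\<^sup>2 - (l / 2 * norm w)\<^sup>2) / (4 * (a + b)))) =
        ((2 * pi / \<bar>l\<bar>) ^ ?n * (1 / (1 - r * s) ^ ?n)) * exp (- (\<bar>l\<bar> / 4 * ((1 + r * s) / (1 - r * s))) * (norm w)\<^sup>2)"
      unfolding Q[symmetric] e[symmetric] .
    then show ?thesis unfolding mehler_def by simp
  qed
  finally show ?thesis .
qed

section \<open>Twisted convolution of Laguerre functions\<close>

lemma abs_laguerre_fun_le_const:
  fixes z :: "complex ^ 'n::finite"
  shows "\<bar>laguerre_fun k l z\<bar> \<le> 5 ^ k * (5/4) ^ CARD('n)"
proof -
  have "5 ^ k * (5/4) ^ CARD('n) * exp (- (\<bar>l\<bar> / 8) * (norm z)\<^sup>2) \<le> 5 ^ k * (5/4) ^ CARD('n) * (1::real)"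
    by (intro mult_left_mono) auto
  then show ?thesis using abs_laguerre_fun_le_exp[of k l z] by linarith
qed

lemma integrable_laguerre_fun_mult:
  fixes h :: "complex ^ 'n::finite \<Rightarrow> complex"
  assumes "l \<noteq> 0" and [measurable]: "h \<in> borel_measurable borel" and "\<And>z. norm (h z) \<le> B"
  shows "integrable lborel (\<lambda>z. of_real (laguerre_fun k l z) * h z)"
proof (rule Bochner_Integration.integrable_bound)
  show "integrable lborel (\<lambda>z :: complex ^ 'n. 5 ^ k * (5/4) ^ CARD('n) * exp (- (\<bar>l\<bar> / 8) * (norm z)\<^sup>2) * B)"
    using assms(1) by (intro integrable_mult_left integrable_mult_right integrable_exp_norm_square) auto
  have "norm (of_real (laguerre_fun k l z) * h z) \<le> norm (5 ^ k * (5/4) ^ CARD('n) * exp (- (\<bar>l\<bar> / 8) * (norm z)\<^sup>2) * B)" for z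
  proof -
    have "norm (of_real (laguerre_fun k l z) * h z) \<le> 5 ^ k * (5/4) ^ CARD('n) * exp (- (\<bar>l\<bar> / 8) * (norm z)\<^sup>2) * B"
      unfolding norm_mult norm_of_real
      by (rule mult_mono[OF abs_laguerre_fun_le_exp assms(3)]) auto
    also have "\<dots> \<le> norm (5 ^ k * (5/4) ^ CARD('n) * exp (- (\<bar>l\<bar> / 8) * (norm z)\<^sup>2) * B)"
      unfolding real_norm_def by (rule abs_ge_self)
    finally show ?thesis .
  qed
  then show "AE z in lborel. norm (of_real (laguerre_fun k l z) * h z) \<le> norm (5 ^ k * (5/4) ^ CARD('n) * exp (- (\<bar>l\<bar> / 8) * (norm z)\<^sup>2) * B)"
    by (intro AE_I2)
qed measurable

text \<open>Small r is enough: the result is fed to \<open>powser_eqI\<close>, which reads off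
  coefficients on a short interval at 0, and there the partial sums have a Gaussian
  majorant.\<close>

lemma laguerre_fun_series_integral:
  fixes h :: "complex ^ 'n::finite \<Rightarrow> complex"
  assumes "l \<noteq> 0" and [measurable]: "h \<in> borel_measurable borel" and B: "\<And>z. norm (h z) \<le> B" and r: "\<bar>r\<bar> \<le> 1/5"
  shows "(\<lambda>k. of_real r ^ k * (\<integral>z. of_real (laguerre_fun k l z) * h z \<partial>lborel)) sums
    (\<integral>z. of_real (mehler \<bar>l\<bar> r z) * h z \<partial>lborel)"
  unfolding integral_mult_right_zero[symmetric]
proof (rule sums_lebesgue_dominated)
  show "integrable lborel (\<lambda>z. of_real r ^ k * (of_real (laguerre_fun k l z) * h z))" for k
    by (intro integrable_mult_right integrable_laguerre_fun_mult[OF assms(1,2) B])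
  show "(\<lambda>z. of_real (mehler \<bar>l\<bar> r z) * h z) \<in> borel_measurable lborel" by measurable
  show "(\<lambda>k. of_real r ^ k * (of_real (laguerre_fun k l z) * h z)) sums (of_real (mehler \<bar>l\<bar> r z) * h z)" for z
  proof -
    have "(\<lambda>k. of_real (r ^ k * laguerre_fun k l z) * h z) sums (of_real (mehler \<bar>l\<bar> r z) * h z)"
      by (intro sums_mult2 sums_of_real laguerre_fun_sums) (use r in auto)
    then show ?thesis by (simp add: mult.assoc)
  qed
  show "integrable lborel (\<lambda>z :: complex ^ 'n. (5/4) ^ CARD('n) * exp (- (\<bar>l\<bar> / 8) * (norm z)\<^sup>2) * B)"
    using assms(1) by (intro integrable_mult_left integrable_mult_right integrable_exp_norm_square) auto
  have "0 \<le> B" using B norm_ge_zero order_trans by blast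
  show "(\<Sum>k<N. norm (of_real r ^ k * (of_real (laguerre_fun k l z) * h z))) \<le> (5/4) ^ CARD('n) * exp (- (\<bar>l\<bar> / 8) * (norm z)\<^sup>2) * B" for N z
  proof -
    have "(\<Sum>k<N. norm (of_real r ^ k * (of_real (laguerre_fun k l z) * h z))) = (\<Sum>k<N. \<bar>r\<bar> ^ k * \<bar>laguerre_fun k l z\<bar>) * norm (h z)"
      by (simp add: norm_mult norm_power sum_distrib_right mult.assoc)
    also have "\<dots> \<le> (5/4) ^ CARD('n) * exp (- (\<bar>l\<bar> / 8) * (norm z)\<^sup>2) * B"
      by (intro mult_mono laguerre_fun_abs_partial_sum[OF r] B) (auto)
    finally show ?thesis .
  qed
qed

lemma borel_measurable_twist [measurable]:
  "(\<lambda>z. cis (c * symp_form z w)) \<in> borel_measurable borel"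
  "(\<lambda>z. cis (c * symp_form w z)) \<in> borel_measurable borel"
  by (intro borel_measurable_continuous_onI continuous_intros)+

lemma lborel_integral_affine:
  fixes f :: "'a::euclidean_space \<Rightarrow> 'b::{banach, second_countable_topology}"
  assumes [measurable]: "f \<in> borel_measurable borel" and "c \<noteq> 0"
  shows "(\<integral>z. f z \<partial>lborel) = \<bar>c\<bar> ^ DIM('a) *\<^sub>R (\<integral>z. f (t + c *\<^sub>R z) \<partial>lborel)"
proof -
  have "(\<integral>z. f z \<partial>lborel) = (\<integral>z. f z \<partial>(density (distr lborel borel (\<lambda>x. t + c *\<^sub>R x)) (\<lambda>_. ennreal (\<bar>c\<bar> ^ DIM('a)))))"
    using lborel_affine[OF assms(2), of t] by (simp add: ennreal_power)
  then show ?thesis by (simp add: integral_density integral_distr)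
qed

lemma lborel_integral_reflect:
  fixes f :: "'a::euclidean_space \<Rightarrow> 'b::{banach, second_countable_topology}"
  assumes "f \<in> borel_measurable borel"
  shows "(\<integral>z. f (w - z) \<partial>lborel) = (\<integral>z. f z \<partial>lborel)"
  using lborel_integral_affine[OF assms, of "-1" w] by simp

text \<open>The right side of the Mehler law depends on r and s through r s only, so comparing
  coefficients first in r and then in s leaves the diagonal terms alone. Up to the factor (2 pi /
  |l|)^n, the twisted convolutions with the Laguerre functions are therefore mutually orthogonal
  projections.\<close>

theorem laguerre_fun_twisted_convolution:
  fixes w :: "complex ^ 'n::finite"
  assumes l: "l \<noteq> 0"
  shows "(\<integral>z. of_real (laguerre_fun j l z) * (of_real (laguerre_fun k l (w - z)) * cis (l / 2 * symp_form z w)) \<partial>lborel)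
    = (if j = k then of_real ((2 * pi / \<bar>l\<bar>) ^ CARD('n) * laguerre_fun k l w) else 0)"
proof -
  let ?n = "CARD('n)"
  let ?K = "\<lambda>z. of_real (laguerre_fun k l (w - z)) * cis (l / 2 * symp_form z w)"
  let ?H = "\<lambda>s c z. of_real (mehler \<bar>l\<bar> s (w - z)) * cis (c / 2 * symp_form z w)"
  define C where "C = (2 * pi / \<bar>l\<bar>) ^ ?n"
  \<comment> \<open>The sign of the twist is left free in c, because the second comparison reflects
    z to w - z and this changes the sign of \<open>symp_form z w\<close>.\<close>
  have step1: "(\<lambda>k. \<integral>z. of_real (laguerre_fun k l z) * (?H s c z) \<partial>lborel)
      = (\<lambda>k. of_real (s ^ k * (C * laguerre_fun k l w)))" if s: "0 < s" "s < 1/5" and c: "c \<noteq> 0" "\<bar>c\<bar> = \<bar>l\<bar>" for s c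
  proof (rule powser_eqI[where \<rho> = "1/5"])
    fix r :: real assume r: "0 < r" "r < 1/5"
    have "(\<lambda>k. of_real r ^ k * (\<integral>z. of_real (laguerre_fun k l z) * (?H s c z) \<partial>lborel)) sums
        (\<integral>z. of_real (mehler \<bar>l\<bar> r z) * (?H s c z) \<partial>lborel)"
    proof (rule laguerre_fun_series_integral[OF l])
      show "norm (?H s c z) \<le> 1 / (1 - s) ^ ?n" for z
        using s mehler_le[of "\<bar>l\<bar>" s "w - z"] mehler_nonneg[of s "\<bar>l\<bar>" "w - z"] by (simp add: norm_mult)
    qed (measurable, use r in auto)
    also have "(\<integral>z. of_real (mehler \<bar>l\<bar> r z) * (?H s c z) \<partial>lborel) = of_real (C * mehler \<bar>l\<bar> (r * s) w)"
      using mehler_twisted_convolution[OF c(1), of r s w] r s c by (simp add: C_def)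
    finally show "(\<lambda>k. of_real r ^ k * (\<integral>z. of_real (laguerre_fun k l z) * (?H s c z) \<partial>lborel)) sums
        of_real (C * mehler \<bar>l\<bar> (r * s) w)" .
    have "\<bar>r * s\<bar> < 1" using abs_mult_less[of r 1 s 1] r s by simp
    then have "(\<lambda>k. of_real (C * ((r * s) ^ k * laguerre_fun k l w))) sums complex_of_real (C * mehler \<bar>l\<bar> (r * s) w)"
      by (intro sums_of_real sums_mult laguerre_fun_sums)
    then show "(\<lambda>k. of_real r ^ k * of_real (s ^ k * (C * laguerre_fun k l w))) sums complex_of_real (C * mehler \<bar>l\<bar> (r * s) w)"
      by (simp add: power_mult_distrib mult_ac)
  qed simp
  have "(\<lambda>j. \<integral>z. of_real (laguerre_fun j l z) * (?K z) \<partial>lborel)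
    = (\<lambda>j. if j = k then of_real (C * laguerre_fun k l w) else 0)"
  proof (rule powser_eqI[where \<rho> = "1/5"])
    fix s :: real assume s: "0 < s" "s < 1/5"
    have "(\<lambda>j. of_real s ^ j * (\<integral>z. of_real (laguerre_fun j l z) * (?K z) \<partial>lborel)) sums
        (\<integral>z. of_real (mehler \<bar>l\<bar> s z) * (?K z) \<partial>lborel)"
    proof (rule laguerre_fun_series_integral[OF l])
      show "norm (?K z) \<le> 5 ^ k * (5/4) ^ ?n" for z
        using abs_laguerre_fun_le_const by (simp add: norm_mult)
    qed (measurable, use s in auto)
    also have "(\<integral>z. of_real (mehler \<bar>l\<bar> s z) * (?K z) \<partial>lborel) =
        (\<integral>z. of_real (mehler \<bar>l\<bar> s (w - z)) * (of_real (laguerre_fun k l z) * cis (l / 2 * symp_form (w - z) w)) \<partial>lborel)"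
    proof -
      have "(\<lambda>z. of_real (mehler \<bar>l\<bar> s z) * (?K z)) \<in> borel_measurable borel"
        by measurable
      from lborel_integral_reflect[OF this, of w] show ?thesis by simp
    qed
    also have "\<dots> = (\<integral>z. of_real (laguerre_fun k l z) * (?H s (- l) z) \<partial>lborel)"
      by (simp add: symp_form_diff_left mult_ac)
    also have "\<dots> = of_real (s ^ k * (C * laguerre_fun k l w))"
      using fun_cong[OF step1[OF s, of "- l"], of k] l by simp
    finally show "(\<lambda>j. of_real s ^ j * (\<integral>z. of_real (laguerre_fun j l z) * (?K z) \<partial>lborel)) sums
        of_real (s ^ k * (C * laguerre_fun k l w))" .
    \<comment> \<open>The limit is a multiple of the single power s^k, so as a series in s it has
      one nonzero coefficient; this is the source of the case distinction j = k.\<close>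
    have "(\<lambda>j. if j = k then of_real s ^ j * of_real (C * laguerre_fun k l w) else 0) sums (of_real s ^ k * complex_of_real (C * laguerre_fun k l w))"
      by (rule sums_single)
    moreover have "(\<lambda>j. if j = k then of_real s ^ j * of_real (C * laguerre_fun k l w) else 0) =
      (\<lambda>j. of_real s ^ j * (if j = k then complex_of_real (C * laguerre_fun k l w) else 0))" by auto
    ultimately show "(\<lambda>j. of_real s ^ j * (if j = k then of_real (C * laguerre_fun k l w) else 0)) sums complex_of_real (s ^ k * (C * laguerre_fun k l w))"
      by simp
  qed simp
  from fun_cong[OF this, of j] show ?thesis unfolding C_def .
qed

text \<open>The normalizing constant of the transform is thus the reciprocal of the value at the
  origin, which \<open>abs_laguerre_fun_le\<close> shows to be the largest modulus.\<close>

lemma laguerre_fun_0: "laguerre_fun k l (0 :: complex ^ 'n::finite) = 1 / fan_const CARD('n) k"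
proof -
  have "Suc (CARD('n) - 1) = CARD('n)" using zero_less_card_finite[where 'a = 'n] by simp
  then have "k + (CARD('n) - 1) = k + CARD('n) - 1" by simp
  then have "real ((k + (CARD('n) - 1)) choose k) = 1 / fan_const CARD('n) k"
    using binomial_fact[OF le_add1[of k "CARD('n) - 1"], where 'a = real] by (simp add: fan_const_def)
  then show ?thesis by (simp add: laguerre_fun_def poly_laguerre_0)
qed

lemma fan_const_pos: "fan_const n k > 0"
  by (simp add: fan_const_def)

lemma fan_const_le_1: "n > 0 \<Longrightarrow> fan_const n k \<le> 1"
proof -
  assume "n > 0"
  have "fact k * fact (n - 1) * ((k + (n - 1)) choose k) = (fact (k + (n - 1)) :: nat)"
    using binomial_fact_lemma[of k "k + (n - 1)"] by simp
  then have "(fact k * fact (n - 1) :: nat) \<le> fact (k + (n - 1))"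
    by (metis le_add1 mult.right_neutral mult_le_mono2 zero_less_binomial Suc_leI One_nat_def)
  then have "(fact k * fact (n - 1) :: real) \<le> fact (k + n - 1)"
    using \<open>n > 0\<close> by (metis (mono_tags, lifting) Nat.add_diff_assoc Suc_leI One_nat_def of_nat_fact of_nat_le_iff of_nat_mult)
  then show ?thesis by (simp add: fan_const_def)
qed

text \<open>The twisted convolution of a Laguerre function with itself at w = 0, where the twist
  disappears and evenness produces the square.\<close>

lemma laguerre_fun_square_integral:
  assumes "l \<noteq> 0"
  shows "integrable lborel (\<lambda>z :: complex ^ 'n::finite. (laguerre_fun k l z)\<^sup>2)"
    and "(\<integral>z. (laguerre_fun k l (z :: complex ^ 'n::finite))\<^sup>2 \<partial>lborel) = (2 * pi / \<bar>l\<bar>) ^ CARD('n) / fan_const CARD('n) k"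
proof -
  have int: "integrable lborel (\<lambda>z :: complex ^ 'n. complex_of_real ((laguerre_fun k l z)\<^sup>2))"
  proof -
    have "norm (complex_of_real (laguerre_fun k l z)) \<le> 5 ^ k * (5/4) ^ CARD('n)" for z :: "complex ^ 'n"
      using abs_laguerre_fun_le_const by simp
    from integrable_laguerre_fun_mult[OF assms, of "\<lambda>z. complex_of_real (laguerre_fun k l z)", where k = k, OF _ this] show ?thesis
      by (simp add: power2_eq_square)
  qed
  from integrable_Re[OF this] show "integrable lborel (\<lambda>z :: complex ^ 'n::finite. (laguerre_fun k l z)\<^sup>2)"
    by (simp only: Re_complex_of_real)
  have "(\<integral>z. complex_of_real ((laguerre_fun k l (z :: complex ^ 'n::finite))\<^sup>2) \<partial>lborel) = of_real ((2 * pi / \<bar>l\<bar>) ^ CARD('n) / fan_const CARD('n) k)"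
    using laguerre_fun_twisted_convolution[OF assms, of k k "0 :: complex ^ 'n"]
    by (simp add: power2_eq_square symp_form_eq_inner imult_def laguerre_fun_0 zero_vec_def[symmetric])
  then show "(\<integral>z. (laguerre_fun k l (z :: complex ^ 'n::finite))\<^sup>2 \<partial>lborel) = (2 * pi / \<bar>l\<bar>) ^ CARD('n) / fan_const CARD('n) k"
    by (simp only: integral_complex_of_real of_real_eq_iff)
qed

text \<open>Idempotency under twisted convolution and the Cauchy-Schwarz inequality give the sharp bound.\<close>

lemma abs_laguerre_fun_le:
  fixes w :: "complex ^ 'n::finite"
  assumes l: "l \<noteq> 0"
  shows "\<bar>laguerre_fun k l w\<bar> \<le> 1 / fan_const CARD('n) k"
proof -
  let ?C = "(2 * pi / \<bar>l\<bar>) ^ CARD('n)"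
  let ?\<phi> = "laguerre_fun k l :: complex ^ 'n \<Rightarrow> real"
  have C: "?C > 0" using l by simp
  have i1: "integrable lborel (\<lambda>z. (?\<phi> z)\<^sup>2)" and v1: "(\<integral>z. (?\<phi> z)\<^sup>2 \<partial>lborel) = ?C / fan_const CARD('n) k"
    using laguerre_fun_square_integral[OF l, where 'n = 'n, of k] by auto
  have v2: "(\<integral>z. (?\<phi> (w - z))\<^sup>2 \<partial>lborel) = ?C / fan_const CARD('n) k"
    by (subst lborel_integral_reflect[of "\<lambda>z. (?\<phi> z)\<^sup>2" w]) (measurable, rule v1)
  \<comment> \<open>The integral of a non-integrable function is 0 by convention, whereas
    \<open>v2\<close> gives a positive value.\<close>
  have i2: "integrable lborel (\<lambda>z. (?\<phi> (w - z))\<^sup>2)"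
  proof (rule ccontr)
    assume "\<not> integrable lborel (\<lambda>z. (?\<phi> (w - z))\<^sup>2)"
    then have "?C / fan_const CARD('n) k = 0" using v2 not_integrable_integral_eq by fastforce
    moreover have "?C / fan_const CARD('n) k > 0" using C fan_const_pos by (rule divide_pos_pos)
    ultimately show False by linarith
  qed
  have "?C * \<bar>?\<phi> w\<bar> = norm (\<integral>z. of_real (?\<phi> z) * (of_real (?\<phi> (w - z)) * cis (l / 2 * symp_form z w)) \<partial>lborel)"
    unfolding laguerre_fun_twisted_convolution[OF l] using C by (simp add: abs_mult norm_mult norm_power norm_divide)
  also have "\<dots> \<le> (\<integral>z. ((?\<phi> z)\<^sup>2 + (?\<phi> (w - z))\<^sup>2) / 2 \<partial>lborel)"
  proof (intro order_trans[OF integral_norm_bound] integral_mono)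
    show "integrable lborel (\<lambda>z. ((?\<phi> z)\<^sup>2 + (?\<phi> (w - z))\<^sup>2) / 2)" using i1 i2 by simp
    show le: "norm (of_real (?\<phi> z) * (of_real (?\<phi> (w - z)) * cis (l / 2 * symp_form z w))) \<le> ((?\<phi> z)\<^sup>2 + (?\<phi> (w - z))\<^sup>2) / 2" for z
      using sum_squares_bound[of "\<bar>?\<phi> z\<bar>" "\<bar>?\<phi> (w - z)\<bar>"] by (simp add: norm_mult)
    show "integrable lborel (\<lambda>z. norm (of_real (?\<phi> z) * (of_real (?\<phi> (w - z)) * cis (l / 2 * symp_form z w))))"
    proof (rule integrable_norm, rule Bochner_Integration.integrable_bound)
      show "integrable lborel (\<lambda>z. ((?\<phi> z)\<^sup>2 + (?\<phi> (w - z))\<^sup>2) / 2)" using i1 i2 by simp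
      show "AE z in lborel. norm (of_real (?\<phi> z) * (of_real (?\<phi> (w - z)) * cis (l / 2 * symp_form z w))) \<le> norm (((?\<phi> z)\<^sup>2 + (?\<phi> (w - z))\<^sup>2) / 2)"
        unfolding real_norm_def[of "(_ + _) / 2"] by (intro AE_I2 order_trans[OF le abs_ge_self])
    qed measurable
  qed
  also have "\<dots> = ?C / fan_const CARD('n) k" using i1 i2 v1 v2 by simp
  finally have "?C * \<bar>?\<phi> w\<bar> \<le> ?C * (1 / fan_const CARD('n) k)" by simp
  then show ?thesis using C by (simp only: mult_le_cancel_left_pos)
qed

section \<open>Plancherel on the line\<close>

text \<open>Continuous functions of bounded support. Continuity is all that approximation by
  Gaussians asks for, and the class is stable under integrating out one variable, hence under the
  Fourier transform in the central variable.\<close>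

definition cc :: "('a::euclidean_space \<Rightarrow> complex) \<Rightarrow> bool" where
  "cc g \<longleftrightarrow> continuous_on UNIV g \<and> (\<exists>R. \<forall>x. R < norm x \<longrightarrow> g x = 0)"

lemma cc_continuous: "cc g \<Longrightarrow> continuous_on UNIV g"
  by (simp add: cc_def)

lemma cc_continuous_on: "cc g \<Longrightarrow> continuous_on A f \<Longrightarrow> continuous_on A (\<lambda>x. g (f x))"
  by (auto intro: continuous_on_compose2 dest: cc_continuous)

lemma cc_measurable: "cc g \<Longrightarrow> g \<in> borel_measurable borel"
  by (intro borel_measurable_continuous_onI cc_continuous)

lemma cc_bounded:
  assumes "cc g"
  obtains M where "M > 0" "\<And>x. norm (g x) \<le> M"
proof -
  obtain R where R: "\<And>x. R < norm x \<Longrightarrow> g x = 0" using assms by (auto simp: cc_def)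
  have "bounded (g ` cball 0 R)"
    by (intro compact_imp_bounded compact_continuous_image continuous_on_subset[OF cc_continuous[OF assms]]) auto
  then obtain M where M: "M > 0" "\<And>x. x \<in> cball 0 R \<Longrightarrow> norm (g x) \<le> M"
    unfolding bounded_pos by auto
  have "norm (g x) \<le> M" for x
    using M R[of x] by (cases "R < norm x") auto
  with M(1) show ?thesis using that by blast
qed

lemma cc_integrable:
  assumes "cc g"
  shows "integrable lborel g"
proof -
  obtain R where R: "\<And>x. R < norm x \<Longrightarrow> g x = 0" using assms by (auto simp: cc_def)
  have "integrable lborel (\<lambda>x. indicator (cball 0 R) x *\<^sub>R g x)"
    by (intro borel_integrable_compact continuous_on_subset[OF cc_continuous[OF assms]]) auto
  moreover have "(\<lambda>x. indicator (cball 0 R) x *\<^sub>R g x) = g"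
    using R by (auto simp: fun_eq_iff indicator_def)
  ultimately show ?thesis by simp
qed

lemma cc_mult: "cc g \<Longrightarrow> continuous_on UNIV h \<Longrightarrow> cc (\<lambda>x. g x * h x)"
  by (auto simp: cc_def intro!: continuous_intros)

lemma cc_cnj: "cc g \<Longrightarrow> cc (\<lambda>x. cnj (g x))"
  by (auto simp: cc_def intro!: continuous_intros)

lemma cc_tensor:
  assumes "cc g" "cc h"
  shows "cc (\<lambda>p. g (fst p) * h (snd p))"
proof -
  obtain R where R: "\<And>x. R < norm x \<Longrightarrow> g x = 0" using assms by (auto simp: cc_def)
  obtain R' where R': "\<And>x. R' < norm x \<Longrightarrow> h x = 0" using assms by (auto simp: cc_def)
  have "g (fst p) * h (snd p) = 0" if "R + R' < norm p" for p
  proof -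
    have "norm p \<le> norm (fst p) + norm (snd p)" using norm_Pair_le[of "fst p" "snd p"] by simp
    then have "R < norm (fst p) \<or> R' < norm (snd p)" using that by linarith
    then show ?thesis using R R' by auto
  qed
  then show ?thesis unfolding cc_def using assms
    by (intro conjI exI[of _ "R + R'"]) (auto intro!: continuous_intros cc_continuous_on[OF assms(1)] cc_continuous_on[OF assms(2)])
qed

lemma cc_norm_square: "cc g \<Longrightarrow> integrable lborel (\<lambda>x. (norm (g x))\<^sup>2)"
proof -
  assume g: "cc g"
  have "integrable lborel (\<lambda>x. g x * cnj (g x))"
    by (intro cc_integrable cc_mult g cc_continuous cc_cnj)
  then have "integrable lborel (\<lambda>x. Re (g x * cnj (g x)))" by (rule integrable_Re)
  then show ?thesis by (simp only: complex_norm_square[symmetric] Re_complex_of_real)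
qed

lemma integrable_tensor:
  fixes f :: "'a::euclidean_space \<Rightarrow> 'c::{banach, second_countable_topology, real_normed_field}"
    and g :: "'b::euclidean_space \<Rightarrow> 'c"
  assumes f: "integrable lborel f" and g: "integrable lborel g"
  shows "integrable lborel (\<lambda>p. f (fst p) * g (snd p))"
    and "(\<integral>p. f (fst p) * g (snd p) \<partial>lborel) = (\<integral>x. f x \<partial>lborel) * (\<integral>y. g y \<partial>lborel)"
proof -
  have [measurable]: "f \<in> borel_measurable borel" "g \<in> borel_measurable borel"
    using f g by (auto dest: borel_measurable_integrable)
  have "integrable (lborel \<Otimes>\<^sub>M lborel) (\<lambda>p. f (fst p) * g (snd p))"
    by (rule lborel_pair.Fubini_integrable) (auto simp: norm_mult f g)
  then show *: "integrable lborel (\<lambda>p. f (fst p) * g (snd p))" by (simp add: lborel_prod)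
  show "(\<integral>p. f (fst p) * g (snd p) \<partial>lborel) = (\<integral>x. f x \<partial>lborel) * (\<integral>y. g y \<partial>lborel)"
    using lborel_pair.integral_fst'[of "\<lambda>p. f (fst p) * g (snd p)"] * by (simp add: lborel_prod)
qed

lemma lborel_pair_integral:
  fixes f :: "'a::euclidean_space \<times> 'b::euclidean_space \<Rightarrow> 'c::{banach, second_countable_topology}"
  assumes "integrable lborel f"
  shows "(\<integral>p. f p \<partial>lborel) = (\<integral>x. \<integral>y. f (x, y) \<partial>lborel \<partial>lborel)"
    and "(\<integral>p. f p \<partial>lborel) = (\<integral>y. \<integral>x. f (x, y) \<partial>lborel \<partial>lborel)"
  using lborel_pair.integral_fst'[of f] lborel_pair.integral_snd[of "\<lambda>x y. f (x, y)"] assms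
  by (simp_all add: lborel_prod)

text \<open>Doubling the variable: the squared modulus of a transform becomes an integral over pairs
  in which the outer parameter sits in the kernel alone, so Fubini's theorem can integrate that
  parameter first.\<close>

lemma integral_norm_square_tensor:
  assumes "integrable lborel f"
  shows "of_real ((norm (\<integral>x. f x \<partial>lborel :: complex))\<^sup>2) = (\<integral>p. f (fst p) * cnj (f (snd p)) \<partial>lborel)"
  using integrable_tensor(2)[OF assms, of "\<lambda>x. cnj (f x)"] assms
  by (simp add: complex_norm_square[symmetric])

text \<open>Substituting \<^term>\<open>x = y + \<delta> *\<^sub>R v\<close> turns the double integral into an integral of
  \<^term>\<open>g (y + \<delta> *\<^sub>R v) * cnj (g y) * \<theta> (y + \<delta> *\<^sub>R v, y)\<close> against a fixed Gaussian in \<^term>\<open>v\<close>.\<close>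

lemma gaussian_approximate_identity:
  fixes g :: "'a::euclidean_space \<Rightarrow> complex" and \<theta> :: "'a \<times> 'a \<Rightarrow> complex"
  assumes g: "cc g" and \<theta>: "continuous_on UNIV \<theta>" "\<And>p. norm (\<theta> p) \<le> 1" "\<And>x. \<theta> (x, x) = 1"
    and \<delta>: "\<And>j. \<delta> j > 0" "\<delta> \<longlonglongrightarrow> 0"
  shows "(\<lambda>j. of_real (1 / \<delta> j ^ DIM('a)) * (\<integral>p. g (fst p) * cnj (g (snd p)) *
      (\<theta> p * of_real (exp (- (norm (fst p - snd p))\<^sup>2 / (\<delta> j)\<^sup>2))) \<partial>lborel))
    \<longlonglongrightarrow> of_real (sqrt pi ^ DIM('a) * (\<integral>x. (norm (g x))\<^sup>2 \<partial>lborel))"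
proof -
  note [continuous_intros] = cc_continuous_on[OF g] continuous_on_compose2[OF \<theta>(1)]
  obtain M where M: "M > 0" "\<And>x. norm (g x) \<le> M" using cc_bounded[OF g] by blast
  define H where "H d q = g (fst q + d *\<^sub>R snd q) * cnj (g (fst q)) * (\<theta> (fst q + d *\<^sub>R snd q, fst q) * of_real (exp (- 1 * (norm (snd q))\<^sup>2)))"
    for d :: real and q
  \<comment> \<open>A majorant independent of d: one factor g is bounded by M, the other gives
    integrability in y, and the Gaussian gives it in v.\<close>
  define W where "W q = M * norm (g (fst q)) * exp (- 1 * (norm (snd q :: 'a))\<^sup>2)" for q
  have Wint: "integrable lborel W"
    unfolding W_def
    by (intro integrable_tensor(1) integrable_mult_right integrable_norm cc_integrable g integrable_exp_norm_square) simp
  have Hm: "H d \<in> borel_measurable borel" for d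
    unfolding H_def by (intro borel_measurable_continuous_onI continuous_intros) auto
  have HW: "norm (H d q) \<le> W q" for d q
  proof -
    have "norm (H d q) = (norm (g (fst q + d *\<^sub>R snd q)) * norm (\<theta> (fst q + d *\<^sub>R snd q, fst q))) * (norm (g (fst q)) * exp (- 1 * (norm (snd q))\<^sup>2))"
      by (simp add: H_def norm_mult)
    also have "\<dots> \<le> (M * 1) * (norm (g (fst q)) * exp (- 1 * (norm (snd q))\<^sup>2))"
      using M by (intro mult_mono \<theta>) auto
    finally show ?thesis by (simp add: W_def)
  qed
  have Hint: "integrable lborel (H d)" for d
    by (rule Bochner_Integration.integrable_bound[OF Wint])
      (use Hm HW in \<open>auto intro!: AE_I2 order_trans[OF HW abs_ge_self]\<close>)
  have eq: "of_real (1 / \<delta> j ^ DIM('a)) * (\<integral>p. g (fst p) * cnj (g (snd p)) *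
      (\<theta> p * of_real (exp (- (norm (fst p - snd p))\<^sup>2 / (\<delta> j)\<^sup>2))) \<partial>lborel) = (\<integral>q. H (\<delta> j) q \<partial>lborel)" for j
  proof -
    define F where "F p = g (fst p) * cnj (g (snd p)) * (\<theta> p * of_real (exp (- (norm (fst p - snd p))\<^sup>2 / (\<delta> j)\<^sup>2)))" for p
    have F: "cc F" unfolding F_def
      by (intro cc_mult cc_tensor cc_cnj g continuous_intros) (use \<delta>(1)[of j] in auto)
    have inner: "(\<integral>x. F (x, y) \<partial>lborel) = of_real (\<delta> j ^ DIM('a)) * (\<integral>v. H (\<delta> j) (y, v) \<partial>lborel)" for y
    proof -
      have "(\<lambda>x. F (x, y)) \<in> borel_measurable borel"
        by (intro borel_measurable_continuous_onI cc_continuous_on[OF F] continuous_intros)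
      from lborel_integral_affine[OF this, of "\<delta> j" y] \<delta>(1)[of j]
      have "(\<integral>x. F (x, y) \<partial>lborel) = of_real (\<delta> j ^ DIM('a)) * (\<integral>v. F (y + \<delta> j *\<^sub>R v, y) \<partial>lborel)"
        by (simp add: scaleR_conv_of_real)
      also have "(\<lambda>v. F (y + \<delta> j *\<^sub>R v, y)) = (\<lambda>v. H (\<delta> j) (y, v))"
        using \<delta>(1)[of j] by (auto simp: F_def H_def fun_eq_iff power_mult_distrib)
      finally show ?thesis .
    qed
    have "(\<integral>p. F p \<partial>lborel) = of_real (\<delta> j ^ DIM('a)) * (\<integral>q. H (\<delta> j) q \<partial>lborel)"
      unfolding lborel_pair_integral(2)[OF cc_integrable[OF F]] inner lborel_pair_integral(1)[OF Hint] by simp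
    then show ?thesis unfolding F_def using \<delta>(1)[of j] by simp
  qed
  have "(\<lambda>j. \<integral>q. H (\<delta> j) q \<partial>lborel) \<longlonglongrightarrow> (\<integral>q. of_real ((norm (g (fst q)))\<^sup>2 * exp (- 1 * (norm (snd q :: 'a))\<^sup>2)) \<partial>lborel)"
  proof (rule integral_dominated_convergence[where w = W])
    show "integrable lborel W" by (rule Wint)
    show "H (\<delta> j) \<in> borel_measurable lborel" for j using Hm by simp
    show "(\<lambda>q :: 'a \<times> 'a. complex_of_real ((norm (g (fst q)))\<^sup>2 * exp (- 1 * (norm (snd q))\<^sup>2))) \<in> borel_measurable lborel"
      by (simp, intro borel_measurable_continuous_onI continuous_intros)
    show "AE q in lborel. norm (H (\<delta> j) q) \<le> W q" for j using HW by simp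
    show "AE q in lborel. (\<lambda>j. H (\<delta> j) q) \<longlonglongrightarrow> of_real ((norm (g (fst q)))\<^sup>2 * exp (- 1 * (norm (snd q))\<^sup>2))"
    proof (rule AE_I2)
      fix q :: "'a \<times> 'a"
      have *: "(\<lambda>j. fst q + \<delta> j *\<^sub>R snd q) \<longlonglongrightarrow> fst q"
        by (auto intro!: tendsto_eq_intros \<delta>)
      have "(\<lambda>j. H (\<delta> j) q) \<longlonglongrightarrow> g (fst q) * cnj (g (fst q)) * (\<theta> (fst q, fst q) * of_real (exp (- 1 * (norm (snd q))\<^sup>2)))"
        unfolding H_def
        by (intro tendsto_intros continuous_on_tendsto_compose[OF cc_continuous[OF g]]
            continuous_on_tendsto_compose[OF \<theta>(1)] *) auto
      then show "(\<lambda>j. H (\<delta> j) q) \<longlonglongrightarrow> of_real ((norm (g (fst q)))\<^sup>2 * exp (- 1 * (norm (snd q))\<^sup>2))"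
        by (simp add: \<theta>(3) complex_norm_square[symmetric])
    qed
  qed
  also have "(\<integral>q. complex_of_real ((norm (g (fst q)))\<^sup>2 * exp (- 1 * (norm (snd q :: 'a))\<^sup>2)) \<partial>lborel) =
      of_real (sqrt pi ^ DIM('a) * (\<integral>x. (norm (g x))\<^sup>2 \<partial>lborel))"
    unfolding integral_complex_of_real
      integrable_tensor(2)[OF cc_norm_square[OF g] integrable_exp_norm_square[OF zero_less_one]]
      integral_exp_norm_square[OF zero_less_one] by (simp add: mult.commute)
  finally show ?thesis unfolding eq .
qed

text \<open>The factor exp (- \<delta>^2 l^2 / 4) makes Fubini's theorem applicable to the doubled
  integral. Integrating l first produces exp (- (x - y)^2 / \<delta>^2), a Gaussian approximate
  identity as \<delta> tends to 0, while on the frequency side the regularization is removed by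
  monotone convergence.\<close>

lemma plancherel_real_cc:
  fixes g :: "real \<Rightarrow> complex"
  assumes g: "cc g"
  shows "(\<integral>\<^sup>+l. ennreal ((norm (\<integral>t. g t * cis (- (l * t)) \<partial>lborel))\<^sup>2) \<partial>lborel)
    = ennreal (2 * pi * (\<integral>t. (norm (g t))\<^sup>2 \<partial>lborel))"
proof -
  note [measurable] = cc_measurable[OF g]
  define G where "G l = (\<integral>t. g t * cis (- (l * t)) \<partial>lborel)" for l
  have [measurable]: "G \<in> borel_measurable borel" unfolding G_def[abs_def] cis_conv_exp by measurable
  define \<delta> where "\<delta> j = 1 / real (Suc j)" for j
  have \<delta>: "\<delta> j > 0" for j by (simp add: \<delta>_def)
  have \<delta>0: "\<delta> \<longlonglongrightarrow> 0" unfolding \<delta>_def by (rule LIMSEQ_Suc[OF lim_1_over_n])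
  let ?E = "\<lambda>j (l :: real). exp (- ((\<delta> j)\<^sup>2 / 4) * l\<^sup>2)"
  let ?D = "\<lambda>j. of_real (1 / \<delta> j ^ DIM(real)) * (\<integral>p. g (fst p) * cnj (g (snd p)) *
      (1 * of_real (exp (- (norm (fst p - snd p))\<^sup>2 / (\<delta> j)\<^sup>2))) \<partial>lborel)"
  have G2: "of_real ((norm (G l))\<^sup>2) = (\<integral>p. g (fst p) * cnj (g (snd p)) * cis (- (l * (fst p - snd p))) \<partial>lborel)" for l
  proof -
    have "integrable lborel (\<lambda>t. g t * cis (- (l * t)))"
      by (intro cc_integrable cc_mult g continuous_intros)
    from integral_norm_square_tensor[OF this] show ?thesis
      unfolding G_def by (simp add: cis_cnj cis_mult algebra_simps)
  qed
  have smooth: "integrable lborel (\<lambda>l. ?E j l * (norm (G l))\<^sup>2) \<and>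
      of_real (\<integral>l. ?E j l * (norm (G l))\<^sup>2 \<partial>lborel) =
      of_real (2 * sqrt pi) * (?D j)" for j
  proof -
    define e where "e = (\<delta> j)\<^sup>2 / 4"
    have e: "e > 0" using \<delta>[of j] by (simp add: e_def)
    define K where "K p l = exp (complex_of_real (- e * l\<^sup>2 + l * 0) + \<i> * of_real (l * (- (fst p - snd p))))" for p :: "real \<times> real" and l :: real
    have K: "K p l = of_real (exp (- e * l\<^sup>2)) * cis (- (l * (fst p - snd p)))" for p l
      unfolding K_def cis_conv_exp exp_of_real[symmetric] exp_add[symmetric] by (simp add: algebra_simps)
    define F where "F q = g (fst (fst q)) * cnj (g (snd (fst q))) * K (fst q) (snd q)" for q
    have gg: "cc (\<lambda>p. g (fst p) * cnj (g (snd p)))" by (intro cc_tensor cc_cnj g)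
    have Fm: "F \<in> borel_measurable borel"
      unfolding F_def K by (intro borel_measurable_continuous_onI continuous_intros cc_continuous_on[OF g])
    have Fint: "integrable lborel F"
    proof (rule Bochner_Integration.integrable_bound)
      show "integrable lborel (\<lambda>q. norm (g (fst (fst q)) * cnj (g (snd (fst q)))) * exp (- e * (norm (snd q))\<^sup>2))"
        by (intro integrable_tensor(1)[where f = "\<lambda>p. norm (g (fst p) * cnj (g (snd p)))"] integrable_norm cc_integrable gg integrable_exp_norm_square e)
      show "AE q in lborel. norm (F q) \<le> norm (norm (g (fst (fst q)) * cnj (g (snd (fst q)))) * exp (- e * (norm (snd q))\<^sup>2))"
        by (simp add: F_def K norm_mult)
    qed (use Fm in simp)
    have 1: "(\<integral>p. F (p, l) \<partial>lborel) = of_real (exp (- e * l\<^sup>2) * (norm (G l))\<^sup>2)" for l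
      unfolding of_real_mult G2 integral_mult_right_zero[symmetric] by (simp add: F_def K mult_ac)
    have 2: "(\<integral>l. F (p, l) \<partial>lborel) = g (fst p) * cnj (g (snd p)) *
        of_real (2 * sqrt pi / \<delta> j * exp (- (norm (fst p - snd p))\<^sup>2 / (\<delta> j)\<^sup>2))" for p
    proof -
      have "sqrt (pi / e) = 2 * sqrt pi / \<delta> j"
        unfolding e_def using \<delta>[of j] by (simp add: real_sqrt_divide real_sqrt_mult)
      then have "(\<integral>l. K p l \<partial>lborel) = of_real (2 * sqrt pi / \<delta> j * exp (- (norm (fst p - snd p))\<^sup>2 / (\<delta> j)\<^sup>2))"
        unfolding K_def gaussian_integral_real(2)[OF e]
        by (simp add: exp_of_real[symmetric] e_def power_divide power2_commute)
      then show ?thesis by (simp add: F_def)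
    qed
    have "integrable lborel (\<lambda>l. \<integral>p. F (p, l) \<partial>lborel)"
      using lborel_pair.integrable_snd[of "\<lambda>p l. F (p, l)"] Fint by (simp add: lborel_prod)
    then have "integrable lborel (\<lambda>l. exp (- e * l\<^sup>2) * (norm (G l))\<^sup>2)"
      unfolding 1 by (auto dest: integrable_Re)
    moreover have "of_real (\<integral>l. exp (- e * l\<^sup>2) * (norm (G l))\<^sup>2 \<partial>lborel) = (\<integral>q. F q \<partial>lborel)"
      unfolding lborel_pair_integral(2)[OF Fint] 1 integral_complex_of_real ..
    moreover have "(\<integral>q. F q \<partial>lborel) = of_real (2 * sqrt pi) * (?D j)"
      unfolding lborel_pair_integral(1)[OF Fint] 2 integral_mult_right_zero[symmetric]
      by (intro Bochner_Integration.integral_cong) (auto simp: mult_ac)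
    ultimately show ?thesis unfolding e_def by simp
  qed
  have "(\<lambda>j. complex_of_real (2 * sqrt pi) * (?D j))
      \<longlonglongrightarrow> of_real (2 * sqrt pi) * of_real (sqrt pi ^ DIM(real) * (\<integral>t. (norm (g t))\<^sup>2 \<partial>lborel))"
    by (intro tendsto_mult_left gaussian_approximate_identity[OF g, where \<theta> = "\<lambda>_. 1"] \<delta> \<delta>0) auto
  moreover have twopi: "2 * sqrt pi * sqrt pi = 2 * pi" by simp
  ultimately have "(\<lambda>j. complex_of_real (\<integral>l. ?E j l * (norm (G l))\<^sup>2 \<partial>lborel))
      \<longlonglongrightarrow> of_real (2 * pi * (\<integral>t. (norm (g t))\<^sup>2 \<partial>lborel))"
    unfolding smooth[THEN conjunct2]
    by (simp only: DIM_real power_one_right of_real_mult[symmetric] mult.assoc[symmetric] twopi)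
  then have lim: "(\<lambda>j. \<integral>l. ?E j l * (norm (G l))\<^sup>2 \<partial>lborel)
      \<longlonglongrightarrow> 2 * pi * (\<integral>t. (norm (g t))\<^sup>2 \<partial>lborel)"
    by (simp only: tendsto_of_real_iff)
  have "(\<lambda>j. \<integral>\<^sup>+l. ennreal (?E j l * (norm (G l))\<^sup>2) \<partial>lborel) \<longlonglongrightarrow> (\<integral>\<^sup>+l. ennreal ((norm (G l))\<^sup>2) \<partial>lborel)"
  proof (rule nn_integral_LIMSEQ)
    show "incseq (\<lambda>j l. ennreal (?E j l * (norm (G l))\<^sup>2))"
    proof (intro incseq_SucI le_funI ennreal_leI mult_right_mono)
      fix j and l :: real
      have "\<delta> (Suc j) \<le> \<delta> j" by (simp add: \<delta>_def frac_le)
      then have "(\<delta> (Suc j))\<^sup>2 \<le> (\<delta> j)\<^sup>2" using \<delta>[of "Suc j"] by (intro power_mono) auto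
      then show "?E j l \<le> exp (- ((\<delta> (Suc j))\<^sup>2 / 4) * l\<^sup>2)"
        by (simp add: mult_right_mono)
    qed auto
    show "(\<lambda>j. ennreal (?E j l * (norm (G l))\<^sup>2)) \<longlonglongrightarrow> ennreal ((norm (G l))\<^sup>2)" for l
    proof (intro tendsto_ennrealI)
      have "(\<lambda>j. ?E j l * (norm (G l))\<^sup>2) \<longlonglongrightarrow> exp (- (0\<^sup>2 / 4) * l\<^sup>2) * (norm (G l))\<^sup>2"
        by (intro tendsto_intros \<delta>0) auto
      then show "(\<lambda>j. ?E j l * (norm (G l))\<^sup>2) \<longlonglongrightarrow> (norm (G l))\<^sup>2" by simp
    qed
  qed measurable
  moreover have "(\<integral>\<^sup>+l. ennreal (?E j l * (norm (G l))\<^sup>2) \<partial>lborel) =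
      ennreal (\<integral>l. ?E j l * (norm (G l))\<^sup>2 \<partial>lborel)" for j
    by (rule nn_integral_eq_integral) (use smooth[of j] in auto)
  ultimately show ?thesis
    using LIMSEQ_unique[OF _ tendsto_ennrealI[OF lim]] unfolding G_def by (simp only:)
qed

section \<open>Plancherel for the twisted convolution\<close>

text \<open>The sign of the twist is that of the time component of (z, t)^-1 (w, 0). On the k-th ray
  the transform of f is \<open>fan_const\<close> times this convolution, applied to the Fourier
  transform of f in t.\<close>

definition tconv :: "nat \<Rightarrow> real \<Rightarrow> (complex ^ 'n::finite \<Rightarrow> complex) \<Rightarrow> complex ^ 'n \<Rightarrow> complex" where
  "tconv k l g w = (\<integral>z. g z * (of_real (laguerre_fun k l (w - z)) * cis (- (l / 2) * symp_form z w)) \<partial>lborel)"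

lemma lborel_integrable_affine:
  fixes f :: "'a::euclidean_space \<Rightarrow> 'b::{banach, second_countable_topology}"
  assumes f: "integrable lborel f" and "c \<noteq> 0"
  shows "integrable lborel (\<lambda>z. f (t + c *\<^sub>R z))"
proof -
  have [measurable]: "f \<in> borel_measurable borel" using f by (auto dest: borel_measurable_integrable)
  have "integrable (density (distr lborel borel (\<lambda>x. t + c *\<^sub>R x)) (\<lambda>_. ennreal (\<bar>c\<bar> ^ DIM('a)))) f"
    using f lborel_affine[OF assms(2), of t] by (simp add: ennreal_power)
  then have "integrable lborel (\<lambda>x. \<bar>c\<bar> ^ DIM('a) *\<^sub>R f (t + c *\<^sub>R x))"
    by (simp add: integrable_density integrable_distr_eq)
  from integrable_scaleR_right[OF this, of "1 / \<bar>c\<bar> ^ DIM('a)"] show ?thesis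
    using assms(2) by simp
qed

text \<open>After doubling the variable, the integral over w is a twisted convolution of the
  Laguerre function with itself, which returns that function times (2 pi / |l|)^n. Up to this
  constant it is the identity <P g, P g> = <P g, g> for a projection P.\<close>

lemma tconv_norm_square:
  fixes g :: "complex ^ 'n::finite \<Rightarrow> complex"
  assumes l: "l \<noteq> 0" and g: "cc g"
  shows "integrable lborel (\<lambda>w. (norm (tconv k l g w))\<^sup>2)"
    and "of_real (\<integral>w. (norm (tconv k l g w))\<^sup>2 \<partial>lborel) = of_real ((2 * pi / \<bar>l\<bar>) ^ CARD('n)) *
      (\<integral>p. g (fst p) * cnj (g (snd p)) *
        (of_real (laguerre_fun k l (fst p - snd p)) * cis (- (l / 2) * symp_form (fst p) (snd p))) \<partial>lborel)"
proof -
  let ?\<phi> = "laguerre_fun k l :: complex ^ 'n \<Rightarrow> real"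
  note [continuous_intros] = cc_continuous_on[OF g]
  define B where "B = 5 ^ k * (5/4 :: real) ^ CARD('n)"
  have B: "\<bar>?\<phi> z\<bar> \<le> B" for z unfolding B_def by (rule abs_laguerre_fun_le_const)
  have B0: "B \<ge> 0" by (simp add: B_def)
  define G where "G p = g (fst p) * cnj (g (snd p))" for p
  have G: "cc G" unfolding G_def by (intro cc_tensor cc_cnj g)
  define F where "F q = G (fst q) * of_real (?\<phi> (snd q - fst (fst q)) * ?\<phi> (snd q - snd (fst q))) *
      cis (- (l / 2) * symp_form (fst (fst q) - snd (fst q)) (snd q))" for q
  have Fm: "F \<in> borel_measurable borel"
    unfolding F_def by (intro borel_measurable_continuous_onI continuous_intros cc_continuous_on[OF G])
  \<comment> \<open>Of the two Laguerre factors one is bounded by the constant B, the other supplies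
    integrability in w.\<close>
  define H where "H q = (norm (G (fst q)) * B) * \<bar>?\<phi> (snd q - fst (fst q))\<bar>" for q
  have Hm: "H \<in> borel_measurable borel"
    unfolding H_def by (intro borel_measurable_continuous_onI continuous_intros cc_continuous_on[OF G])
  have \<phi>int: "integrable lborel (\<lambda>z. \<bar>?\<phi> z\<bar>)"
    using integrable_laguerre_fun_mult[OF l, of "\<lambda>_. 1" 1 k] by (auto dest: integrable_norm)
  have \<phi>int': "integrable lborel (\<lambda>w. \<bar>?\<phi> (w - z)\<bar>)" for z
    using lborel_integrable_affine[OF \<phi>int, of 1 "- z"] by simp
  have Hint: "integrable lborel H"
  proof -
    have "integrable (lborel \<Otimes>\<^sub>M lborel) H"
    proof (rule lborel_pair.Fubini_integrable)
      show "AE p in lborel. integrable lborel (\<lambda>w. H (p, w))"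
        unfolding H_def by (intro AE_I2 integrable_mult_right) (simp add: \<phi>int')
      have "(\<integral>w. norm (H (p, w)) \<partial>lborel) = norm (G p) * (B * (\<integral>z. \<bar>?\<phi> z\<bar> \<partial>lborel))" for p
      proof -
        have "(\<integral>w. \<bar>?\<phi> (w - fst p)\<bar> \<partial>lborel) = (\<integral>z. \<bar>?\<phi> z\<bar> \<partial>lborel)"
          by (subst lborel_integral_affine[where t = "- fst p" and c = 1 and f = "\<lambda>z. \<bar>?\<phi> z\<bar>"]) simp_all
        then show ?thesis using B0 by (simp add: H_def abs_mult)
      qed
      then show "integrable lborel (\<lambda>p. \<integral>w. norm (H (p, w)) \<partial>lborel)"
        by (simp only:) (intro integrable_mult_left integrable_norm cc_integrable G)
    qed (use Hm in \<open>simp add: lborel_prod\<close>)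
    then show ?thesis by (simp add: lborel_prod)
  qed
  have Fint: "integrable lborel F"
  proof (rule Bochner_Integration.integrable_bound[OF Hint])
    have "norm (F q) \<le> norm (H q)" for q
    proof -
      have "norm (F q) = (norm (G (fst q)) * \<bar>?\<phi> (snd q - snd (fst q))\<bar>) * \<bar>?\<phi> (snd q - fst (fst q))\<bar>"
        by (simp add: F_def norm_mult abs_mult)
      also have "\<dots> \<le> H q" unfolding H_def by (intro mult_mono B) (auto simp: B0)
      finally show ?thesis by simp
    qed
    then show "AE q in lborel. norm (F q) \<le> norm (H q)" by simp
  qed (use Fm in simp)
  have 1: "(\<integral>p. F (p, w) \<partial>lborel) = of_real ((norm (tconv k l g w))\<^sup>2)" for w
  proof -
    have "integrable lborel (\<lambda>z. g z * (of_real (?\<phi> (w - z)) * cis (- (l / 2) * symp_form z w)))"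
      by (intro cc_integrable cc_mult g continuous_intros)
    from integral_norm_square_tensor[OF this]
    have "of_real ((norm (tconv k l g w))\<^sup>2) = (\<integral>p. g (fst p) * (of_real (?\<phi> (w - fst p)) * cis (- (l / 2) * symp_form (fst p) w)) *
        cnj (g (snd p) * (of_real (?\<phi> (w - snd p)) * cis (- (l / 2) * symp_form (snd p) w))) \<partial>lborel)"
      unfolding tconv_def .
    also have "\<dots> = (\<integral>p. F (p, w) \<partial>lborel)"
    proof (rule Bochner_Integration.integral_cong)
      fix p :: "(complex ^ 'n) \<times> (complex ^ 'n)"
      have "cis (- (l / 2) * symp_form (fst p - snd p) w) = cis (- (l / 2) * symp_form (fst p) w) * cnj (cis (- (l / 2) * symp_form (snd p) w))"
        by (simp add: cis_cnj cis_mult symp_form_diff_left algebra_simps)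
      then show "g (fst p) * (of_real (?\<phi> (w - fst p)) * cis (- (l / 2) * symp_form (fst p) w)) *
        cnj (g (snd p) * (of_real (?\<phi> (w - snd p)) * cis (- (l / 2) * symp_form (snd p) w))) = F (p, w)"
        by (simp add: F_def G_def mult_ac)
    qed simp
    finally show ?thesis by simp
  qed
  \<comment> \<open>Substituting w = \<open>snd p\<close> + v turns the product of the two Laguerre
    factors into a convolution evaluated at u; bilinearity of the form splits off a phase that
    depends on p alone.\<close>
  have 2: "(\<integral>w. F (p, w) \<partial>lborel) = of_real ((2 * pi / \<bar>l\<bar>) ^ CARD('n)) *
      (g (fst p) * cnj (g (snd p)) * (of_real (?\<phi> (fst p - snd p)) * cis (- (l / 2) * symp_form (fst p) (snd p))))" for p
  proof -
    define u where "u = fst p - snd p"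
    have "(\<lambda>w. F (p, w)) \<in> borel_measurable borel"
      unfolding F_def by (intro borel_measurable_continuous_onI continuous_intros cc_continuous_on[OF G])
    from lborel_integral_affine[OF this, of 1 "snd p"]
    have "(\<integral>w. F (p, w) \<partial>lborel) = (\<integral>v. F (p, snd p + v) \<partial>lborel)" by simp
    also have "(\<lambda>v. F (p, snd p + v)) = (\<lambda>v. (G p * cis (- (l / 2) * symp_form (fst p) (snd p))) *
        (of_real (?\<phi> v) * (of_real (?\<phi> (u - v)) * cis (l / 2 * symp_form v u))))"
    proof
      fix v
      have "?\<phi> (snd p + v - fst p) = ?\<phi> (u - v)"
        using laguerre_fun_minus[of k l "u - v"] by (simp add: u_def algebra_simps)
      moreover have s: "symp_form u (snd p + v) = symp_form (fst p) (snd p) - symp_form v u"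
        by (subst symp_form_swap[of v u]) (simp add: u_def symp_form_add_right symp_form_diff_left)
      have "cis (- (l / 2) * symp_form u (snd p + v)) = cis (- (l / 2) * symp_form (fst p) (snd p)) * cis (l / 2 * symp_form v u)"
        unfolding s cis_mult by (simp add: algebra_simps)
      ultimately show "F (p, snd p + v) = (G p * cis (- (l / 2) * symp_form (fst p) (snd p))) *
        (of_real (?\<phi> v) * (of_real (?\<phi> (u - v)) * cis (l / 2 * symp_form v u)))"
        unfolding F_def by (simp add: u_def[symmetric])
    qed
    also have "(\<integral>v. (G p * cis (- (l / 2) * symp_form (fst p) (snd p))) *
        (of_real (?\<phi> v) * (of_real (?\<phi> (u - v)) * cis (l / 2 * symp_form v u))) \<partial>lborel) =
        (G p * cis (- (l / 2) * symp_form (fst p) (snd p))) * of_real ((2 * pi / \<bar>l\<bar>) ^ CARD('n) * ?\<phi> u)"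
      unfolding integral_mult_right_zero laguerre_fun_twisted_convolution[OF l] by simp
    finally show ?thesis by (simp add: G_def u_def mult_ac)
  qed
  have "integrable lborel (\<lambda>w. \<integral>p. F (p, w) \<partial>lborel)"
    using lborel_pair.integrable_snd[of "\<lambda>p w. F (p, w)"] Fint by (simp add: lborel_prod)
  then show "integrable lborel (\<lambda>w. (norm (tconv k l g w))\<^sup>2)"
    unfolding 1 by (auto dest: integrable_Re)
  have "of_real (\<integral>w. (norm (tconv k l g w))\<^sup>2 \<partial>lborel) = (\<integral>q. F q \<partial>lborel)"
    unfolding lborel_pair_integral(2)[OF Fint] 1 integral_complex_of_real ..
  also have "\<dots> = of_real ((2 * pi / \<bar>l\<bar>) ^ CARD('n)) *
      (\<integral>p. g (fst p) * cnj (g (snd p)) *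
        (of_real (laguerre_fun k l (fst p - snd p)) * cis (- (l / 2) * symp_form (fst p) (snd p))) \<partial>lborel)"
    unfolding lborel_pair_integral(1)[OF Fint] 2 integral_mult_right_zero ..
  finally show "of_real (\<integral>w. (norm (tconv k l g w))\<^sup>2 \<partial>lborel) = of_real ((2 * pi / \<bar>l\<bar>) ^ CARD('n)) *
      (\<integral>p. g (fst p) * cnj (g (snd p)) *
        (of_real (laguerre_fun k l (fst p - snd p)) * cis (- (l / 2) * symp_form (fst p) (snd p))) \<partial>lborel)" .
qed

text \<open>Partial sums of nonnegative terms lie below the limit of the Abel means, which gives
  convergence; each Abel mean lies below the full sum, which gives equality.\<close>

lemma nonneg_abel_sums:
  fixes a :: "nat \<Rightarrow> real"
  assumes a: "\<And>k. a k \<ge> 0" and r: "\<And>j. 0 < r j" "\<And>j. r j < 1" "r \<longlonglongrightarrow> 1"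
    and f: "\<And>j. (\<lambda>k. r j ^ k * a k) sums f j" "f \<longlonglongrightarrow> L"
  shows "a sums L"
proof -
  have le: "(\<Sum>k<N. a k) \<le> L" for N
  proof (rule tendsto_le[OF _ f(2)])
    show "(\<lambda>j. \<Sum>k<N. r j ^ k * a k) \<longlonglongrightarrow> (\<Sum>k<N. a k)"
      by (rule tendsto_eq_intros r(3) refl | simp)+
    show "\<forall>\<^sub>F j in sequentially. (\<Sum>k<N. r j ^ k * a k) \<le> f j"
    proof (intro always_eventually allI)
      fix j
      have "0 \<le> r j" using r(1)[of j] by simp
      then show "(\<Sum>k<N. r j ^ k * a k) \<le> f j"
        unfolding sums_unique[OF f(1)]
        by (intro sum_le_suminf sums_summable[OF f(1)]) (auto intro!: mult_nonneg_nonneg a)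
    qed
  qed simp
  have summ: "summable a"
    by (rule summableI_nonneg_bounded[OF a le])
  have "L \<le> suminf a"
  proof (rule tendsto_upperbound[OF f(2)])
    show "\<forall>\<^sub>F j in sequentially. f j \<le> suminf a"
    proof (intro always_eventually allI)
      fix j
      have "r j ^ k * a k \<le> a k" for k
        using a[of k] r(1,2)[of j] by (simp add: mult_left_le_one_le power_le_one less_imp_le)
      then have "(\<Sum>k. r j ^ k * a k) \<le> suminf a"
        using f(1)[of j] summ by (intro suminf_le) (auto simp: sums_iff)
      then show "f j \<le> suminf a" using f(1)[of j] by (simp add: sums_iff)
    qed
  qed simp
  moreover have "suminf a \<le> L" using le summ by (intro suminf_le_const)
  ultimately show ?thesis using summ by (simp add: sums_iff)
qed

text \<open>With Abel weights r^k the doubled integrals add up to one with the Mehler kernel, an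
  approximate identity as r tends to 1. One factor (2 pi / |l|)^n comes from
  \<open>tconv_norm_square\<close>, the other is the limiting mass of the kernel.\<close>

lemma tconv_plancherel:
  fixes g :: "complex ^ 'n::finite \<Rightarrow> complex"
  assumes l: "l \<noteq> 0" and g: "cc g"
  shows "(\<lambda>k. \<integral>w. (norm (tconv k l g w))\<^sup>2 \<partial>lborel) sums ((2 * pi / \<bar>l\<bar>) ^ (2 * CARD('n)) * (\<integral>z. (norm (g z))\<^sup>2 \<partial>lborel))"
proof -
  let ?n = "CARD('n)"
  define C where "C = (2 * pi / \<bar>l\<bar>) ^ ?n"
  define G where "G p = g (fst p) * cnj (g (snd p))" for p
  have G: "cc G" unfolding G_def by (intro cc_tensor cc_cnj g)
  define \<theta> where "\<theta> p = cis (- (l / 2) * symp_form (fst p) (snd p))" for p :: "(complex ^ 'n) \<times> (complex ^ 'n)"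
  have \<theta>: "continuous_on UNIV \<theta>" unfolding \<theta>_def by (intro continuous_intros)
  define r where "r j = 1 - 1 / real (Suc (Suc j))" for j
  have r: "0 < r j" "r j < 1" for j by (simp_all add: r_def)
  have "(\<lambda>j. 1 / real (Suc (Suc j))) \<longlonglongrightarrow> 0" by (intro LIMSEQ_Suc lim_1_over_n)
  from tendsto_diff[OF tendsto_const this, of 1] have r1: "r \<longlonglongrightarrow> 1" by (simp add: r_def[abs_def])
  \<comment> \<open>The width for which the exponent of the Mehler kernel is -|z|^2 /
    \<delta>^2.\<close>
  define \<delta> where "\<delta> j = sqrt (4 * (1 - r j) / (\<bar>l\<bar> * (1 + r j)))" for j
  have \<delta>: "\<delta> j > 0" for j using l r[of j] by (auto simp: \<delta>_def intro!: divide_pos_pos mult_pos_pos)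
  have "\<delta> \<longlonglongrightarrow> sqrt (4 * (1 - 1) / (\<bar>l\<bar> * (1 + 1)))"
    unfolding \<delta>_def by (intro tendsto_intros r1) (use l in auto)
  then have \<delta>0: "\<delta> \<longlonglongrightarrow> 0" by simp
  define A where "A j = (\<integral>p. G p * (of_real (mehler \<bar>l\<bar> (r j) (fst p - snd p)) * \<theta> p) \<partial>lborel)" for j
  have series: "(\<lambda>k. of_real (r j ^ k * (\<integral>w. (norm (tconv k l g w))\<^sup>2 \<partial>lborel))) sums (of_real C * A j)" for j
  proof -
    have "(\<lambda>k. \<integral>p. of_real (r j) ^ k * (G p * (of_real (laguerre_fun k l (fst p - snd p)) * \<theta> p)) \<partial>lborel) sums A j"
      unfolding A_def
    proof (rule sums_lebesgue_dominated)
      show "integrable lborel (\<lambda>p. of_real (r j) ^ k * (G p * (of_real (laguerre_fun k l (fst p - snd p)) * \<theta> p)))" for k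
        by (intro integrable_mult_right cc_integrable cc_mult G continuous_intros \<theta>)
      show "(\<lambda>p. G p * (of_real (mehler \<bar>l\<bar> (r j) (fst p - snd p)) * \<theta> p)) \<in> borel_measurable lborel"
        using r[of j] by (simp, intro borel_measurable_continuous_onI continuous_intros \<theta> cc_continuous G)
      show "(\<lambda>k. of_real (r j) ^ k * (G p * (of_real (laguerre_fun k l (fst p - snd p)) * \<theta> p))) sums
          (G p * (of_real (mehler \<bar>l\<bar> (r j) (fst p - snd p)) * \<theta> p))" for p
      proof -
        have "(\<lambda>k. G p * (of_real (r j ^ k * laguerre_fun k l (fst p - snd p)) * \<theta> p)) sums (G p * (of_real (mehler \<bar>l\<bar> (r j) (fst p - snd p)) * \<theta> p))"
          using r[of j] by (intro sums_mult sums_mult2 sums_of_real laguerre_fun_sums) auto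
        then show ?thesis by (simp add: mult_ac)
      qed
      \<comment> \<open>The majorant uses the sharp bound by the value at 0; a bound growing like
        5^k would be summable against r^k only for r < 1/5.\<close>
      show "integrable lborel (\<lambda>p. norm (G p) * mehler \<bar>l\<bar> (r j) (0 :: complex ^ 'n))"
        by (intro integrable_mult_left integrable_norm cc_integrable G)
      show "(\<Sum>k<N. norm (of_real (r j) ^ k * (G p * (of_real (laguerre_fun k l (fst p - snd p)) * \<theta> p)))) \<le> norm (G p) * mehler \<bar>l\<bar> (r j) (0 :: complex ^ 'n)" for N p
      proof -
        have s: "(\<lambda>k. r j ^ k * laguerre_fun k l (0 :: complex ^ 'n)) sums mehler \<bar>l\<bar> (r j) (0 :: complex ^ 'n)"
          using r[of j] by (intro laguerre_fun_sums) auto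
        have nn: "laguerre_fun k l (0 :: complex ^ 'n) \<ge> 0" for k
          using fan_const_pos[of ?n k] by (simp add: laguerre_fun_0 less_imp_le)
        have "(\<Sum>k<N. norm (of_real (r j) ^ k * (G p * (of_real (laguerre_fun k l (fst p - snd p)) * \<theta> p)))) =
            norm (G p) * (\<Sum>k<N. r j ^ k * \<bar>laguerre_fun k l (fst p - snd p)\<bar>)"
          using r[of j] by (simp add: norm_mult norm_power \<theta>_def sum_distrib_left mult_ac)
        also have "\<dots> \<le> norm (G p) * (\<Sum>k<N. r j ^ k * laguerre_fun k l (0 :: complex ^ 'n))"
          using r[of j] abs_laguerre_fun_le[OF l, of _ "fst p - snd p"]
          by (intro mult_left_mono sum_mono) (auto simp: laguerre_fun_0)
        also have "\<dots> \<le> norm (G p) * mehler \<bar>l\<bar> (r j) (0 :: complex ^ 'n)"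
          unfolding sums_unique[OF s] using r[of j]
          by (intro mult_left_mono sum_le_suminf sums_summable[OF s]) (auto intro!: mult_nonneg_nonneg nn)
        finally show ?thesis .
      qed
    qed
    then have "(\<lambda>k. of_real C * (of_real (r j) ^ k * (\<integral>p. G p * (of_real (laguerre_fun k l (fst p - snd p)) * \<theta> p) \<partial>lborel))) sums (of_real C * A j)"
      unfolding integral_mult_right_zero by (rule sums_mult)
    moreover have "of_real C * (of_real (r j) ^ k * (\<integral>p. G p * (of_real (laguerre_fun k l (fst p - snd p)) * \<theta> p) \<partial>lborel)) =
        of_real (r j ^ k * (\<integral>w. (norm (tconv k l g w))\<^sup>2 \<partial>lborel))" for k
      unfolding of_real_mult tconv_norm_square(2)[OF l g] C_def G_def \<theta>_def by (simp add: mult_ac)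
    ultimately show ?thesis by simp
  qed
  have lim: "(\<lambda>j. of_real C * A j) \<longlonglongrightarrow> of_real C * (of_real (C * (\<integral>z. (norm (g z))\<^sup>2 \<partial>lborel)))"
  proof (intro tendsto_mult_left)
    have A: "A j = of_real ((4 / (\<bar>l\<bar> * (1 + r j))) ^ ?n) * (of_real (1 / \<delta> j ^ DIM(complex ^ 'n)) *
        (\<integral>p. g (fst p) * cnj (g (snd p)) * (\<theta> p * of_real (exp (- (norm (fst p - snd p))\<^sup>2 / (\<delta> j)\<^sup>2))) \<partial>lborel))" for j
    proof -
      have d2: "(\<delta> j)\<^sup>2 = 4 * (1 - r j) / (\<bar>l\<bar> * (1 + r j))"
        unfolding \<delta>_def using r[of j] by (simp add: divide_nonneg_nonneg)
      have d2': "(\<delta> j)\<^sup>2 = 4 / (\<bar>l\<bar> * (1 + r j)) * (1 - r j)" unfolding d2 by simp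
      have e: "1 / (\<delta> j)\<^sup>2 = \<bar>l\<bar> / 4 * ((1 + r j) / (1 - r j))" unfolding d2 by simp
      have c: "1 / (1 - r j) ^ ?n = (4 / (\<bar>l\<bar> * (1 + r j))) ^ ?n * (1 / \<delta> j ^ DIM(complex ^ 'n))"
      proof -
        have "\<delta> j ^ DIM(complex ^ 'n) = ((\<delta> j)\<^sup>2) ^ ?n" by (simp add: power_mult[symmetric] mult.commute)
        then show ?thesis unfolding d2' power_mult_distrib using l r[of j] by (simp add: power_divide power_mult_distrib)
      qed
      have m: "mehler \<bar>l\<bar> (r j) z = (4 / (\<bar>l\<bar> * (1 + r j))) ^ ?n * (1 / \<delta> j ^ DIM(complex ^ 'n)) * exp (- (norm z)\<^sup>2 / (\<delta> j)\<^sup>2)" for z :: "complex ^ 'n"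
      proof -
        have "- (norm z)\<^sup>2 / (\<delta> j)\<^sup>2 = - (1 / (\<delta> j)\<^sup>2) * (norm z)\<^sup>2" by simp
        then show ?thesis unfolding c[symmetric] e[symmetric] mehler_def by simp
      qed
      show ?thesis unfolding A_def m G_def integral_mult_right_zero[symmetric]
        by (intro Bochner_Integration.integral_cong) (simp_all add: mult_ac)
    qed
    have "A \<longlonglongrightarrow> of_real ((4 / (\<bar>l\<bar> * (1 + 1))) ^ ?n) * of_real (sqrt pi ^ DIM(complex ^ 'n) * (\<integral>z. (norm (g z))\<^sup>2 \<partial>lborel))"
      unfolding A
    proof (intro tendsto_mult tendsto_of_real)
      show "(\<lambda>j. (4 / (\<bar>l\<bar> * (1 + r j))) ^ ?n) \<longlonglongrightarrow> (4 / (\<bar>l\<bar> * (1 + 1))) ^ ?n"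
        using l by (intro tendsto_intros r1) auto
      show "(\<lambda>j. of_real (1 / \<delta> j ^ DIM(complex ^ 'n)) *
        (\<integral>p. g (fst p) * cnj (g (snd p)) * (\<theta> p * of_real (exp (- (norm (fst p - snd p))\<^sup>2 / (\<delta> j)\<^sup>2))) \<partial>lborel)) \<longlonglongrightarrow>
        of_real (sqrt pi ^ DIM(complex ^ 'n) * (\<integral>z. (norm (g z))\<^sup>2 \<partial>lborel))"
        by (rule gaussian_approximate_identity[OF g \<theta> _ _ \<delta> \<delta>0]) (simp_all add: \<theta>_def)
    qed
    moreover have "(4 / (\<bar>l\<bar> * (1 + 1))) ^ ?n * sqrt pi ^ DIM(complex ^ 'n) = C"
    proof -
      have "DIM(complex ^ 'n) = 2 * ?n" by simp
      then have "sqrt pi ^ DIM(complex ^ 'n) = pi ^ ?n" by (simp only: power_mult) simp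
      then show ?thesis unfolding C_def by (simp only: power_mult_distrib[symmetric]) simp
    qed
    ultimately show "A \<longlonglongrightarrow> of_real (C * (\<integral>z. (norm (g z))\<^sup>2 \<partial>lborel))"
      by (simp only: of_real_mult[symmetric] mult.assoc[symmetric])
  qed
  have "(\<lambda>k. \<integral>w. (norm (tconv k l g w))\<^sup>2 \<partial>lborel) sums (C * (C * (\<integral>z. (norm (g z))\<^sup>2 \<partial>lborel)))"
  proof (rule nonneg_abel_sums[OF _ r r1])
    show "(\<lambda>k. r j ^ k * (\<integral>w. (norm (tconv k l g w))\<^sup>2 \<partial>lborel)) sums Re (of_real C * A j)" for j
      using sums_Re[OF series[of j]] by (simp only: Re_complex_of_real)
    show "(\<lambda>j. Re (of_real C * A j)) \<longlonglongrightarrow> C * (C * (\<integral>z. (norm (g z))\<^sup>2 \<partial>lborel))"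
      using tendsto_Re[OF lim] by (simp only: of_real_mult[symmetric] Re_complex_of_real)
  qed simp
  moreover have "C * (C * X) = (2 * pi / \<bar>l\<bar>) ^ (?n + ?n) * X" for X
    unfolding C_def power_add by (rule mult.assoc[symmetric])
  ultimately show ?thesis by (simp only: mult_2)
qed

section \<open>The Strichartz transform of continuous functions\<close>

abbreviation fan_weight :: "nat \<Rightarrow> nat \<Rightarrow> real \<Rightarrow> real" where
  "fan_weight n k l \<equiv> 1 / (2 * pi) ^ (2 * n + 1) * (1 / (fan_const n k)\<^sup>2) * \<bar>l\<bar> ^ (2 * n)"

abbreviation fan_point :: "nat \<Rightarrow> nat \<Rightarrow> real \<Rightarrow> real \<times> real" where
  "fan_point n k l \<equiv> (l, (2 * real k + real n) * \<bar>l\<bar>)"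

section \<open>Rays of the fan and measurability of the transform\<close>

lemma fan_ray_unique:
  assumes "a \<in> fan_ray n k" "a \<in> fan_ray n j"
  shows "k = j"
  using assms by (auto simp: fan_ray_def)

lemma fan_index_eq: "a \<in> fan_ray n k \<Longrightarrow> fan_index n a = k"
  unfolding fan_index_def using fan_ray_unique by blast

lemma fan_ray_not_limit: "a \<in> fan_ray n k \<Longrightarrow> a \<notin> fan_limit_ray"
  by (auto simp: fan_ray_def fan_limit_ray_def)

lemma fan_point_in_ray: "l \<noteq> 0 \<Longrightarrow> (fan_point n k l) \<in> fan_ray n k"
  by (auto simp: fan_ray_def)

lemma fan_ray_alt: "fan_ray n k = {a. fst a \<noteq> 0 \<and> snd a = (2 * real k + real n) * \<bar>fst a\<bar>}"
  by (auto simp: fan_ray_def)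

lemma measurable_fan_ray [measurable]: "fan_ray n k \<in> sets borel"
proof -
  have "{a \<in> space borel. fst a \<noteq> 0 \<and> snd a = (2 * real k + real n) * \<bar>fst a\<bar>} \<in> sets borel"
    unfolding borel_prod[symmetric] by measurable
  then show ?thesis by (simp add: fan_ray_alt)
qed

lemma measurable_fan_limit_ray [measurable]: "fan_limit_ray \<in> sets borel"
proof -
  have "{a \<in> space borel. fst a = (0::real) \<and> snd a \<ge> (0::real)} \<in> sets borel"
    unfolding borel_prod[symmetric] by measurable
  moreover have "{a \<in> space borel. fst a = (0::real) \<and> snd a \<ge> (0::real)} = fan_limit_ray"
    by (auto simp: fan_limit_ray_def)
  ultimately show ?thesis by simp
qed

lemma measurable_heis_fan [measurable]: "heis_fan n \<in> sets borel"
  unfolding heis_fan_def by measurable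

lemma measurable_fan_index [measurable]: "fan_index n \<in> borel \<rightarrow>\<^sub>M count_space UNIV"
proof (rule measurableI)
  fix A :: "nat set"
  \<comment> \<open>Off the rays the defining predicate fails for every k, so
    \<open>fan_index\<close> takes one and the same unspecified value there.\<close>
  define k0 where "k0 = (THE k::nat. False)"
  have "fan_index n -` A \<inter> space borel = (\<Union>k\<in>A. fan_ray n k) \<union> (if k0 \<in> A then - (\<Union>k. fan_ray n k) else {})"
  proof (rule set_eqI)
    fix a
    show "a \<in> fan_index n -` A \<inter> space borel \<longleftrightarrow> a \<in> (\<Union>k\<in>A. fan_ray n k) \<union> (if k0 \<in> A then - (\<Union>k. fan_ray n k) else {})"
    proof (cases "\<exists>k. a \<in> fan_ray n k")
      case True
      then obtain k where k: "a \<in> fan_ray n k" ..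
      have "a \<in> (\<Union>k\<in>A. fan_ray n k) \<longleftrightarrow> k \<in> A" by (metis UN_iff fan_ray_unique k)
      then show ?thesis using fan_index_eq[OF k] k by auto
    next
      case False
      then have "fan_index n a = k0" by (simp add: fan_index_def k0_def)
      then show ?thesis using False by auto
    qed
  qed
  also have "\<dots> \<in> sets borel" by (auto intro!: sets.Un sets.countable_UN' simp: borel_comp)
  finally show "fan_index n -` A \<inter> space borel \<in> sets borel" .
qed simp

lemma measurable_laguerre_fun_compose [measurable (raw)]:
  assumes [measurable]: "k \<in> M \<rightarrow>\<^sub>M count_space UNIV" "l \<in> borel_measurable M" "z \<in> M \<rightarrow>\<^sub>M borel"
  shows "(\<lambda>x. laguerre_fun (k x) (l x) (z x)) \<in> borel_measurable M"
proof (rule measurable_compose_countable[where f = "\<lambda>k x. laguerre_fun k (l x) (z x)" and g = k])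
  show "(\<lambda>x. laguerre_fun i (l x) (z x)) \<in> borel_measurable M" for i
  proof -
    have "(\<lambda>t. poly (laguerre (CARD('b) - 1) i) t) \<in> borel_measurable borel"
      by (intro borel_measurable_continuous_onI continuous_intros)
    note [measurable] = measurable_compose[OF _ this]
    show ?thesis unfolding laguerre_fun_def by measurable
  qed
qed fact

lemma heis_mult_inv: "heis_mult (heis_inv p) (w, 0) = (w - fst p, - snd p - symp_form (fst p) w / 2)"
  by (simp add: heis_mult_def heis_inv_def symp_form_def sum_negf)

lemma borel_measurable_symp_form [measurable (raw)]:
  assumes [measurable]: "z \<in> M \<rightarrow>\<^sub>M borel" "w \<in> M \<rightarrow>\<^sub>M borel"
  shows "(\<lambda>x. symp_form (z x) (w x)) \<in> borel_measurable M"
  unfolding symp_form_eq_inner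
proof -
  have "(\<lambda>w. imult w) \<in> borel_measurable borel"
    unfolding imult_def by (intro borel_measurable_continuous_onI continuous_intros)
  note [measurable] = measurable_compose[OF _ this]
  show "(\<lambda>x. z x \<bullet> imult (w x)) \<in> borel_measurable M" by measurable
qed

text \<open>The kernel splits into a character in the central variable and the twisted kernel of
  \<open>tconv\<close>, so the transform is an ordinary Fourier transform followed by a twisted
  convolution.\<close>

lemma fan_char_heis_mult_inv:
  "fan_char a (heis_mult (heis_inv p) (w, 0)) = cis (- (fst a * snd p)) *
    (of_real (laguerre_fun (fan_index CARD('n) a) (fst a) (w - fst p)) * cis (- (fst a / 2) * symp_form (fst p) (w :: complex ^ 'n::finite)))"
  unfolding heis_mult_inv fan_char_def cis_conv_exp
  by (simp add: exp_add[symmetric] algebra_simps)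

lemma borel_measurable_cis_compose [measurable (raw)]:
  "f \<in> borel_measurable M \<Longrightarrow> (\<lambda>x. cis (f x)) \<in> borel_measurable M"
  unfolding cis_conv_exp by measurable

lemma borel_measurable_strichartz_borel:
  fixes f :: "'n::finite heis \<Rightarrow> complex"
  assumes [measurable]: "f \<in> borel_measurable borel"
  shows "(\<lambda>x. strichartz f (fst x) (snd x)) \<in> borel_measurable (borel \<Otimes>\<^sub>M lborel)"
proof -
  have [measurable]: "(\<lambda>x. fan_const CARD('n) (fan_index CARD('n) (fst x))) \<in> borel_measurable (borel \<Otimes>\<^sub>M (lborel :: (complex ^ 'n) measure))"
    by (rule measurable_compose[where N = "count_space UNIV"]) measurable
  have 1: "(\<lambda>a. fst a) \<in> (borel :: (real \<times> real) measure) \<rightarrow>\<^sub>M borel" "(\<lambda>p. fst p) \<in> (borel :: 'n heis measure) \<rightarrow>\<^sub>M borel" "(\<lambda>p. snd p) \<in> (borel :: 'n heis measure) \<rightarrow>\<^sub>M borel"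
    unfolding borel_prod[symmetric] by measurable
  note [measurable] = measurable_compose[OF _ 1(1)] measurable_compose[OF _ 1(2)] measurable_compose[OF _ 1(3)]
  have [measurable]: "(\<lambda>x. \<integral>p. f p * fan_char (fst x) (heis_mult (heis_inv p) (snd x, 0)) \<partial>lborel) \<in> borel_measurable (borel \<Otimes>\<^sub>M (lborel :: (complex ^ 'n) measure))"
    unfolding fan_char_heis_mult_inv
    by (rule lborel.borel_measurable_lebesgue_integral) measurable
  show ?thesis unfolding strichartz_def by measurable
qed

lemma sets_fan_nu2 [measurable_cong]: "sets (fan_nu2 n) = sets (restrict_space borel (heis_fan n))"
  by (simp add: fan_nu2_def)

lemma space_fan_nu2: "space (fan_nu2 n) = heis_fan n"
  using sets_eq_imp_space_eq[OF sets_fan_nu2, of n] by (simp add: space_restrict_space)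

lemma borel_measurable_strichartz:
  fixes f :: "'n::finite heis \<Rightarrow> complex"
  assumes "f \<in> borel_measurable lborel"
  shows "(\<lambda>x. strichartz f (fst x) (snd x)) \<in> borel_measurable (fan_nu2 n \<Otimes>\<^sub>M lborel)"
proof -
  have "(\<lambda>x. strichartz f (fst x) (snd x)) \<in> borel_measurable (borel \<Otimes>\<^sub>M lborel)"
    using assms by (intro borel_measurable_strichartz_borel) simp
  moreover have "(\<lambda>x. x) \<in> fan_nu2 n \<Otimes>\<^sub>M lborel \<rightarrow>\<^sub>M borel \<Otimes>\<^sub>M lborel"
  proof -
    have [measurable]: "(\<lambda>a. a) \<in> fan_nu2 n \<rightarrow>\<^sub>M borel"
      unfolding measurable_cong_sets[OF sets_fan_nu2 refl] by (rule measurable_restrict_space1) simp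
    have "(\<lambda>x. (fst x, snd x)) \<in> fan_nu2 n \<Otimes>\<^sub>M lborel \<rightarrow>\<^sub>M borel \<Otimes>\<^sub>M lborel"
      by (intro measurable_Pair measurable_compose[OF measurable_fst \<open>(\<lambda>a. a) \<in> fan_nu2 n \<rightarrow>\<^sub>M borel\<close>]) simp
    then show ?thesis by simp
  qed
  ultimately show ?thesis by (rule measurable_compose[rotated])
qed

abbreviation fan_kernel :: "nat \<Rightarrow> real \<times> real \<Rightarrow> complex ^ 'n::finite \<Rightarrow> 'n heis \<Rightarrow> complex" where
  "fan_kernel k a w p \<equiv> cis (- (fst a * snd p)) *
    (of_real (laguerre_fun k (fst a) (w - fst p)) * cis (- (fst a / 2) * symp_form (fst p) w))"

lemma strichartz_fan_ray:
  fixes f :: "'n::finite heis \<Rightarrow> complex"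
  assumes "a \<in> fan_ray CARD('n) k"
  shows "strichartz f a w = of_real (fan_const CARD('n) k) *
    (\<integral>p. f p * (fan_kernel k a w p) \<partial>lborel)"
  using assms unfolding strichartz_def fan_char_heis_mult_inv by (simp add: fan_index_eq fan_ray_not_limit)

section \<open>Plancherel for continuous functions of bounded support\<close>

lemma cc_partial_integral:
  fixes F :: "'a::euclidean_space \<times> 'b::euclidean_space \<Rightarrow> complex"
  assumes F: "cc F"
  shows "cc (\<lambda>x. \<integral>y. F (x, y) \<partial>lborel)"
proof -
  obtain R where R: "\<And>p. R < norm p \<Longrightarrow> F p = 0" using F by (auto simp: cc_def)
  obtain M where M: "M > 0" "\<And>p. norm (F p) \<le> M" using cc_bounded[OF F] by blast
  have zero: "F (x, y) = 0" if "R < norm x \<or> R < norm y" for x y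
    using that R[of "(x, y)"] norm_fst_le[of x y] norm_snd_le[of y x] by auto
  have "continuous_on UNIV (\<lambda>x. \<integral>y. F (x, y) \<partial>lborel)"
    unfolding continuous_on_sequentially o_def
  proof (intro ballI allI impI)
    fix u :: "nat \<Rightarrow> 'a" and x
    assume u: "(\<forall>j. u j \<in> UNIV) \<and> u \<longlonglongrightarrow> x"
    show "(\<lambda>j. \<integral>y. F (u j, y) \<partial>lborel) \<longlonglongrightarrow> (\<integral>y. F (x, y) \<partial>lborel)"
    proof (rule integral_dominated_convergence[where w = "\<lambda>y. M * indicator (cball 0 R) y"])
      show "(\<lambda>y. F (x, y)) \<in> borel_measurable lborel" "\<And>j. (\<lambda>y. F (u j, y)) \<in> borel_measurable lborel"
        by (simp_all, intro borel_measurable_continuous_onI cc_continuous_on[OF F] continuous_intros,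
            intro borel_measurable_continuous_onI cc_continuous_on[OF F] continuous_intros)
      show "integrable lborel (\<lambda>y :: 'b. M * indicator (cball 0 R) y)"
        using emeasure_lborel_cball_finite[of "0 :: 'b" R] by (simp add: integrable_indicator_iff)
      show "AE y in lborel. (\<lambda>j. F (u j, y)) \<longlonglongrightarrow> F (x, y)"
        using u by (intro AE_I2 continuous_on_tendsto_compose[OF cc_continuous[OF F]] tendsto_Pair) auto
      show "AE y in lborel. norm (F (u j, y)) \<le> M * indicator (cball 0 R) y" for j
        using M zero by (intro AE_I2) (auto simp: indicator_def not_le)
    qed
  qed
  moreover have "(\<integral>y. F (x, y) \<partial>lborel) = 0" if "R < norm x" for x
    using zero that by simp
  ultimately show ?thesis unfolding cc_def by blast
qed

lemma cc_slice: "cc F \<Longrightarrow> cc (\<lambda>y. F (x, y))"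
proof -
  assume F: "cc F"
  then obtain R where R: "\<And>p. R < norm p \<Longrightarrow> F p = 0" by (auto simp: cc_def)
  have "F (x, y) = 0" if "R < norm y" for y using that R[of "(x, y)"] norm_snd_le[of y x] by auto
  then show ?thesis unfolding cc_def
    by (intro conjI cc_continuous_on[OF F] continuous_intros exI[of _ R]) auto
qed

lemma ennreal_integral_norm_square:
  "integrable lborel (\<lambda>x. (norm (f x))\<^sup>2) \<Longrightarrow> ennreal (\<integral>x. (norm (f x))\<^sup>2 \<partial>lborel) = (\<integral>\<^sup>+x. ennreal ((norm (f x))\<^sup>2) \<partial>lborel)"
  by (rule nn_integral_eq_integral[symmetric]) auto

lemma strichartz_cc:
  fixes f :: "'n::finite heis \<Rightarrow> complex"
  assumes f: "cc f" and a: "a \<in> fan_ray CARD('n) k"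
  shows "strichartz f a w = of_real (fan_const CARD('n) k) * tconv k (fst a) (\<lambda>z. \<integral>t. f (z, t) * cis (- (fst a * t)) \<partial>lborel) w"
proof -
  have "integrable lborel (\<lambda>p. f p * (fan_kernel k a w p))"
    by (intro cc_integrable cc_mult f continuous_intros)
  from lborel_pair_integral(1)[OF this]
  show ?thesis unfolding strichartz_fan_ray[OF a] tconv_def
    by (simp add: integral_mult_left_zero[symmetric] mult.assoc del: integral_mult_left_zero integral_mult_left integral_mult_right_zero integral_mult_right)
qed

text \<open>The constants cancel on each ray: c_{n,k}^-2 in the measure against the square of the
  normalization, and (2 pi)^(-2n-1) |\<lambda>|^(2n) against (2 pi / |\<lambda>|)^(2n) from
  \<open>tconv_plancherel\<close>. The remaining 1 / (2 pi) is consumed by Plancherel in the central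
  variable.\<close>

lemma strichartz_plancherel_cc:
  fixes f :: "'n::finite heis \<Rightarrow> complex"
  assumes f: "cc f"
  shows "(\<integral>\<^sup>+x. ennreal ((norm (strichartz f (fst x) (snd x)))\<^sup>2) \<partial>(fan_nu2 CARD('n) \<Otimes>\<^sub>M lborel)) =
    (\<integral>\<^sup>+p. ennreal ((norm (f p))\<^sup>2) \<partial>lborel)"
proof -
  let ?n = "CARD('n)"
  note [measurable] = cc_measurable[OF f]
  have str [measurable]: "(\<lambda>x. strichartz f (fst x) (snd x)) \<in> borel_measurable (fan_nu2 ?n \<Otimes>\<^sub>M lborel)"
    by (rule borel_measurable_strichartz) simp
  define ft where "ft l z = (\<integral>t. f (z, t) * cis (- (l * t)) \<partial>lborel)" for l and z :: "complex ^ 'n"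
  have ft: "cc (ft l)" for l
  proof -
    have "cc (\<lambda>p. f p * cis (- (l * snd p)))" by (intro cc_mult f continuous_intros)
    from cc_partial_integral[OF this] show ?thesis by (simp add: ft_def[abs_def])
  qed
  have ftm [measurable]: "(\<lambda>(z, l). ft l z) \<in> borel_measurable (lborel \<Otimes>\<^sub>M lborel)"
    unfolding ft_def by measurable
  have "(\<integral>\<^sup>+x. ennreal ((norm (strichartz f (fst x) (snd x)))\<^sup>2) \<partial>(fan_nu2 ?n \<Otimes>\<^sub>M lborel)) =
      (\<integral>\<^sup>+a. \<integral>\<^sup>+w. ennreal ((norm (strichartz f a w))\<^sup>2) \<partial>lborel \<partial>fan_nu2 ?n)"
    by (subst lborel.nn_integral_fst[symmetric]) simp_all
  also have "\<dots> = (\<integral>\<^sup>+l. (\<Sum>k. ennreal (fan_weight ?n k l) *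
     (\<integral>\<^sup>+w. ennreal ((norm (strichartz f (fan_point ?n k l) w))\<^sup>2) \<partial>lborel)) \<partial>lborel)"
  proof (rule nn_integral_fan_nu2)
    have "(\<lambda>a. \<integral>\<^sup>+w. ennreal ((norm (strichartz f a w))\<^sup>2) \<partial>lborel) \<in> borel_measurable (fan_nu2 ?n)"
      using lborel.borel_measurable_nn_integral_fst[of "\<lambda>x. ennreal ((norm (strichartz f (fst x) (snd x)))\<^sup>2)" "fan_nu2 ?n"] by simp
    then show "(\<lambda>a. \<integral>\<^sup>+w. ennreal ((norm (strichartz f a w))\<^sup>2) \<partial>lborel) \<in> borel_measurable (restrict_space borel (heis_fan ?n))"
      unfolding measurable_cong_sets[OF sets_fan_nu2 refl] .
  qed
  also have "\<dots> = (\<integral>\<^sup>+l. ennreal (1 / (2 * pi)) * (\<integral>\<^sup>+z. ennreal ((norm (ft l z))\<^sup>2) \<partial>lborel) \<partial>lborel)"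
  proof (rule nn_integral_cong_AE)
    have "AE l in lborel. l \<noteq> (0::real)" by (rule AE_lborel_singleton)
    then show "AE l in lborel. (\<Sum>k. ennreal (fan_weight ?n k l) *
     (\<integral>\<^sup>+w. ennreal ((norm (strichartz f (fan_point ?n k l) w))\<^sup>2) \<partial>lborel)) =
      ennreal (1 / (2 * pi)) * (\<integral>\<^sup>+z. ennreal ((norm (ft l z))\<^sup>2) \<partial>lborel)"
    proof eventually_elim
      case (elim l)
      define D where "D = 1 / (2 * pi) ^ (2 * ?n + 1) * \<bar>l\<bar> ^ (2 * ?n)"
      have D: "D \<ge> 0" by (simp add: D_def)
      have "ennreal (fan_weight ?n k l) *
        (\<integral>\<^sup>+w. ennreal ((norm (strichartz f (fan_point ?n k l) w))\<^sup>2) \<partial>lborel) =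
        ennreal (D * (\<integral>w. (norm (tconv k l (ft l) w))\<^sup>2 \<partial>lborel))" for k
      proof -
        have "strichartz f (fan_point ?n k l) w = of_real (fan_const ?n k) * tconv k l (ft l) w" for w
          using strichartz_cc[OF f fan_point_in_ray[OF elim, of k ?n], of w] by (simp add: ft_def[abs_def])
        then have "(\<integral>\<^sup>+w. ennreal ((norm (strichartz f (fan_point ?n k l) w))\<^sup>2) \<partial>lborel) =
            (\<integral>\<^sup>+w. ennreal ((fan_const ?n k)\<^sup>2) * ennreal ((norm (tconv k l (ft l) w))\<^sup>2) \<partial>lborel)"
          by (simp add: norm_mult power_mult_distrib ennreal_mult)
        also have "\<dots> = ennreal ((fan_const ?n k)\<^sup>2) * (\<integral>\<^sup>+w. ennreal ((norm (tconv k l (ft l) w))\<^sup>2) \<partial>lborel)"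
          by (rule nn_integral_cmult) (use borel_measurable_integrable[OF tconv_norm_square(1)[OF elim ft]] in simp)
        also have "\<dots> = ennreal ((fan_const ?n k)\<^sup>2 * (\<integral>w. (norm (tconv k l (ft l) w))\<^sup>2 \<partial>lborel))"
          by (subst ennreal_integral_norm_square[symmetric, OF tconv_norm_square(1)[OF elim ft]]) (simp add: ennreal_mult)
        finally show ?thesis
          using fan_const_pos[of ?n k] by (simp add: D_def ennreal_mult[symmetric] field_simps)
      qed
      then have "(\<Sum>k. ennreal (fan_weight ?n k l) *
        (\<integral>\<^sup>+w. ennreal ((norm (strichartz f (fan_point ?n k l) w))\<^sup>2) \<partial>lborel)) =
        (\<Sum>k. ennreal (D * (\<integral>w. (norm (tconv k l (ft l) w))\<^sup>2 \<partial>lborel)))" by simp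
      also have "\<dots> = ennreal (D * ((2 * pi / \<bar>l\<bar>) ^ (2 * ?n) * (\<integral>z. (norm (ft l z))\<^sup>2 \<partial>lborel)))"
        by (rule suminf_ennreal_eq) (use D in \<open>auto intro!: sums_mult tconv_plancherel elim ft\<close>)
      also have "D * ((2 * pi / \<bar>l\<bar>) ^ (2 * ?n) * (\<integral>z. (norm (ft l z))\<^sup>2 \<partial>lborel)) = 1 / (2 * pi) * (\<integral>z. (norm (ft l z))\<^sup>2 \<partial>lborel)"
        using elim by (simp add: D_def power_divide)
      also have "ennreal \<dots> = ennreal (1 / (2 * pi)) * (\<integral>\<^sup>+z. ennreal ((norm (ft l z))\<^sup>2) \<partial>lborel)"
        by (subst ennreal_integral_norm_square[symmetric, OF cc_norm_square[OF ft]]) (rule ennreal_mult, simp_all)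
      finally show ?case .
    qed
  qed
  also have "\<dots> = ennreal (1 / (2 * pi)) * (\<integral>\<^sup>+l. \<integral>\<^sup>+z. ennreal ((norm (ft l z))\<^sup>2) \<partial>lborel \<partial>lborel)"
    by (rule nn_integral_cmult) (use ftm in measurable)
  also have "(\<integral>\<^sup>+l. \<integral>\<^sup>+z. ennreal ((norm (ft l z))\<^sup>2) \<partial>lborel \<partial>lborel) = (\<integral>\<^sup>+z. \<integral>\<^sup>+l. ennreal ((norm (ft l z))\<^sup>2) \<partial>lborel \<partial>lborel)"
    by (rule lborel_pair.Fubini') measurable
  also have "\<dots> = (\<integral>\<^sup>+z. ennreal (2 * pi) * (\<integral>\<^sup>+t. ennreal ((norm (f (z, t)))\<^sup>2) \<partial>lborel) \<partial>lborel)"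
    unfolding ft_def
    by (intro nn_integral_cong) (simp add: plancherel_real_cc[OF cc_slice[OF f]] ennreal_mult
        ennreal_integral_norm_square[OF cc_norm_square[OF cc_slice[OF f]]])
  also have "\<dots> = ennreal (2 * pi) * (\<integral>\<^sup>+z. \<integral>\<^sup>+t. ennreal ((norm (f (z, t)))\<^sup>2) \<partial>lborel \<partial>lborel)"
    by (rule nn_integral_cmult) measurable
  also have "(\<integral>\<^sup>+z. \<integral>\<^sup>+t. ennreal ((norm (f (z, t)))\<^sup>2) \<partial>lborel \<partial>lborel) = (\<integral>\<^sup>+p. ennreal ((norm (f p))\<^sup>2) \<partial>(lborel \<Otimes>\<^sub>M lborel))"
    by (rule lborel.nn_integral_fst) (simp add: lborel_prod)
  finally show ?thesis
    by (simp add: mult.assoc[symmetric] ennreal_mult[symmetric] lborel_prod)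
qed

section \<open>Square integrable functions and density\<close>

text \<open>The counterpart of \<open>L2_fun\<close> for an arbitrary measure, since the transforms
  live on the fan times C^n.\<close>

definition sq_integrable :: "'a measure \<Rightarrow> ('a \<Rightarrow> complex) \<Rightarrow> bool" where
  "sq_integrable M f \<longleftrightarrow> f \<in> borel_measurable M \<and> integrable M (\<lambda>x. (norm (f x))\<^sup>2)"

lemma sq_integrable_lborel: "sq_integrable lborel f \<longleftrightarrow> f \<in> L2_fun"
  by (simp add: sq_integrable_def L2_fun_def)

lemma sq_integrable_measurable [measurable_dest]: "sq_integrable M f \<Longrightarrow> f \<in> borel_measurable M"
  by (simp add: sq_integrable_def)

lemma norm_square_add_le: "(norm (a + b :: complex))\<^sup>2 \<le> 2 * (norm a)\<^sup>2 + 2 * (norm b)\<^sup>2"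
proof -
  have "(norm (a + b))\<^sup>2 \<le> (norm a + norm b)\<^sup>2" by (intro power_mono norm_triangle_ineq) auto
  also have "\<dots> \<le> 2 * (norm a)\<^sup>2 + 2 * (norm b)\<^sup>2"
    using sum_squares_bound[of "norm a" "norm b"] by (simp add: power2_sum)
  finally show ?thesis .
qed

lemma sq_integrable_add: "sq_integrable M f \<Longrightarrow> sq_integrable M g \<Longrightarrow> sq_integrable M (\<lambda>x. f x + g x)"
proof -
  assume f: "sq_integrable M f" and g: "sq_integrable M g"
  note [measurable] = sq_integrable_measurable[OF f] sq_integrable_measurable[OF g]
  have "integrable M (\<lambda>x. (norm (f x + g x))\<^sup>2)"
  proof (rule Bochner_Integration.integrable_bound)
    show "integrable M (\<lambda>x. 2 * (norm (f x))\<^sup>2 + 2 * (norm (g x))\<^sup>2)"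
      using f g by (auto simp: sq_integrable_def)
    show "AE x in M. norm ((norm (f x + g x))\<^sup>2) \<le> norm (2 * (norm (f x))\<^sup>2 + 2 * (norm (g x))\<^sup>2)"
      using norm_square_add_le by (intro AE_I2) auto
  qed measurable
  then show ?thesis by (simp add: sq_integrable_def)
qed

lemma sq_integrable_cmult: "sq_integrable M f \<Longrightarrow> sq_integrable M (\<lambda>x. c * f x)"
  by (auto simp: sq_integrable_def norm_mult power_mult_distrib)

lemma sq_integrable_diff: "sq_integrable M f \<Longrightarrow> sq_integrable M g \<Longrightarrow> sq_integrable M (\<lambda>x. f x - g x)"
  using sq_integrable_add[of M f "\<lambda>x. -1 * g x"] sq_integrable_cmult[of M g "-1"] by simp

lemma sq_integrable_nn:
  assumes "f \<in> borel_measurable M" "(\<integral>\<^sup>+x. ennreal ((norm (f x))\<^sup>2) \<partial>M) < \<infinity>"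
  shows "sq_integrable M f"
  using assms by (auto simp: sq_integrable_def integrable_iff_bounded)

lemma sq_integrable_nn_eq:
  "sq_integrable M f \<Longrightarrow> (\<integral>\<^sup>+x. ennreal ((norm (f x))\<^sup>2) \<partial>M) = ennreal (\<integral>x. (norm (f x))\<^sup>2 \<partial>M)"
  unfolding sq_integrable_def by (rule nn_integral_eq_integral) auto

text \<open>A weighted arithmetic-geometric mean inequality: the term in b gets an arbitrarily small
  factor at the price of a large one on a - b, which tends to 0 in the application.\<close>

lemma abs_norm_square_diff_le:
  fixes a b :: complex
  assumes "\<eta> > 0"
  shows "\<bar>(norm a)\<^sup>2 - (norm b)\<^sup>2\<bar> \<le> (1 + 1 / \<eta>) * (norm (a - b))\<^sup>2 + \<eta> * (norm b)\<^sup>2"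
proof -
  let ?d = "norm (a - b)"
  have "\<bar>norm a - norm b\<bar> \<le> ?d" by (rule norm_triangle_ineq3)
  moreover have "\<bar>(norm a)\<^sup>2 - (norm b)\<^sup>2\<bar> = \<bar>norm a - norm b\<bar> * (norm a + norm b)"
    by (simp add: power2_eq_square square_diff_square_factored abs_mult mult.commute)
  ultimately have "\<bar>(norm a)\<^sup>2 - (norm b)\<^sup>2\<bar> \<le> ?d * (norm a + norm b)"
    by (simp only: mult_right_mono add_nonneg_nonneg norm_ge_zero)
  also have "\<dots> \<le> ?d * (?d + 2 * norm b)"
    using norm_triangle_sub[of a b] by (intro mult_left_mono) auto
  finally have "\<bar>(norm a)\<^sup>2 - (norm b)\<^sup>2\<bar> \<le> ?d\<^sup>2 + 2 * ?d * norm b"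
    by (simp add: power2_eq_square algebra_simps)
  moreover have "2 * ?d * norm b \<le> (1 / \<eta>) * ?d\<^sup>2 + \<eta> * (norm b)\<^sup>2"
    using sum_squares_bound[of "?d / sqrt \<eta>" "sqrt \<eta> * norm b"] assms
    by (simp add: power_mult_distrib power_divide)
  ultimately show ?thesis by (simp add: distrib_right)
qed

text \<open>The previous estimate is integrated: first \<eta> makes the term in g small, then j the
  term in f j - g. This is continuity of the L^2 norm, for measures over which no normed space has
  been set up.\<close>

lemma sq_integrable_norm_tendsto:
  assumes f: "\<And>j. sq_integrable M (f j)" and g: "sq_integrable M g"
    and lim: "(\<lambda>j. \<integral>x. (norm (f j x - g x))\<^sup>2 \<partial>M) \<longlonglongrightarrow> 0"
  shows "(\<lambda>j. \<integral>x. (norm (f j x))\<^sup>2 \<partial>M) \<longlonglongrightarrow> (\<integral>x. (norm (g x))\<^sup>2 \<partial>M)"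
proof (rule LIMSEQ_I)
  fix e :: real assume e: "e > 0"
  define A where "A = (\<integral>x. (norm (g x))\<^sup>2 \<partial>M)"
  have A: "A \<ge> 0" by (simp add: A_def)
  define \<eta> where "\<eta> = e / (2 * (A + 1))"
  have \<eta>: "\<eta> > 0" "\<eta> * A < e / 2" using e A by (auto simp: \<eta>_def field_simps)
  define c where "c = 1 + 1 / \<eta>"
  have c: "c > 0" using \<eta> by (simp add: c_def add_pos_pos)
  obtain N where N: "\<And>j. j \<ge> N \<Longrightarrow> norm ((\<integral>x. (norm (f j x - g x))\<^sup>2 \<partial>M) - 0) < e / (2 * c)"
    using LIMSEQ_D[OF lim, of "e / (2 * c)"] e c by auto
  have "norm ((\<integral>x. (norm (f j x))\<^sup>2 \<partial>M) - A) < e" if "j \<ge> N" for j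
  proof -
    have i: "integrable M (\<lambda>x. (norm (f j x))\<^sup>2)" "integrable M (\<lambda>x. (norm (g x))\<^sup>2)" "integrable M (\<lambda>x. (norm (f j x - g x))\<^sup>2)"
      using f[of j] g sq_integrable_diff[OF f[of j] g] by (auto simp: sq_integrable_def)
    have "norm ((\<integral>x. (norm (f j x))\<^sup>2 \<partial>M) - A) = norm (\<integral>x. (norm (f j x))\<^sup>2 - (norm (g x))\<^sup>2 \<partial>M)"
      using i by (simp add: A_def)
    also have "\<dots> \<le> (\<integral>x. norm ((norm (f j x))\<^sup>2 - (norm (g x))\<^sup>2) \<partial>M)" by (rule integral_norm_bound)
    also have "\<dots> \<le> (\<integral>x. c * (norm (f j x - g x))\<^sup>2 + \<eta> * (norm (g x))\<^sup>2 \<partial>M)"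
      unfolding c_def real_norm_def
      by (intro integral_mono abs_norm_square_diff_le \<eta> Bochner_Integration.integrable_add integrable_mult_right i integrable_abs Bochner_Integration.integrable_diff)
    also have "\<dots> = c * (\<integral>x. (norm (f j x - g x))\<^sup>2 \<partial>M) + \<eta> * A"
      using i by (simp add: A_def)
    also have "c * (\<integral>x. (norm (f j x - g x))\<^sup>2 \<partial>M) < c * (e / (2 * c))"
      using N[OF that] c by (intro mult_strict_left_mono) auto
    finally show ?thesis using c \<eta> by simp
  qed
  then show "\<exists>N. \<forall>j\<ge>N. norm ((\<integral>x. (norm (f j x))\<^sup>2 \<partial>M) - (\<integral>x. (norm (g x))\<^sup>2 \<partial>M)) < e"
    unfolding A_def by blast
qed

text \<open>A Lebesgue measurable function is a limit almost everywhere of continuous ones.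
  Retracting their values to a disc and multiplying by a cutoff adds the uniform bound and the
  common support; the limit is unchanged because f already has both.\<close>

lemma cc_approximates_bounded:
  fixes f :: "'a::euclidean_space \<Rightarrow> complex"
  assumes [measurable]: "f \<in> borel_measurable borel" and M: "M > 0" "\<And>x. norm (f x) \<le> M"
    and R: "\<And>x. R < norm x \<Longrightarrow> f x = 0"
  obtains h where "\<And>n::nat. cc (h n)" "AE x in lborel. (\<lambda>n. h n x) \<longlonglongrightarrow> f x"
    "\<And>n x. norm (h n x) \<le> M * indicator (cball 0 (R + 1)) x"
proof -
  have "f \<in> borel_measurable lebesgue" by (rule measurable_completion) simp
  then have "f measurable_on UNIV" by (rule lebesgue_measurable_imp_measurable_on) simp
  then obtain N g where N: "negligible N" and g: "\<And>n. continuous_on UNIV (g n)"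
    and lim: "\<And>x. x \<notin> N \<Longrightarrow> (\<lambda>n::nat. g n x) \<longlonglongrightarrow> f x"
    unfolding measurable_on_def by auto
  \<comment> \<open>The radial retraction onto the disc of radius M; it is continuous and fixes the
    values of f.\<close>
  define clip where "clip v = (M / max M (norm v)) *\<^sub>R v" for v :: complex
  have clip_cont: "continuous_on UNIV clip" unfolding clip_def
    by (intro continuous_intros) (use M in \<open>auto simp: max_def\<close>)
  have clip_le: "norm (clip v) \<le> M" for v
    using M(1) by (auto simp: clip_def max_def field_simps)
  define cutoff where "cutoff x = complex_of_real (max 0 (min 1 (R + 1 - norm x)))" for x :: 'a
  have cutoff_cont: "continuous_on UNIV cutoff" unfolding cutoff_def by (intro continuous_intros)
  define h where "h n x = cutoff x * clip (g n x)" for n x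
  have "cc (h n)" for n
    unfolding cc_def
  proof
    show "continuous_on UNIV (h n)"
      unfolding h_def by (intro continuous_intros cutoff_cont continuous_on_compose2[OF clip_cont g]) auto
    show "\<exists>R. \<forall>x. R < norm x \<longrightarrow> h n x = 0"
      by (intro exI[of _ "R + 1"]) (auto simp: h_def cutoff_def)
  qed
  moreover have "AE x in lborel. (\<lambda>n. h n x) \<longlonglongrightarrow> f x"
  proof -
    from N obtain N' where N': "N' \<in> null_sets lborel" "N \<subseteq> N'"
      unfolding negligible_iff_null_sets null_sets_completion_iff2 by blast
    show ?thesis
    proof (rule AE_I'[OF N'(1)], rule subsetI)
      fix x assume "x \<in> {x \<in> space lborel. \<not> (\<lambda>n. h n x) \<longlonglongrightarrow> f x}"
      then have nl: "\<not> (\<lambda>n. h n x) \<longlonglongrightarrow> f x" by simp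
      show "x \<in> N'"
      proof (rule ccontr)
        assume "x \<notin> N'"
        then have l: "(\<lambda>n. g n x) \<longlonglongrightarrow> f x" using N'(2) lim by auto
        have "(\<lambda>n. h n x) \<longlonglongrightarrow> cutoff x * clip (f x)"
          unfolding h_def by (intro tendsto_intros continuous_on_tendsto_compose[OF clip_cont l]) auto
        moreover have "cutoff x * clip (f x) = f x"
        proof (cases "R < norm x")
          case True
          then show ?thesis using R by (simp add: clip_def)
        next
          case False
          then show ?thesis using M(1) M(2)[of x] by (simp add: clip_def cutoff_def max_def)
        qed
        ultimately show False using nl by simp
      qed
    qed
  qed
  moreover have "norm (h n x) \<le> M * indicator (cball 0 (R + 1)) x" for n x
  proof (cases "norm x \<le> R + 1")
    case True
    have "norm (h n x) = norm (cutoff x) * norm (clip (g n x))" by (simp add: h_def norm_mult)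
    also have "\<dots> \<le> 1 * M" by (intro mult_mono clip_le) (auto simp: cutoff_def)
    finally show ?thesis using True by simp
  next
    case False
    then show ?thesis by (simp add: h_def cutoff_def)
  qed
  ultimately show ?thesis using that by blast
qed

text \<open>One h serves for both distances, since the transform is controlled pointwise by the L^1
  norm and in square mean by the L^2 norm.\<close>

lemma cc_dense:
  fixes f :: "'a::euclidean_space \<Rightarrow> complex"
  assumes f: "f \<in> L2_fun" "integrable lborel f" and e: "e > 0"
  obtains h where "cc h" "(\<integral>x. norm (f x - h x) \<partial>lborel) < e" "(\<integral>x. (norm (f x - h x))\<^sup>2 \<partial>lborel) < e"
proof -
  have [measurable]: "f \<in> borel_measurable borel" using f by (auto simp: L2_fun_def)
  have f2: "integrable lborel (\<lambda>x. (norm (f x))\<^sup>2)" using f by (simp add: L2_fun_def)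
  define t where "t N x = (if norm x \<le> real N \<and> norm (f x) \<le> real N then f x else 0)" for N :: nat and x
  have tm [measurable]: "t N \<in> borel_measurable borel" for N unfolding t_def by measurable
  have t_le: "norm (f x - t N x) \<le> norm (f x)" for N x by (simp add: t_def)
  have t_lim: "(\<lambda>N. f x - t N x) \<longlonglongrightarrow> 0" for x
  proof (rule tendsto_eventually)
    obtain N0 where N0: "norm x + norm (f x) \<le> real N0" using real_arch_simple by blast
    have "f x - t N x = 0" if "N \<ge> N0" for N
    proof -
      have "norm x + norm (f x) \<le> real N" using N0 that by linarith
      then have "norm x \<le> real N" "norm (f x) \<le> real N" using norm_ge_zero[of x] norm_ge_zero[of "f x"] by linarith+
      then show ?thesis by (simp add: t_def)
    qed
    then show "\<forall>\<^sub>F N in sequentially. f x - t N x = 0" unfolding eventually_sequentially by blast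
  qed
  have "(\<lambda>N. \<integral>x. norm (f x - t N x) \<partial>lborel) \<longlonglongrightarrow> (\<integral>x. 0 \<partial>(lborel :: 'a measure))"
    by (rule integral_dominated_convergence[where w = "\<lambda>x. norm (f x)"])
      (use f t_le tendsto_norm[OF t_lim] in \<open>auto intro!: AE_I2\<close>)
  \<comment> \<open>A quarter of e for each error, because the squared estimate at the end doubles
    both terms.\<close>
  then have "\<forall>\<^sub>F N in sequentially. (\<integral>x. norm (f x - t N x) \<partial>lborel) < e / 4"
    using e by (intro order_tendstoD) auto
  moreover have "(\<lambda>N. \<integral>x. (norm (f x - t N x))\<^sup>2 \<partial>lborel) \<longlonglongrightarrow> (\<integral>x. 0 \<partial>(lborel :: 'a measure))"
    by (rule integral_dominated_convergence[where w = "\<lambda>x. (norm (f x))\<^sup>2"])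
      (use f2 t_le tendsto_power[OF tendsto_norm[OF t_lim], where n = 2] in \<open>auto intro!: AE_I2 power_mono\<close>)
  then have "\<forall>\<^sub>F N in sequentially. (\<integral>x. (norm (f x - t N x))\<^sup>2 \<partial>lborel) < e / 4"
    using e by (intro order_tendstoD) auto
  ultimately have "\<forall>\<^sub>F N in sequentially. (\<integral>x. norm (f x - t N x) \<partial>lborel) < e / 4 \<and> (\<integral>x. (norm (f x - t N x))\<^sup>2 \<partial>lborel) < e / 4"
    by (rule eventually_conj)
  then obtain N where N: "(\<integral>x. norm (f x - t N x) \<partial>lborel) < e / 4" "(\<integral>x. (norm (f x - t N x))\<^sup>2 \<partial>lborel) < e / 4"
    using eventually_happens[of _ sequentially] by auto
  define M where "M = real N + 1"
  have M: "M > 0" "\<And>x. norm (t N x) \<le> M" by (auto simp: M_def t_def)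
  obtain h where h: "\<And>n::nat. cc (h n)" "AE x in lborel. (\<lambda>n. h n x) \<longlonglongrightarrow> t N x"
    "\<And>n x. norm (h n x) \<le> M * indicator (cball 0 (real N + 1)) x"
    using cc_approximates_bounded[OF tm M, of "real N"] by (auto simp: t_def)
  define W where "W = (\<lambda>x::'a. 2 * M * indicator (cball 0 (real N + 1)) x)"
  have hW: "norm (t N x - h n x) \<le> W x" for n x
  proof (cases "norm x \<le> real N + 1")
    case True
    then show ?thesis using M(2)[of x] h(3)[of n x] norm_triangle_ineq4[of "t N x" "h n x"] by (simp add: W_def)
  next
    case False
    then show ?thesis using h(3)[of n x] by (simp add: W_def t_def)
  qed
  have hW2: "(norm (t N x - h n x))\<^sup>2 \<le> (W x)\<^sup>2" for n x
    by (rule power_mono[OF hW norm_ge_zero])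
  have ind: "integrable lborel (\<lambda>x::'a. indicator (cball 0 (real N + 1)) x :: real)"
    using emeasure_lborel_cball_finite[of "0 :: 'a" "real N + 1"] by (simp add: integrable_indicator_iff)
  have W1: "integrable lborel W" unfolding W_def by (intro integrable_mult_right ind)
  have "(\<lambda>x. (W x)\<^sup>2) = (\<lambda>x. (2 * M)\<^sup>2 * indicator (cball 0 (real N + 1)) x)"
    by (auto simp: W_def indicator_def fun_eq_iff)
  then have W2: "integrable lborel (\<lambda>x. (W x)\<^sup>2)" by (simp only: integrable_mult_right ind)
  have [measurable]: "h n \<in> borel_measurable borel" for n using cc_measurable[OF h(1)] .
  have hl: "AE x in lborel. (\<lambda>n. norm (t N x - h n x)) \<longlonglongrightarrow> 0"
    using h(2)
  proof eventually_elim
    case (elim x)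
    from tendsto_norm[OF tendsto_diff[OF tendsto_const elim], of "t N x"] show ?case by simp
  qed
  have "(\<lambda>n. \<integral>x. norm (t N x - h n x) \<partial>lborel) \<longlonglongrightarrow> (\<integral>x. 0 \<partial>(lborel :: 'a measure))"
    by (rule integral_dominated_convergence[where w = W]) (use W1 hW hl in auto)
  then have "\<forall>\<^sub>F n in sequentially. (\<integral>x. norm (t N x - h n x) \<partial>lborel) < e / 4"
    using e by (intro order_tendstoD) auto
  moreover have "(\<lambda>n. \<integral>x. (norm (t N x - h n x))\<^sup>2 \<partial>lborel) \<longlonglongrightarrow> (\<integral>x. 0 \<partial>(lborel :: 'a measure))"
  proof (rule integral_dominated_convergence[where w = "\<lambda>x. (W x)\<^sup>2"])
    show "AE x in lborel. (\<lambda>n. (norm (t N x - h n x))\<^sup>2) \<longlonglongrightarrow> 0"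
      using hl
    proof eventually_elim
      case (elim x)
      from tendsto_power[OF this, where n = 2] show ?case by simp
    qed
    show "AE x in lborel. norm ((norm (t N x - h n x))\<^sup>2) \<le> (W x)\<^sup>2" for n
      using hW2 by simp
  qed (use W2 in auto)
  then have "\<forall>\<^sub>F n in sequentially. (\<integral>x. (norm (t N x - h n x))\<^sup>2 \<partial>lborel) < e / 4"
    using e by (intro order_tendstoD) auto
  ultimately have "\<forall>\<^sub>F n in sequentially. (\<integral>x. norm (t N x - h n x) \<partial>lborel) < e / 4 \<and> (\<integral>x. (norm (t N x - h n x))\<^sup>2 \<partial>lborel) < e / 4"
    by (rule eventually_conj)
  then obtain n where n: "(\<integral>x. norm (t N x - h n x) \<partial>lborel) < e / 4" "(\<integral>x. (norm (t N x - h n x))\<^sup>2 \<partial>lborel) < e / 4"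
    using eventually_happens[of _ sequentially] by auto
  have i1: "integrable lborel (\<lambda>x. norm (f x - t N x))"
    by (rule Bochner_Integration.integrable_bound[OF integrable_norm[OF f(2)]]) (use t_le in auto)
  have i2: "integrable lborel (\<lambda>x. norm (t N x - h n x))"
    by (rule Bochner_Integration.integrable_bound[OF W1]) (use hW in \<open>auto intro!: AE_I2 order_trans[OF hW abs_ge_self]\<close>)
  have j1: "integrable lborel (\<lambda>x. (norm (f x - t N x))\<^sup>2)"
    by (rule Bochner_Integration.integrable_bound[OF f2]) (use t_le in \<open>auto intro!: AE_I2 power_mono\<close>)
  have j2: "integrable lborel (\<lambda>x. (norm (t N x - h n x))\<^sup>2)"
    by (rule Bochner_Integration.integrable_bound[OF W2]) (use hW2 in auto)
  have "(\<integral>x. norm (f x - h n x) \<partial>lborel) \<le> (\<integral>x. norm (f x - t N x) + norm (t N x - h n x) \<partial>lborel)"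
  proof (rule integral_mono')
    show "norm (f x - h n x) \<le> norm (f x - t N x) + norm (t N x - h n x)" for x
      using norm_triangle_ineq[of "f x - t N x" "t N x - h n x"] by simp
  qed (use i1 i2 in auto)
  also have "\<dots> < e" using i1 i2 N n e by simp
  finally have 1: "(\<integral>x. norm (f x - h n x) \<partial>lborel) < e" .
  have "(\<integral>x. (norm (f x - h n x))\<^sup>2 \<partial>lborel) \<le> (\<integral>x. 2 * (norm (f x - t N x))\<^sup>2 + 2 * (norm (t N x - h n x))\<^sup>2 \<partial>lborel)"
  proof (rule integral_mono')
    show "(norm (f x - h n x))\<^sup>2 \<le> 2 * (norm (f x - t N x))\<^sup>2 + 2 * (norm (t N x - h n x))\<^sup>2" for x
      using norm_square_add_le[of "f x - t N x" "t N x - h n x"] by simp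
  qed (use j1 j2 in auto)
  also have "\<dots> < e" using j1 j2 N n e by simp
  finally have 2: "(\<integral>x. (norm (f x - h n x))\<^sup>2 \<partial>lborel) < e" .
  show ?thesis by (rule that[OF h(1) 1 2])
qed

section \<open>The Plancherel theorem\<close>

lemma heis_fan_cases:
  assumes "a \<in> heis_fan n"
  obtains "a \<in> fan_limit_ray" | k where "a \<in> fan_ray n k"
  using assms by (auto simp: heis_fan_def)

lemma fan_ray_fst_nonzero: "a \<in> fan_ray n k \<Longrightarrow> fst a \<noteq> 0"
  by (auto simp: fan_ray_def)

lemma norm_fan_kernel_le:
  fixes w :: "complex ^ 'n::finite"
  assumes "a \<in> fan_ray CARD('n) k"
  shows "norm (fan_kernel k a w p)
    = \<bar>laguerre_fun k (fst a) (w - fst p)\<bar>"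
  by (simp add: norm_mult)

lemma integrable_strichartz:
  fixes f :: "'n::finite heis \<Rightarrow> complex"
  assumes a: "a \<in> fan_ray CARD('n) k" and f: "integrable lborel f"
  shows "integrable lborel (\<lambda>p. f p * (fan_kernel k a w p))"
proof (rule Bochner_Integration.integrable_bound)
  show "integrable lborel (\<lambda>p. norm (f p) * (1 / fan_const CARD('n) k))" using f by simp
  have [measurable]: "f \<in> borel_measurable borel" using f by auto
  have "(\<lambda>p :: 'n heis. fan_kernel k a w p) \<in> borel_measurable borel"
    by (intro borel_measurable_continuous_onI continuous_intros)
  then show "(\<lambda>p. f p * (fan_kernel k a w p)) \<in> borel_measurable lborel"
    by simp
  show "AE p in lborel. norm (f p * (fan_kernel k a w p))
      \<le> norm (norm (f p) * (1 / fan_const CARD('n) k))"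
    unfolding norm_mult[of "f _"] norm_fan_kernel_le[OF a]
    unfolding real_norm_def[of "_ * _"]
    by (intro AE_I2 order_trans[OF mult_left_mono abs_ge_self] abs_laguerre_fun_le fan_ray_fst_nonzero[OF a]) simp
qed

lemma strichartz_lincomb:
  fixes f g :: "'n::finite heis \<Rightarrow> complex"
  assumes a: "a \<in> heis_fan CARD('n)" and f: "integrable lborel f" and g: "integrable lborel g"
  shows "strichartz (\<lambda>p. f p + c * g p) a w = strichartz f a w + c * strichartz g a w"
  using a
proof (cases rule: heis_fan_cases)
  case 1
  then show ?thesis by (simp add: strichartz_def)
next
  case (2 k)
  have "(\<lambda>p. (f p + c * g p) * (fan_kernel k a w p)) =
      (\<lambda>p. f p * (fan_kernel k a w p) +
      c * (g p * (fan_kernel k a w p)))"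
    by (simp add: distrib_right mult.assoc)
  then show ?thesis
    unfolding strichartz_fan_ray[OF 2]
    using integrable_strichartz[OF 2 f, of w] integrable_strichartz[OF 2 g, of w]
    by (simp add: distrib_left)
qed

lemma strichartz_add:
  fixes f g :: "'n::finite heis \<Rightarrow> complex"
  assumes "a \<in> heis_fan CARD('n)" "integrable lborel f" "integrable lborel g"
  shows "strichartz (\<lambda>p. f p + g p) a w = strichartz f a w + strichartz g a w"
  using strichartz_lincomb[OF assms, of 1 w] by simp

lemma strichartz_diff:
  fixes f g :: "'n::finite heis \<Rightarrow> complex"
  assumes "a \<in> heis_fan CARD('n)" "integrable lborel f" "integrable lborel g"
  shows "strichartz (\<lambda>p. f p - g p) a w = strichartz f a w - strichartz g a w"
  using strichartz_lincomb[OF assms, of "-1" w] by simp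

text \<open>The sharp bound on the Laguerre functions cancels the normalization, so the normalized
  kernel has modulus at most 1 on every ray.\<close>

lemma norm_strichartz_le:
  fixes f :: "'n::finite heis \<Rightarrow> complex"
  assumes a: "a \<in> heis_fan CARD('n)" and f: "integrable lborel f"
  shows "norm (strichartz f a w) \<le> (\<integral>p. norm (f p) \<partial>lborel)"
  using a
proof (cases rule: heis_fan_cases)
  case 1
  then show ?thesis by (simp add: strichartz_def)
next
  case (2 k)
  let ?c = "fan_const CARD('n) k"
  note c = fan_const_pos[of "CARD('n)" k]
  have "norm (strichartz f a w) = ?c * norm (\<integral>p. f p * (fan_kernel k a w p) \<partial>lborel)"
    unfolding strichartz_fan_ray[OF 2] using c by (simp add: norm_mult)
  also have "\<dots> \<le> ?c * (\<integral>p. norm (f p) * (1 / ?c) \<partial>lborel)"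
  proof (intro mult_left_mono order_trans[OF integral_norm_bound] integral_mono')
    show "integrable lborel (\<lambda>p. norm (f p) * (1 / ?c))" using f by simp
    show "norm (f p * (fan_kernel k a w p)) \<le> norm (f p) * (1 / ?c)" for p
      unfolding norm_mult[of "f _"] norm_fan_kernel_le[OF 2]
      by (intro mult_left_mono abs_laguerre_fun_le fan_ray_fst_nonzero[OF 2]) simp
  qed (use c in auto)
  also have "\<dots> = (\<integral>p. norm (f p) \<partial>lborel)" using c by simp
  finally show ?thesis .
qed

text \<open>Cauchy-Schwarz with weight |f| bounds the squared integral by the L^1 norm of f times
  the integral of |f| |\<phi>_k|^2, and Fubini's theorem then reduces the integral over w to the
  squared L^2 norm of \<phi>_k. Normalization leaves the factor c_{n,k}^2 / c_{n,k}, at most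
  1.\<close>

lemma strichartz_slice_bound:
  fixes f :: "'n::finite heis \<Rightarrow> complex"
  assumes a: "a \<in> fan_ray CARD('n) k" and f: "integrable lborel f"
  shows "(\<integral>\<^sup>+w. ennreal ((norm (strichartz f a w))\<^sup>2) \<partial>lborel) \<le> ennreal ((2 * pi / \<bar>fst a\<bar>) ^ CARD('n) * (\<integral>p. norm (f p) \<partial>lborel)\<^sup>2)"
proof -
  let ?c = "fan_const CARD('n) k" and ?C = "(2 * pi / \<bar>fst a\<bar>) ^ CARD('n)"
  let ?\<phi> = "\<lambda>w p. laguerre_fun k (fst a) (w - fst p)"
  note c = fan_const_pos[of "CARD('n)" k]
  note a0 = fan_ray_fst_nonzero[OF a]
  define A where "A = (\<integral>p. norm (f p) \<partial>lborel)"
  have A: "A \<ge> 0" "(\<integral>\<^sup>+p. ennreal (norm (f p)) \<partial>lborel) = ennreal A"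
    unfolding A_def using f by (auto intro!: nn_integral_eq_integral)
  have [measurable]: "f \<in> borel_measurable borel" using f by auto
  have "(\<lambda>q :: (complex ^ 'n) \<times> 'n heis. ?\<phi> (fst q) (snd q)) \<in> borel_measurable borel"
    by (intro borel_measurable_continuous_onI continuous_intros)
  then have \<phi>m2: "(\<lambda>q :: (complex ^ 'n) \<times> 'n heis. ?\<phi> (fst q) (snd q)) \<in> borel_measurable (borel \<Otimes>\<^sub>M borel)"
    by (simp add: borel_prod)
  have \<phi>m [measurable]: "(\<lambda>p :: 'n heis. ?\<phi> w p) \<in> borel_measurable borel" for w
    by (intro borel_measurable_continuous_onI continuous_intros)
  have pt: "ennreal ((norm (strichartz f a w))\<^sup>2) \<le> ennreal (?c\<^sup>2 * A) * (\<integral>\<^sup>+p. ennreal (norm (f p)) * ennreal ((?\<phi> w p)\<^sup>2) \<partial>lborel)" for w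
  proof -
    let ?I = "\<integral>\<^sup>+p. ennreal (sqrt (norm (f p))) * ennreal (sqrt (norm (f p)) * \<bar>?\<phi> w p\<bar>) \<partial>lborel"
    have "ennreal (norm (\<integral>p. f p * (fan_kernel k a w p) \<partial>lborel))
        \<le> (\<integral>\<^sup>+p. ennreal (norm (f p * (fan_kernel k a w p))) \<partial>lborel)"
      by (rule integral_norm_bound_ennreal[OF integrable_strichartz[OF a f]])
    also have "\<dots> = ?I"
      unfolding norm_mult[of "f _"] norm_fan_kernel_le[OF a]
      by (intro nn_integral_cong) (simp add: ennreal_mult[symmetric] mult.assoc[symmetric])
    finally have "ennreal (norm (strichartz f a w)) \<le> ennreal ?c * ?I"
      unfolding strichartz_fan_ray[OF a] norm_mult norm_of_real using c
      by (simp add: ennreal_mult mult_left_mono)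
    then have "ennreal (norm (strichartz f a w)) ^ 2 \<le> (ennreal ?c * ?I) ^ 2" by (rule power_mono) simp
    also have "\<dots> = ennreal (?c\<^sup>2) * ?I ^ 2" using c by (simp add: power_mult_distrib ennreal_power)
    also have "?I ^ 2 \<le> (\<integral>\<^sup>+p. ennreal (sqrt (norm (f p))) ^ 2 \<partial>lborel) * (\<integral>\<^sup>+p. ennreal (sqrt (norm (f p)) * \<bar>?\<phi> w p\<bar>) ^ 2 \<partial>lborel)"
      by (rule Cauchy_Schwarz_nn_integral) simp_all
    also have "\<dots> = ennreal A * (\<integral>\<^sup>+p. ennreal (norm (f p)) * ennreal ((?\<phi> w p)\<^sup>2) \<partial>lborel)"
      by (simp add: ennreal_power power_mult_distrib ennreal_mult A(2))
    finally show ?thesis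
      using A c by (simp add: ennreal_power ennreal_mult mult.assoc mult_left_mono)
  qed
  have "(\<integral>\<^sup>+w. ennreal ((norm (strichartz f a w))\<^sup>2) \<partial>lborel) \<le> (\<integral>\<^sup>+w. ennreal (?c\<^sup>2 * A) * (\<integral>\<^sup>+p. ennreal (norm (f p)) * ennreal ((?\<phi> w p)\<^sup>2) \<partial>lborel) \<partial>lborel)"
    by (intro nn_integral_mono pt)
  also have "\<dots> = ennreal (?c\<^sup>2 * A) * (\<integral>\<^sup>+w. \<integral>\<^sup>+p. ennreal (norm (f p)) * ennreal ((?\<phi> w p)\<^sup>2) \<partial>lborel \<partial>lborel)"
    by (rule nn_integral_cmult) (use \<phi>m2 in measurable)
  also have "(\<integral>\<^sup>+w. \<integral>\<^sup>+p. ennreal (norm (f p)) * ennreal ((?\<phi> w p)\<^sup>2) \<partial>lborel \<partial>lborel) =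
      (\<integral>\<^sup>+p. \<integral>\<^sup>+w. ennreal (norm (f p)) * ennreal ((?\<phi> w p)\<^sup>2) \<partial>lborel \<partial>lborel)"
    by (rule lborel_pair.Fubini'[symmetric]) (use \<phi>m2 in \<open>simp add: case_prod_beta'\<close>)
  also have "\<dots> = (\<integral>\<^sup>+p. ennreal (norm (f p)) * ennreal (?C / ?c) \<partial>lborel)"
  proof (intro nn_integral_cong)
    fix p :: "'n heis"
    have i: "integrable lborel (\<lambda>w. (?\<phi> w p)\<^sup>2)"
      using lborel_integrable_affine[OF laguerre_fun_square_integral(1)[OF a0, where 'n = 'n, of k], of 1 "- fst p"] by simp
    have m: "(\<lambda>z :: complex ^ 'n. (laguerre_fun k (fst a) z)\<^sup>2) \<in> borel_measurable borel" by measurable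
    have "(\<integral>\<^sup>+w. ennreal ((?\<phi> w p)\<^sup>2) \<partial>lborel) = ennreal (\<integral>w. (?\<phi> w p)\<^sup>2 \<partial>lborel)"
      by (rule nn_integral_eq_integral[OF i]) simp
    also have "(\<integral>w. (?\<phi> w p)\<^sup>2 \<partial>lborel) = ?C / ?c"
      using lborel_integral_affine[OF m, of 1 "- fst p"] laguerre_fun_square_integral(2)[OF a0, where 'n = 'n, of k] by simp
    finally have "(\<integral>\<^sup>+w. ennreal ((?\<phi> w p)\<^sup>2) \<partial>lborel) = ennreal (?C / ?c)" .
    moreover have "(\<integral>\<^sup>+w. ennreal (norm (f p)) * ennreal ((?\<phi> w p)\<^sup>2) \<partial>lborel) = ennreal (norm (f p)) * (\<integral>\<^sup>+w. ennreal ((?\<phi> w p)\<^sup>2) \<partial>lborel)"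
      by (rule nn_integral_cmult) (use i in auto)
    ultimately show "(\<integral>\<^sup>+w. ennreal (norm (f p)) * ennreal ((?\<phi> w p)\<^sup>2) \<partial>lborel) = ennreal (norm (f p)) * ennreal (?C / ?c)" by simp
  qed
  also have "\<dots> = ennreal A * ennreal (?C / ?c)"
    unfolding A(2)[symmetric] by (rule nn_integral_multc) simp
  also have "ennreal (?c\<^sup>2 * A) * (ennreal A * ennreal (?C / ?c)) = ennreal (?c * (?C * A\<^sup>2))"
    using A c by (simp add: ennreal_mult[symmetric] power2_eq_square)
  also have "\<dots> \<le> ennreal (?C * A\<^sup>2)"
    using fan_const_le_1[of "CARD('n)" k] c by (intro ennreal_leI mult_left_le_one_le) auto
  finally show ?thesis unfolding A_def .
qed

text \<open>L^1 approximation makes the transforms converge at every point of the fan, L^2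
  approximation makes them Cauchy by the case of continuous functions; Fatou's lemma identifies the
  limit in square mean with the pointwise one.\<close>

theorem strichartz_plancherel:
  fixes f :: "'n::finite heis \<Rightarrow> complex"
  assumes f: "f \<in> L2_fun" "integrable lborel f"
  defines "M \<equiv> fan_nu2 CARD('n) \<Otimes>\<^sub>M lborel"
  shows "sq_integrable M (\<lambda>x. strichartz f (fst x) (snd x))"
    and "(\<integral>x. (norm (strichartz f (fst x) (snd x)))\<^sup>2 \<partial>M) = (\<integral>p. (norm (f p))\<^sup>2 \<partial>lborel)"
proof -
  define s where "s f x = strichartz f (fst x) (snd x)" for f :: "'n heis \<Rightarrow> complex" and x
  have sM: "s f \<in> borel_measurable M" if "f \<in> borel_measurable lborel" for f
    unfolding s_def[abs_def] M_def by (rule borel_measurable_strichartz[OF that])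
  have fanM: "fst x \<in> heis_fan CARD('n)" if "x \<in> space M" for x
    using that by (auto simp: M_def space_pair_measure space_fan_nu2)
  have "\<exists>g. cc g \<and> (\<integral>x. norm (f x - g x) \<partial>lborel) < 1 / real (Suc j) \<and> (\<integral>x. (norm (f x - g x))\<^sup>2 \<partial>lborel) < 1 / real (Suc j)" for j
    using cc_dense[OF f, of "1 / real (Suc j)"] by auto
  then have "\<exists>g. \<forall>j. cc (g j) \<and> (\<integral>x. norm (f x - g j x) \<partial>lborel) < 1 / real (Suc j) \<and> (\<integral>x. (norm (f x - g j x))\<^sup>2 \<partial>lborel) < 1 / real (Suc j)"
    by (intro choice allI)
  then obtain g where g: "\<And>j. cc (g j)" and g1: "\<And>j. (\<integral>x. norm (f x - g j x) \<partial>lborel) < 1 / real (Suc j)"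
    and g2: "\<And>j. (\<integral>x. (norm (f x - g j x))\<^sup>2 \<partial>lborel) < 1 / real (Suc j)"
    by blast
  have to0: "(\<lambda>j. 1 / real (Suc j)) \<longlonglongrightarrow> 0" by (rule LIMSEQ_Suc[OF lim_1_over_n])
  have sq_cc: "sq_integrable lborel h" if "cc h" for h :: "'n heis \<Rightarrow> complex"
    using that cc_measurable[OF that] cc_norm_square[OF that] by (simp add: sq_integrable_def)
  have sqf: "sq_integrable lborel f" using f by (simp add: sq_integrable_lborel)
  have [measurable]: "g j \<in> borel_measurable borel" "f \<in> borel_measurable borel" for j
    using cc_measurable[OF g] f(2) by auto
  have cc_diff: "cc (\<lambda>x. g i x - g j x)" for i j
  proof -
    obtain R R' where "\<And>x. R < norm x \<Longrightarrow> g i x = 0" "\<And>x. R' < norm x \<Longrightarrow> g j x = 0"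
      using g[of i] g[of j] by (auto simp: cc_def)
    then show ?thesis unfolding cc_def
      by (intro conjI continuous_intros cc_continuous g exI[of _ "max R R'"]) auto
  qed
  have ssq: "sq_integrable M (s h) \<and> (\<integral>x. (norm (s h x))\<^sup>2 \<partial>M) = (\<integral>x. (norm (h x))\<^sup>2 \<partial>lborel)" if h: "cc h" for h
  proof -
    have e: "(\<integral>\<^sup>+x. ennreal ((norm (s h x))\<^sup>2) \<partial>M) = ennreal (\<integral>x. (norm (h x))\<^sup>2 \<partial>lborel)"
      unfolding s_def M_def strichartz_plancherel_cc[OF h] by (rule sq_integrable_nn_eq[OF sq_cc[OF h]])
    then have "sq_integrable M (s h)"
      using sM[of h] cc_measurable[OF h] by (intro sq_integrable_nn) auto
    then show ?thesis using e sq_integrable_nn_eq[of M "s h"] by simp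
  qed
  have pt: "(\<lambda>j. s (g j) x) \<longlonglongrightarrow> s f x" if "x \<in> space M" for x
  proof -
    have "(\<lambda>j. s f x - s (g j) x) \<longlonglongrightarrow> 0"
    proof (rule Lim_null_comparison[OF _ to0], intro always_eventually allI)
      fix j
      have "norm (s f x - s (g j) x) = norm (strichartz (\<lambda>p. f p - g j p) (fst x) (snd x))"
        unfolding s_def strichartz_diff[OF fanM[OF that] f(2) cc_integrable[OF g]] ..
      also have "\<dots> \<le> (\<integral>p. norm (f p - g j p) \<partial>lborel)"
        by (rule norm_strichartz_le[OF fanM[OF that]]) (intro Bochner_Integration.integrable_diff f cc_integrable g)
      finally show "norm (s f x - s (g j) x) \<le> 1 / real (Suc j)" using g1[of j] by simp
    qed
    from tendsto_diff[OF tendsto_const this, of "s f x"] show ?thesis by simp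
  qed
  \<comment> \<open>The bound arises as 2 / (i + 1) + 2 / (j + 1) with j \<ge> i, before j tends to
    infinity.\<close>
  have close: "(\<integral>\<^sup>+x. ennreal ((norm (s (g i) x - s f x))\<^sup>2) \<partial>M) \<le> ennreal (4 / real (Suc i))" for i
  proof -
    have [measurable]: "s (g j) \<in> borel_measurable M" for j by (intro sM) simp
    have "(\<integral>\<^sup>+x. ennreal ((norm (s (g i) x - s f x))\<^sup>2) \<partial>M) = (\<integral>\<^sup>+x. liminf (\<lambda>j. ennreal ((norm (s (g i) x - s (g j) x))\<^sup>2)) \<partial>M)"
    proof (rule nn_integral_cong)
      fix x assume "x \<in> space M"
      from pt[OF this] have "(\<lambda>j. ennreal ((norm (s (g i) x - s (g j) x))\<^sup>2)) \<longlonglongrightarrow> ennreal ((norm (s (g i) x - s f x))\<^sup>2)"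
        by (intro tendsto_intros) auto
      from lim_imp_Liminf[OF trivial_limit_sequentially this]
      show "ennreal ((norm (s (g i) x - s f x))\<^sup>2) = liminf (\<lambda>j. ennreal ((norm (s (g i) x - s (g j) x))\<^sup>2))" ..
    qed
    also have "\<dots> \<le> liminf (\<lambda>j. \<integral>\<^sup>+x. ennreal ((norm (s (g i) x - s (g j) x))\<^sup>2) \<partial>M)"
      by (rule nn_integral_liminf) measurable
    also have "\<dots> \<le> ennreal (4 / real (Suc i))"
    proof (rule Liminf_le)
      show "\<forall>\<^sub>F j in sequentially. (\<integral>\<^sup>+x. ennreal ((norm (s (g i) x - s (g j) x))\<^sup>2) \<partial>M) \<le> ennreal (4 / real (Suc i))"
        using eventually_ge_at_top[of i]
      proof eventually_elim
        case (elim j)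
        have "(\<integral>\<^sup>+x. ennreal ((norm (s (g i) x - s (g j) x))\<^sup>2) \<partial>M) = (\<integral>\<^sup>+x. ennreal ((norm (s (\<lambda>p. g i p - g j p) x))\<^sup>2) \<partial>M)"
          by (intro nn_integral_cong) (simp add: s_def strichartz_diff fanM cc_integrable g)
        also have "\<dots> = ennreal (\<integral>p. (norm (g i p - g j p))\<^sup>2 \<partial>lborel)"
          unfolding sq_integrable_nn_eq[OF conjunct1[OF ssq[OF cc_diff]]] conjunct2[OF ssq[OF cc_diff]] ..
        also have "\<dots> \<le> ennreal (4 / real (Suc i))"
        proof (rule ennreal_leI)
          have i: "integrable lborel (\<lambda>x. (norm (f x - g j x))\<^sup>2)" for j
            using sq_integrable_diff[OF sqf sq_cc[OF g[of j]]] by (simp add: sq_integrable_def)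
          have "(\<integral>p. (norm (g i p - g j p))\<^sup>2 \<partial>lborel) \<le> (\<integral>p. 2 * (norm (f p - g i p))\<^sup>2 + 2 * (norm (f p - g j p))\<^sup>2 \<partial>lborel)"
          proof (rule integral_mono')
            show "(norm (g i p - g j p))\<^sup>2 \<le> 2 * (norm (f p - g i p))\<^sup>2 + 2 * (norm (f p - g j p))\<^sup>2" for p
              using norm_square_add_le[of "g i p - f p" "f p - g j p"] by (simp add: norm_minus_commute)
          qed (use i in auto)
          also have "\<dots> = 2 * (\<integral>p. (norm (f p - g i p))\<^sup>2 \<partial>lborel) + 2 * (\<integral>p. (norm (f p - g j p))\<^sup>2 \<partial>lborel)"
            using i by simp
          also have "\<dots> \<le> 2 * (1 / real (Suc i)) + 2 * (1 / real (Suc j))"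
            using g2[of i] g2[of j] by (intro add_mono mult_left_mono) auto
          also have "1 / real (Suc j) \<le> 1 / real (Suc i)" using elim by (simp add: frac_le)
          finally show "(\<integral>p. (norm (g i p - g j p))\<^sup>2 \<partial>lborel) \<le> 4 / real (Suc i)" by simp
        qed
        finally show ?case .
      qed
    qed simp
    finally show ?thesis .
  qed
  have sfm: "s f \<in> borel_measurable M" by (rule sM) simp
  have sqd: "sq_integrable M (\<lambda>x. s (g i) x - s f x)" for i
  proof (rule sq_integrable_nn)
    have "s (g i) \<in> borel_measurable M" by (intro sM) simp
    then show "(\<lambda>x. s (g i) x - s f x) \<in> borel_measurable M" using sfm by measurable
    show "(\<integral>\<^sup>+x. ennreal ((norm (s (g i) x - s f x))\<^sup>2) \<partial>M) < \<infinity>"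
      using close[of i] by (auto intro: le_less_trans)
  qed
  have sqs: "sq_integrable M (s f)"
    using sq_integrable_diff[OF conjunct1[OF ssq[OF g]] sqd, of 0 0] by simp
  then show "sq_integrable M (\<lambda>x. strichartz f (fst x) (snd x))" unfolding s_def .
  have "(\<lambda>j. \<integral>x. (norm (s (g j) x))\<^sup>2 \<partial>M) \<longlonglongrightarrow> (\<integral>x. (norm (s f x))\<^sup>2 \<partial>M)"
  proof (rule sq_integrable_norm_tendsto)
    show "(\<lambda>j. \<integral>x. (norm (s (g j) x - s f x))\<^sup>2 \<partial>M) \<longlonglongrightarrow> 0"
    proof (rule Lim_null_comparison[OF _ tendsto_mult_right_zero[OF to0, of 4]], intro always_eventually allI)
      fix j
      have "ennreal (\<integral>x. (norm (s (g j) x - s f x))\<^sup>2 \<partial>M) \<le> ennreal (4 / real (Suc j))"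
        using close[of j] unfolding sq_integrable_nn_eq[OF sqd] .
      then show "norm (\<integral>x. (norm (s (g j) x - s f x))\<^sup>2 \<partial>M) \<le> 4 * (1 / real (Suc j))" by simp
    qed
  qed (use ssq g sqs in auto)
  moreover have "(\<lambda>j. \<integral>x. (norm (g j x))\<^sup>2 \<partial>lborel) \<longlonglongrightarrow> (\<integral>x. (norm (f x))\<^sup>2 \<partial>lborel)"
  proof (rule sq_integrable_norm_tendsto)
    show "(\<lambda>j. \<integral>x. (norm (g j x - f x))\<^sup>2 \<partial>lborel) \<longlonglongrightarrow> 0"
      by (rule Lim_null_comparison[OF _ to0], intro always_eventually allI)
        (use g2 in \<open>simp add: norm_minus_commute less_imp_le\<close>)
  qed (use sq_cc g sqf in auto)
  ultimately show "(\<integral>x. (norm (strichartz f (fst x) (snd x)))\<^sup>2 \<partial>M) = (\<integral>p. (norm (f p))\<^sup>2 \<partial>lborel)"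
    using ssq[OF g] LIMSEQ_unique unfolding s_def by auto
qed

section \<open>The transform extended to all of L^2\<close>

lemma space_fan: "x \<in> space (fan_nu2 n \<Otimes>\<^sub>M N) \<Longrightarrow> fst x \<in> heis_fan n"
  by (auto simp: space_pair_measure space_fan_nu2)

lemma strichartz_L2_sq_integrable:
  fixes f :: "'n::finite heis L2"
  shows "strichartz_L2 f G \<Longrightarrow> sq_integrable (fan_nu2 CARD('n) \<Otimes>\<^sub>M lborel) G"
  unfolding strichartz_L2_def by (blast intro: sq_integrable_nn)

text \<open>Stated for a sum with an explicit g because polarization turns it into Parseval's
  formula; the limit that defines the transform of f is taken here, once.\<close>

lemma strichartz_L2_norm_add:
  fixes f :: "'n::finite heis L2"
  assumes f: "strichartz_L2 f G" and g: "g \<in> L2_fun" "integrable lborel g"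
  shows "(norm (f + L2_of g))\<^sup>2 = (\<integral>x. (norm (G x + strichartz g (fst x) (snd x)))\<^sup>2 \<partial>(fan_nu2 CARD('n) \<Otimes>\<^sub>M lborel))"
proof -
  let ?M = "fan_nu2 CARD('n) \<Otimes>\<^sub>M (lborel :: (complex ^ 'n) measure)"
  let ?s = "\<lambda>f (x :: (real \<times> real) \<times> (complex ^ 'n)). strichartz f (fst x) (snd x)"
  obtain \<phi> where \<phi>: "\<And>j. \<phi> j \<in> L2_fun" "\<And>j. integrable lborel (\<phi> j)"
    and lim: "(\<lambda>j. L2_of (\<phi> j)) \<longlonglongrightarrow> f"
    and Glim: "(\<lambda>j. \<integral>\<^sup>+x. ennreal ((norm (?s (\<phi> j) x - G x))\<^sup>2) \<partial>?M) \<longlonglongrightarrow> 0"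
    using f unfolding strichartz_L2_def by auto
  note G = strichartz_L2_sq_integrable[OF f]
  have s\<phi>: "sq_integrable ?M (?s (\<phi> j))" for j by (rule strichartz_plancherel(1)[OF \<phi>])
  have sg: "sq_integrable ?M (?s g)" by (rule strichartz_plancherel(1)[OF g])
  have sum: "(\<lambda>x. \<phi> j x + g x) \<in> L2_fun" "integrable lborel (\<lambda>x. \<phi> j x + g x)" for j
    using \<phi> g by (auto intro: L2_fun_add)
  have "(\<lambda>j. \<integral>x. (norm (?s (\<phi> j) x + ?s g x))\<^sup>2 \<partial>?M) \<longlonglongrightarrow> (\<integral>x. (norm (G x + ?s g x))\<^sup>2 \<partial>?M)"
  proof (rule sq_integrable_norm_tendsto)
    have "(\<lambda>j. ennreal (\<integral>x. (norm (?s (\<phi> j) x - G x))\<^sup>2 \<partial>?M)) \<longlonglongrightarrow> ennreal 0"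
      using Glim unfolding sq_integrable_nn_eq[OF sq_integrable_diff[OF s\<phi> G]] by simp
    then show "(\<lambda>j. \<integral>x. (norm ((?s (\<phi> j) x + ?s g x) - (G x + ?s g x)))\<^sup>2 \<partial>?M) \<longlonglongrightarrow> 0"
      by (subst (asm) tendsto_ennreal_iff) auto
  qed (intro sq_integrable_add s\<phi> sg G)+
  moreover have "(\<integral>x. (norm (?s (\<phi> j) x + ?s g x))\<^sup>2 \<partial>?M) = (norm (L2_of (\<phi> j) + L2_of g))\<^sup>2" for j
  proof -
    have "(\<integral>x. (norm (?s (\<phi> j) x + ?s g x))\<^sup>2 \<partial>?M) = (\<integral>x. (norm (?s (\<lambda>p. \<phi> j p + g p) x))\<^sup>2 \<partial>?M)"
      by (intro Bochner_Integration.integral_cong) (simp_all add: strichartz_add[OF space_fan \<phi>(2) g(2)])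
    also have "\<dots> = (norm (L2_of (\<lambda>p. \<phi> j p + g p)))\<^sup>2"
      unfolding strichartz_plancherel(2)[OF sum] norm_L2_of[OF sum(1)] ..
    finally show ?thesis by (simp add: L2_of_add \<phi> g)
  qed
  moreover have "(\<lambda>j. (norm (L2_of (\<phi> j) + L2_of g))\<^sup>2) \<longlonglongrightarrow> (norm (f + L2_of g))\<^sup>2"
    by (intro tendsto_intros lim)
  ultimately show ?thesis using LIMSEQ_unique by auto
qed

lemma strichartz_zero: "strichartz (\<lambda>p. 0) a w = 0"
  by (simp add: strichartz_def)

lemma strichartz_L2_norm:
  fixes f :: "'n::finite heis L2"
  assumes "strichartz_L2 f G"
  shows "(norm f)\<^sup>2 = (\<integral>x. (norm (G x))\<^sup>2 \<partial>(fan_nu2 CARD('n) \<Otimes>\<^sub>M lborel))"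
  using strichartz_L2_norm_add[OF assms, of "\<lambda>p. 0"] by (simp add: L2_fun_zero L2_of_zero strichartz_zero)

text \<open>Polarization with g and -g. Both inner products are the real ones, so no imaginary
  combinations enter.\<close>

lemma strichartz_parseval:
  fixes f :: "'n::finite heis L2"
  assumes f: "strichartz_L2 f G" and g: "g \<in> L2_fun" "integrable lborel g"
  shows "integrable (fan_nu2 CARD('n) \<Otimes>\<^sub>M lborel) (\<lambda>x. G x \<bullet> strichartz g (fst x) (snd x))"
    and "f \<bullet> L2_of g = (\<integral>x. G x \<bullet> strichartz g (fst x) (snd x) \<partial>(fan_nu2 CARD('n) \<Otimes>\<^sub>M lborel))"
proof -
  let ?M = "fan_nu2 CARD('n) \<Otimes>\<^sub>M (lborel :: (complex ^ 'n) measure)"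
  let ?s = "\<lambda>f (x :: (real \<times> real) \<times> (complex ^ 'n)). strichartz f (fst x) (snd x)"
  have g': "(\<lambda>x. - g x) \<in> L2_fun" "integrable lborel (\<lambda>x. - g x)"
    using g by (auto intro: L2_fun_uminus)
  note G = strichartz_L2_sq_integrable[OF f]
  have sg: "sq_integrable ?M (?s g)" by (rule strichartz_plancherel(1)[OF g])
  have sm: "?s (\<lambda>p. - g p) x = - ?s g x" if "x \<in> space ?M" for x
    using strichartz_lincomb[OF space_fan[OF that], of "\<lambda>p. 0" g "-1"] g by (simp add: strichartz_zero)
  have i: "integrable ?M (\<lambda>x. (norm (G x + ?s g x))\<^sup>2)" "integrable ?M (\<lambda>x. (norm (G x - ?s g x))\<^sup>2)"
    using sq_integrable_add[OF G sg] sq_integrable_diff[OF G sg] by (auto simp: sq_integrable_def)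
  have pol: "(a \<bullet> b) = ((norm (a + b))\<^sup>2 - (norm (a - b))\<^sup>2) / 4" for a b :: "'z::real_inner"
    by (simp add: power2_norm_eq_inner inner_add_left inner_add_right inner_diff_left inner_diff_right inner_commute)
  show "integrable ?M (\<lambda>x. G x \<bullet> ?s g x)"
    unfolding pol using i by simp
  have "L2_of (\<lambda>x. - g x) = - L2_of g"
    using L2_of_scaleR[OF g(1), of "-1"] by simp
  then have "(norm (f - L2_of g))\<^sup>2 = (norm (f + L2_of (\<lambda>x. - g x)))\<^sup>2" by simp
  also have "\<dots> = (\<integral>x. (norm (G x - ?s g x))\<^sup>2 \<partial>?M)"
    unfolding strichartz_L2_norm_add[OF f g']
    by (intro Bochner_Integration.integral_cong) (simp_all add: sm)
  finally have "f \<bullet> L2_of g = ((\<integral>x. (norm (G x + ?s g x))\<^sup>2 \<partial>?M) - (\<integral>x. (norm (G x - ?s g x))\<^sup>2 \<partial>?M)) / 4"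
    unfolding pol[of f] strichartz_L2_norm_add[OF f g] by simp
  then show "f \<bullet> L2_of g = (\<integral>x. G x \<bullet> ?s g x \<partial>?M)"
    unfolding pol[of "G _"] using i by simp
qed

text \<open>The operator T is described only through transforms; this additivity is what lets the
  estimate for T f be applied to T f - T g.\<close>

lemma strichartz_L2_diff:
  fixes f f' :: "'n::finite heis L2"
  assumes "strichartz_L2 f G" "strichartz_L2 f' G'"
  shows "strichartz_L2 (f - f') (\<lambda>x. G x - G' x)"
proof -
  let ?M = "fan_nu2 CARD('n) \<Otimes>\<^sub>M (lborel :: (complex ^ 'n) measure)"
  let ?s = "\<lambda>f (x :: (real \<times> real) \<times> (complex ^ 'n)). strichartz f (fst x) (snd x)"
  let ?d = "\<lambda>f G x. (norm (?s f x - G x))\<^sup>2"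
  obtain \<phi> where \<phi>: "\<And>j. \<phi> j \<in> L2_fun" "\<And>j. integrable lborel (\<phi> j)"
    and lim: "(\<lambda>j. L2_of (\<phi> j)) \<longlonglongrightarrow> f"
    and Glim: "(\<lambda>j. \<integral>\<^sup>+x. ennreal (?d (\<phi> j) G x) \<partial>?M) \<longlonglongrightarrow> 0"
    using assms(1) unfolding strichartz_L2_def by auto
  obtain \<psi> where \<psi>: "\<And>j. \<psi> j \<in> L2_fun" "\<And>j. integrable lborel (\<psi> j)"
    and lim': "(\<lambda>j. L2_of (\<psi> j)) \<longlonglongrightarrow> f'"
    and Glim': "(\<lambda>j. \<integral>\<^sup>+x. ennreal (?d (\<psi> j) G' x) \<partial>?M) \<longlonglongrightarrow> 0"
    using assms(2) unfolding strichartz_L2_def by auto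
  note G = strichartz_L2_sq_integrable[OF assms(1)] strichartz_L2_sq_integrable[OF assms(2)]
  note sq = sq_integrable_diff[OF G]
  have s\<phi>: "sq_integrable ?M (?s (\<phi> j))" "sq_integrable ?M (?s (\<psi> j))" for j
    using strichartz_plancherel(1) \<phi> \<psi> by blast+
  define \<xi> where "\<xi> j p = \<phi> j p - \<psi> j p" for j p
  have "\<xi> j \<in> L2_fun \<and> integrable lborel (\<xi> j)" for j
    unfolding \<xi>_def[abs_def] using \<phi> \<psi> by (auto intro: L2_fun_diff)
  moreover have "(\<lambda>j. L2_of (\<xi> j)) \<longlonglongrightarrow> f - f'"
    unfolding \<xi>_def[abs_def] L2_of_diff[OF \<phi>(1) \<psi>(1)] by (intro tendsto_diff lim lim')
  moreover have "(\<lambda>j. \<integral>\<^sup>+x. ennreal (?d (\<xi> j) (\<lambda>x. G x - G' x) x) \<partial>?M) \<longlonglongrightarrow> 0"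
  proof (rule tendsto_sandwich[OF _ _ tendsto_const])
    have le: "(\<integral>\<^sup>+x. ennreal (?d (\<xi> j) (\<lambda>x. G x - G' x) x) \<partial>?M) \<le>
        2 * (\<integral>\<^sup>+x. ennreal (?d (\<phi> j) G x) \<partial>?M) + 2 * (\<integral>\<^sup>+x. ennreal (?d (\<psi> j) G' x) \<partial>?M)" for j
    proof -
      note [measurable] = sq_integrable_measurable[OF s\<phi>(1)[of j]] sq_integrable_measurable[OF s\<phi>(2)[of j]]
        sq_integrable_measurable[OF G(1)] sq_integrable_measurable[OF G(2)]
      have "(\<integral>\<^sup>+x. ennreal (?d (\<xi> j) (\<lambda>x. G x - G' x) x) \<partial>?M) \<le>
        (\<integral>\<^sup>+x. 2 * ennreal (?d (\<phi> j) G x) + 2 * ennreal (?d (\<psi> j) G' x) \<partial>?M)"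
      proof (intro nn_integral_mono)
        fix x assume x: "x \<in> space ?M"
        have "?s (\<xi> j) x - (G x - G' x) = (?s (\<phi> j) x - G x) + - (?s (\<psi> j) x - G' x)"
          unfolding \<xi>_def[abs_def] strichartz_diff[OF space_fan[OF x] \<phi>(2) \<psi>(2)] by simp
        then have "?d (\<xi> j) (\<lambda>x. G x - G' x) x \<le> 2 * ?d (\<phi> j) G x + 2 * ?d (\<psi> j) G' x"
          using norm_square_add_le[of "?s (\<phi> j) x - G x" "- (?s (\<psi> j) x - G' x)"] by (simp only: norm_minus_cancel)
        then have "ennreal (?d (\<xi> j) (\<lambda>x. G x - G' x) x) \<le> ennreal (2 * ?d (\<phi> j) G x + 2 * ?d (\<psi> j) G' x)"
          by (rule ennreal_leI)
        then show "ennreal (?d (\<xi> j) (\<lambda>x. G x - G' x) x) \<le> 2 * ennreal (?d (\<phi> j) G x) + 2 * ennreal (?d (\<psi> j) G' x)"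
          by (simp add: ennreal_plus ennreal_mult)
      qed
      also have "\<dots> = 2 * (\<integral>\<^sup>+x. ennreal (?d (\<phi> j) G x) \<partial>?M) + 2 * (\<integral>\<^sup>+x. ennreal (?d (\<psi> j) G' x) \<partial>?M)"
        by (simp add: nn_integral_add nn_integral_cmult)
      finally show ?thesis .
    qed
    then show "\<forall>\<^sub>F j in sequentially. (\<integral>\<^sup>+x. ennreal (?d (\<xi> j) (\<lambda>x. G x - G' x) x) \<partial>?M) \<le>
        2 * (\<integral>\<^sup>+x. ennreal (?d (\<phi> j) G x) \<partial>?M) + 2 * (\<integral>\<^sup>+x. ennreal (?d (\<psi> j) G' x) \<partial>?M)"
      by simp
    have "(\<lambda>j. 2 * (\<integral>\<^sup>+x. ennreal (?d (\<phi> j) G x) \<partial>?M) + 2 * (\<integral>\<^sup>+x. ennreal (?d (\<psi> j) G' x) \<partial>?M)) \<longlonglongrightarrow> 2 * 0 + 2 * 0"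
      by (intro tendsto_add ennreal_tendsto_cmult Glim Glim') auto
    then show "(\<lambda>j. 2 * (\<integral>\<^sup>+x. ennreal (?d (\<phi> j) G x) \<partial>?M) + 2 * (\<integral>\<^sup>+x. ennreal (?d (\<psi> j) G' x) \<partial>?M)) \<longlonglongrightarrow> 0"
      by simp
  qed simp
  moreover have "(\<lambda>x. G x - G' x) \<in> borel_measurable ?M" "(\<integral>\<^sup>+x. ennreal ((norm (G x - G' x))\<^sup>2) \<partial>?M) < \<infinity>"
    using sq sq_integrable_nn_eq[OF sq] by (auto simp: sq_integrable_def)
  ultimately show ?thesis unfolding strichartz_L2_def by blast
qed

section \<open>Real interpolation\<close>

text \<open>Sigma-finiteness is what allows the level \<alpha> and the point of the fan to be
  integrated in either order.\<close>

lemma sigma_finite_fan_nu2: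
  assumes n: "n > 0"
  shows "sigma_finite_measure (fan_nu2 n)"
proof
  \<comment> \<open>\<open>A N\<close> consists of the points with |\<lambda>| \<le> N on the rays k
    \<le> N, together with the whole limit ray, where the density |l|^(2n) vanishes because n >
    0.\<close>
  define A where "A N = {a \<in> heis_fan n. \<bar>fst a\<bar> \<le> real N \<and> (fst a \<noteq> 0 \<longrightarrow> snd a \<le> (2 * real N + real n) * \<bar>fst a\<bar>)}" for N :: nat
  have Am [measurable]: "A N \<in> sets (restrict_space borel (heis_fan n))" for N
  proof -
    have "{a \<in> space borel. \<bar>fst a\<bar> \<le> real N \<and> (fst a \<noteq> 0 \<longrightarrow> snd a \<le> (2 * real N + real n) * \<bar>fst a\<bar>)} \<in> sets borel"
      unfolding borel_prod[symmetric] by measurable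
    moreover have "A N = heis_fan n \<inter> {a \<in> space borel. \<bar>fst a\<bar> \<le> real N \<and> (fst a \<noteq> 0 \<longrightarrow> snd a \<le> (2 * real N + real n) * \<bar>fst a\<bar>)}"
      by (auto simp: A_def)
    ultimately show ?thesis by (auto simp: sets_restrict_space)
  qed
  have fin: "emeasure (fan_nu2 n) (A N) \<noteq> \<infinity>" for N
  proof -
    define c where "c k = 1 / (2 * pi) ^ (2 * n + 1) * (1 / (fan_const n k)\<^sup>2) * real N ^ (2 * n)" for k
    have "emeasure (fan_nu2 n) (A N) = (\<integral>\<^sup>+a. indicator (A N) a \<partial>fan_nu2 n)"
      using Am by (simp add: sets_fan_nu2)
    also have "\<dots> = (\<integral>\<^sup>+l. (\<Sum>k. ennreal (fan_weight n k l) *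
        indicator (A N) (fan_point n k l)) \<partial>lborel)"
      by (rule nn_integral_fan_nu2) simp
    also have "\<dots> \<le> (\<integral>\<^sup>+l. (\<Sum>k\<le>N. ennreal (c k)) * indicator {- real N..real N} l \<partial>lborel)"
    proof (rule nn_integral_mono)
      fix l :: real
      have "(\<Sum>k. ennreal (fan_weight n k l) * indicator (A N) (fan_point n k l))
          = (\<Sum>k\<le>N. ennreal (fan_weight n k l) * indicator (A N) (fan_point n k l))"
      proof (rule suminf_finite)
        fix k assume "k \<notin> {..N}"
        then have "l = 0 \<or> (fan_point n k l) \<notin> A N"
          by (auto simp: A_def)
        then show "ennreal (fan_weight n k l) * indicator (A N) (fan_point n k l) = 0"
          using n by auto
      qed simp
      also have "\<dots> \<le> (\<Sum>k\<le>N. ennreal (c k) * indicator {- real N..real N} l)"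
      proof (rule sum_mono)
        fix k
        show "ennreal (fan_weight n k l) * indicator (A N) (fan_point n k l)
          \<le> ennreal (c k) * indicator {- real N..real N} l"
        proof (cases "\<bar>l\<bar> \<le> real N")
          case True
          have "\<bar>l\<bar> ^ (2 * n) \<le> real N ^ (2 * n)" using True by (intro power_mono) auto
          then have "ennreal (fan_weight n k l) \<le> ennreal (c k)"
            unfolding c_def by (intro ennreal_leI mult_left_mono) auto
          then show ?thesis using True by (auto simp: indicator_def)
        next
          case False
          then show ?thesis by (auto simp: A_def)
        qed
      qed
      finally show "(\<Sum>k. ennreal (fan_weight n k l) * indicator (A N) (fan_point n k l))
          \<le> (\<Sum>k\<le>N. ennreal (c k)) * indicator {- real N..real N} l"
        by (simp add: sum_distrib_right)
    qed
    also have "\<dots> = (\<Sum>k\<le>N. ennreal (c k)) * ennreal (2 * real N)"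
      by (subst nn_integral_cmult_indicator) auto
    also have "(\<Sum>k\<le>N. ennreal (c k)) = ennreal (\<Sum>k\<le>N. c k)"
      by (rule sum_ennreal) (simp add: c_def)
    also have "\<dots> * ennreal (2 * real N) < \<infinity>" by (simp add: ennreal_mult_less_top)
    finally show ?thesis by simp
  qed
  have "(\<Union>N. A N) = heis_fan n"
  proof
    show "heis_fan n \<subseteq> (\<Union>N. A N)"
    proof
      fix a assume a: "a \<in> heis_fan n"
      obtain N1 where N1: "\<bar>fst a\<bar> \<le> real N1" using real_arch_simple by blast
      from a show "a \<in> (\<Union>N. A N)"
      proof (cases rule: heis_fan_cases)
        case 1
        then show ?thesis using N1 a by (auto simp: A_def fan_limit_ray_def intro!: exI[of _ N1])
      next
        case (2 k)
        have "(2 * real k + real n) * \<bar>fst a\<bar> \<le> (2 * real (max N1 k) + real n) * \<bar>fst a\<bar>"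
          by (intro mult_right_mono) auto
        then have "a \<in> A (max N1 k)" using 2 N1 a by (auto simp: A_def fan_ray_def)
        then show ?thesis by blast
      qed
    qed
  qed (auto simp: A_def)
  then show "\<exists>A. countable A \<and> A \<subseteq> sets (fan_nu2 n) \<and> \<Union>A = space (fan_nu2 n) \<and> (\<forall>a\<in>A. emeasure (fan_nu2 n) a \<noteq> \<infinity>)"
    using Am fin by (intro exI[of _ "range A"]) (auto simp: sets_fan_nu2 space_fan_nu2)
qed

section \<open>Elementary integrals over the level\<close>

lemma nn_integral_linear_Icc:
  assumes "X \<ge> 0"
  shows "(\<integral>\<^sup>+\<alpha>. ennreal (4 * \<alpha>) * indicator {0..X} \<alpha> \<partial>lborel) = ennreal (2 * X\<^sup>2)"
proof -
  have "(\<integral>\<^sup>+\<alpha>. ennreal (4 * \<alpha>) * indicator {0..X} \<alpha> \<partial>lborel) = ennreal (2 * X\<^sup>2 - 2 * 0\<^sup>2)"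
    by (rule nn_integral_FTC_Icc) (use assms in \<open>auto intro!: derivative_eq_intros\<close>)
  then show ?thesis by simp
qed

lemma nn_integral_powr_atLeast:
  assumes X: "X > 0" and e: "e < 0"
  shows "(\<integral>\<^sup>+\<alpha>. ennreal (\<alpha> powr (e - 1)) * indicator {X..} \<alpha> \<partial>lborel) = ennreal (X powr e / (- e))"
proof -
  have "(\<integral>\<^sup>+\<alpha>. ennreal (\<alpha> powr (e - 1)) * indicator {X..} \<alpha> \<partial>lborel) = ennreal (0 - X powr e / e)"
  proof (rule nn_integral_FTC_atLeast)
    show "((\<lambda>\<alpha>. \<alpha> powr e / e) has_real_derivative \<alpha> powr (e - 1)) (at \<alpha>)" if "X \<le> \<alpha>" for \<alpha>
      using that X e by (auto intro!: derivative_eq_intros)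
    have "((\<lambda>\<alpha>. \<alpha> powr e) \<longlongrightarrow> 0) at_top"
      using e by (rule tendsto_neg_powr) (rule filterlim_ident)
    from tendsto_divide[OF this tendsto_const[of e]] e show "((\<lambda>\<alpha>. \<alpha> powr e / e) \<longlongrightarrow> 0) at_top" by simp
  qed auto
  then show ?thesis by simp
qed

text \<open>The open right endpoint matches the strict inequality in the superlevel sets {|m| >
  \<alpha>}.\<close>

lemma nn_integral_layer:
  assumes "x \<ge> 0"
  shows "(\<integral>\<^sup>+\<alpha>. ennreal (2 * \<alpha>) * indicator {0<..<x} \<alpha> \<partial>lborel) = ennreal (x\<^sup>2)"
proof -
  have "(\<integral>\<^sup>+\<alpha>. ennreal (2 * \<alpha>) * indicator {0<..<x} \<alpha> \<partial>lborel) = (\<integral>\<^sup>+\<alpha>. ennreal (2 * \<alpha>) * indicator {0..x} \<alpha> \<partial>lborel)"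
  proof (rule nn_integral_cong_AE)
    show "AE \<alpha> in lborel. ennreal (2 * \<alpha>) * indicator {0<..<x} \<alpha> = ennreal (2 * \<alpha>) * indicator {0..x} \<alpha>"
      using AE_lborel_singleton[of 0] AE_lborel_singleton[of x] by eventually_elim (auto simp: indicator_def)
  qed
  also have "\<dots> = ennreal (x\<^sup>2 - 0\<^sup>2)"
    by (rule nn_integral_FTC_Icc) (use assms in \<open>auto intro!: derivative_eq_intros\<close>)
  finally show ?thesis by simp
qed

text \<open>One level of the real interpolation between Plancherel and the \<open>L\<^sup>1\<close> bound on the slices. It is
  applied with \<open>E = {\<bar>m\<bar> > \<alpha>}\<close> and \<open>s = \<alpha> powr - \<gamma>\<close>, where \<open>\<gamma> = (2 p - 1) / (p - 1)\<close> makes both parts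
  integrate over \<open>\<alpha>\<close> to the same power of \<open>\<bar>g\<bar>\<close>.\<close>

lemma strichartz_level_bound:
  fixes g :: "'n::finite heis \<Rightarrow> complex"
  assumes g: "g \<in> L2_fun" "integrable lborel g"
    and \<sigma>: "\<sigma> > 1" and g\<sigma>: "integrable lborel (\<lambda>x. norm (g x) powr \<sigma>)" "(\<integral>x. norm (g x) powr \<sigma> \<partial>lborel) \<le> 1"
    and E: "E \<in> sets (fan_nu2 CARD('n))" and s: "s > 0"
    and B: "emeasure (fan_mu CARD('n)) E \<le> ennreal B" "B \<ge> 0"
  shows "(\<integral>\<^sup>+x. ennreal ((norm (strichartz g (fst x) (snd x)))\<^sup>2) * indicator E (fst x) \<partial>(fan_nu2 CARD('n) \<Otimes>\<^sub>M lborel)) \<le>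
    (\<integral>\<^sup>+x. ennreal (2 * (norm (g x))\<^sup>2 * indicator {x. norm (g x) \<le> s} x +
      2 * (2 * pi) ^ CARD('n) * B * s powr (1 - \<sigma>) * (norm (g x) * indicator {x. norm (g x) > s} x)) \<partial>lborel)"
proof -
  let ?M = "fan_nu2 CARD('n) \<Otimes>\<^sub>M (lborel :: (complex ^ 'n) measure)"
  define S where "S f x = strichartz f (fst x) (snd x)" for f :: "'n heis \<Rightarrow> complex" and x
  note [measurable] = E
  have [measurable]: "g \<in> borel_measurable borel" using g by auto
  \<comment> \<open>The part of g below height s is estimated by Plancherel over the whole fan, the
    part above it by the L^1 slice bound over E, whose \<mu>-measure is at most B.\<close>
  define g1 where "g1 x = (if norm (g x) \<le> s then g x else 0)" for x
  define g2 where "g2 x = (if norm (g x) \<le> s then 0 else g x)" for x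
  have [measurable]: "g1 \<in> borel_measurable borel" "g2 \<in> borel_measurable borel"
    unfolding g1_def g2_def by measurable
  have g1: "g1 \<in> L2_fun" "integrable lborel g1"
  proof -
    have "integrable lborel (\<lambda>x. (norm (g1 x))\<^sup>2)"
      by (rule Bochner_Integration.integrable_bound[of _ "\<lambda>x. (norm (g x))\<^sup>2"]) (use g in \<open>auto simp: g1_def L2_fun_def\<close>)
    then show "g1 \<in> L2_fun" by (simp add: L2_fun_def)
    show "integrable lborel g1"
      by (rule Bochner_Integration.integrable_bound[OF g(2)]) (auto simp: g1_def)
  qed
  have g2: "integrable lborel g2"
    by (rule Bochner_Integration.integrable_bound[OF g(2)]) (auto simp: g2_def)
  have gsum: "g = (\<lambda>x. g1 x + g2 x)" by (auto simp: g1_def g2_def)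
  have Sm [measurable]: "S g1 \<in> borel_measurable ?M" "S g2 \<in> borel_measurable ?M"
    unfolding S_def[abs_def] by (rule borel_measurable_strichartz, simp)+
  have fanM: "fst x \<in> heis_fan CARD('n)" if "x \<in> space ?M" for x
    using that by (auto simp: space_pair_measure space_fan_nu2)
  have "(\<integral>\<^sup>+x. ennreal ((norm (S g x))\<^sup>2) * indicator E (fst x) \<partial>?M) \<le>
      (\<integral>\<^sup>+x. 2 * ennreal ((norm (S g1 x))\<^sup>2) + 2 * (ennreal ((norm (S g2 x))\<^sup>2) * indicator E (fst x)) \<partial>?M)"
  proof (rule nn_integral_mono)
    fix x assume x: "x \<in> space ?M"
    have "S g x = S g1 x + S g2 x"
      unfolding S_def by (subst gsum) (rule strichartz_add[OF fanM[OF x] g1(2) g2])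
    then have "ennreal ((norm (S g x))\<^sup>2) \<le> ennreal (2 * (norm (S g1 x))\<^sup>2 + 2 * (norm (S g2 x))\<^sup>2)"
      using norm_square_add_le[of "S g1 x" "S g2 x"] by (intro ennreal_leI) simp
    also have "\<dots> = 2 * ennreal ((norm (S g1 x))\<^sup>2) + 2 * ennreal ((norm (S g2 x))\<^sup>2)"
      by (simp add: ennreal_plus ennreal_mult)
    finally show "ennreal ((norm (S g x))\<^sup>2) * indicator E (fst x) \<le> 2 * ennreal ((norm (S g1 x))\<^sup>2) + 2 * (ennreal ((norm (S g2 x))\<^sup>2) * indicator E (fst x))"
      by (auto simp: indicator_def)
  qed
  also have "\<dots> = 2 * (\<integral>\<^sup>+x. ennreal ((norm (S g1 x))\<^sup>2) \<partial>?M) + 2 * (\<integral>\<^sup>+x. ennreal ((norm (S g2 x))\<^sup>2) * indicator E (fst x) \<partial>?M)"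
    by (simp add: nn_integral_add nn_integral_cmult)
  also have "(\<integral>\<^sup>+x. ennreal ((norm (S g1 x))\<^sup>2) \<partial>?M) = ennreal (\<integral>x. (norm (g1 x))\<^sup>2 \<partial>lborel)"
    using strichartz_plancherel[OF g1] sq_integrable_nn_eq[of ?M "S g1"] by (simp add: S_def[abs_def])
  also have "\<dots> = (\<integral>\<^sup>+x. ennreal ((norm (g1 x))\<^sup>2) \<partial>lborel)"
    using g1(1) by (intro nn_integral_eq_integral[symmetric]) (auto simp: L2_fun_def)
  finally have split: "(\<integral>\<^sup>+x. ennreal ((norm (S g x))\<^sup>2) * indicator E (fst x) \<partial>?M) \<le>
      2 * (\<integral>\<^sup>+x. ennreal ((norm (g1 x))\<^sup>2) \<partial>lborel) + 2 * (\<integral>\<^sup>+x. ennreal ((norm (S g2 x))\<^sup>2) * indicator E (fst x) \<partial>?M)" .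
  have high: "(\<integral>\<^sup>+x. ennreal ((norm (S g2 x))\<^sup>2) * indicator E (fst x) \<partial>?M) \<le> ennreal ((2 * pi) ^ CARD('n) * B * s powr (1 - \<sigma>)) * (\<integral>\<^sup>+x. ennreal (norm (g2 x)) \<partial>lborel)"
  proof -
    define A where "A = (\<integral>x. norm (g2 x) \<partial>lborel)"
    have A: "A \<ge> 0" "(\<integral>\<^sup>+x. ennreal (norm (g2 x)) \<partial>lborel) = ennreal A"
      unfolding A_def using g2 by (auto intro!: nn_integral_eq_integral)
    \<comment> \<open>Where |g| > s, the negative exponent 1 - \<sigma> gives |g| \<le>
      s^(1-\<sigma>) |g|^\<sigma>, and the last power has integral at most 1.\<close>
    have A1: "A \<le> s powr (1 - \<sigma>)"
    proof -
      have "A \<le> (\<integral>x. s powr (1 - \<sigma>) * norm (g x) powr \<sigma> \<partial>lborel)"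
        unfolding A_def
      proof (rule integral_mono')
        show "integrable lborel (\<lambda>x. s powr (1 - \<sigma>) * norm (g x) powr \<sigma>)" using g\<sigma> by simp
        show "norm (g2 x) \<le> s powr (1 - \<sigma>) * norm (g x) powr \<sigma>" for x
        proof (cases "norm (g x) \<le> s")
          case True
          then show ?thesis by (simp add: g2_def)
        next
          case False
          then have "norm (g x) = norm (g x) powr (1 - \<sigma>) * norm (g x) powr \<sigma>"
            using s by (simp flip: powr_add)
          also have "norm (g x) powr (1 - \<sigma>) \<le> s powr (1 - \<sigma>)"
            using False s \<sigma> by (intro powr_mono2') auto
          finally show ?thesis using False by (simp add: g2_def mult_right_mono)
        qed
      qed simp
      also have "\<dots> = s powr (1 - \<sigma>) * (\<integral>x. norm (g x) powr \<sigma> \<partial>lborel)" by simp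
      also have "\<dots> \<le> s powr (1 - \<sigma>) * 1" using g\<sigma> by (intro mult_left_mono) auto
      finally show ?thesis by simp
    qed
    have "(\<integral>\<^sup>+x. ennreal ((norm (S g2 x))\<^sup>2) * indicator E (fst x) \<partial>?M) =
        (\<integral>\<^sup>+a. \<integral>\<^sup>+w. ennreal ((norm (S g2 (a, w)))\<^sup>2) * indicator E a \<partial>lborel \<partial>fan_nu2 CARD('n))"
      by (subst lborel.nn_integral_fst[symmetric]) simp_all
    also have "\<dots> \<le> (\<integral>\<^sup>+a. ennreal ((2 * pi) ^ CARD('n) * A\<^sup>2) * (ennreal (1 / \<bar>fst a\<bar> ^ CARD('n)) * indicator E a) \<partial>fan_nu2 CARD('n))"
    proof (rule nn_integral_mono)
      fix a assume "a \<in> space (fan_nu2 CARD('n))"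
      then have a: "a \<in> heis_fan CARD('n)" by (simp add: space_fan_nu2)
      have "(\<integral>\<^sup>+w. ennreal ((norm (S g2 (a, w)))\<^sup>2) \<partial>lborel) \<le> ennreal ((2 * pi) ^ CARD('n) * A\<^sup>2) * ennreal (1 / \<bar>fst a\<bar> ^ CARD('n))"
        using a
      proof (cases rule: heis_fan_cases)
        case 1
        then show ?thesis by (simp add: S_def strichartz_def)
      next
        case (2 k)
        have "(2 * pi / \<bar>fst a\<bar>) ^ CARD('n) * A\<^sup>2 = (2 * pi) ^ CARD('n) * A\<^sup>2 * (1 / \<bar>fst a\<bar> ^ CARD('n))"
          by (simp add: power_divide)
        then show ?thesis using strichartz_slice_bound[OF 2 g2] A(1)
          by (simp add: S_def A_def[symmetric] ennreal_mult[symmetric])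
      qed
      then show "(\<integral>\<^sup>+w. ennreal ((norm (S g2 (a, w)))\<^sup>2) * indicator E a \<partial>lborel) \<le>
          ennreal ((2 * pi) ^ CARD('n) * A\<^sup>2) * (ennreal (1 / \<bar>fst a\<bar> ^ CARD('n)) * indicator E a)"
        by (auto simp: indicator_def)
    qed
    also have "\<dots> = ennreal ((2 * pi) ^ CARD('n) * A\<^sup>2) * emeasure (fan_mu CARD('n)) E"
    proof -
      have "(\<lambda>a :: real \<times> real. 1 / \<bar>fst a\<bar> ^ CARD('n)) \<in> borel_measurable (borel \<Otimes>\<^sub>M borel)"
        by measurable
      then have "(\<lambda>a :: real \<times> real. 1 / \<bar>fst a\<bar> ^ CARD('n)) \<in> borel_measurable (restrict_space borel (heis_fan CARD('n)))"
        unfolding borel_prod by (rule measurable_restrict_space1)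
      then have [measurable]: "(\<lambda>a. 1 / \<bar>fst a\<bar> ^ CARD('n)) \<in> borel_measurable (fan_nu2 CARD('n))"
        by (subst measurable_cong_sets[OF sets_fan_nu2 refl])
      show ?thesis
        unfolding fan_mu_def by (subst emeasure_density) (auto simp: nn_integral_cmult)
    qed
    also have "\<dots> \<le> ennreal ((2 * pi) ^ CARD('n) * A\<^sup>2) * ennreal B" by (rule mult_left_mono[OF B(1)]) simp
    \<comment> \<open>Only one of the two factors A is replaced by its bound; the other stays as an
      integral of |g2|, so that \<alpha> can later be integrated with x fixed.\<close>
    also have "\<dots> \<le> ennreal ((2 * pi) ^ CARD('n) * B * s powr (1 - \<sigma>) * A)"
    proof -
      have "(2 * pi) ^ CARD('n) * A\<^sup>2 * B = (2 * pi) ^ CARD('n) * B * A * A" by (simp add: power2_eq_square)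
      also have "\<dots> \<le> (2 * pi) ^ CARD('n) * B * s powr (1 - \<sigma>) * A"
        using A(1) A1 B by (intro mult_right_mono mult_left_mono) auto
      finally show ?thesis using A B by (simp add: ennreal_mult[symmetric] ennreal_leI)
    qed
    also have "\<dots> = ennreal ((2 * pi) ^ CARD('n) * B * s powr (1 - \<sigma>)) * ennreal A"
      using A B by (intro ennreal_mult) auto
    finally show ?thesis unfolding A(2) .
  qed
  note order_trans[OF split add_left_mono[OF mult_left_mono[OF high zero_le]]]
  also have "2 * (\<integral>\<^sup>+x. ennreal ((norm (g1 x))\<^sup>2) \<partial>lborel) + 2 * (ennreal ((2 * pi) ^ CARD('n) * B * s powr (1 - \<sigma>)) * (\<integral>\<^sup>+x. ennreal (norm (g2 x)) \<partial>lborel)) = (\<integral>\<^sup>+x. 2 * ennreal ((norm (g1 x))\<^sup>2) + 2 * (ennreal ((2 * pi) ^ CARD('n) * B * s powr (1 - \<sigma>)) * ennreal (norm (g2 x))) \<partial>lborel)"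
    by (simp add: nn_integral_add nn_integral_cmult)
  also have "\<dots> = (\<integral>\<^sup>+x. ennreal (2 * (norm (g x))\<^sup>2 * indicator {x. norm (g x) \<le> s} x +
      2 * (2 * pi) ^ CARD('n) * B * s powr (1 - \<sigma>) * (norm (g x) * indicator {x. norm (g x) > s} x)) \<partial>lborel)"
  proof (intro nn_integral_cong)
    fix x
    show "2 * ennreal ((norm (g1 x))\<^sup>2) + 2 * (ennreal ((2 * pi) ^ CARD('n) * B * s powr (1 - \<sigma>)) * ennreal (norm (g2 x))) =
        ennreal (2 * (norm (g x))\<^sup>2 * indicator {x. norm (g x) \<le> s} x +
      2 * (2 * pi) ^ CARD('n) * B * s powr (1 - \<sigma>) * (norm (g x) * indicator {x. norm (g x) > s} x))"
      using B(2) by (cases "norm (g x) \<le> s") (simp_all add: g1_def g2_def ennreal_mult mult.assoc)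
  qed
  finally show ?thesis unfolding S_def .
qed

text \<open>A Paley inequality: |m|^2 is written as a layer integral over \<alpha>, each level is
  bounded by \<open>strichartz_level_bound\<close>, and for fixed x the integral over \<alpha> is
  computed. The exponent 2p / (2p - 1) is dual to 2p, and 1/2 - 1/(2p) is the reciprocal of the weak
  exponent 2p / (p - 1).\<close>

lemma strichartz_paley:
  fixes g :: "'n::finite heis \<Rightarrow> complex" and m :: "real \<times> real \<Rightarrow> complex"
  assumes p: "p > 1" and g: "g \<in> L2_fun" "integrable lborel g"
    and g\<sigma>: "integrable lborel (\<lambda>x. norm (g x) powr (2 * p / (2 * p - 1)))"
      "(\<integral>x. norm (g x) powr (2 * p / (2 * p - 1)) \<partial>lborel) \<le> 1"
    and m: "m \<in> borel_measurable (restrict_space borel (heis_fan CARD('n)))"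
    and C: "C > 0"
    and weak: "\<And>\<alpha>. \<alpha> > 0 \<Longrightarrow> emeasure (fan_mu CARD('n)) {a \<in> heis_fan CARD('n). norm (m a) > \<alpha>} < \<infinity>"
      "\<And>\<alpha>. \<alpha> > 0 \<Longrightarrow> \<alpha> * measure (fan_mu CARD('n)) {a \<in> heis_fan CARD('n). norm (m a) > \<alpha>} powr (1/2 - 1 / (2 * p)) \<le> C"
  shows "(\<integral>\<^sup>+x. ennreal ((norm (m (fst x) * strichartz g (fst x) (snd x)))\<^sup>2) \<partial>(fan_nu2 CARD('n) \<Otimes>\<^sub>M lborel))
    \<le> ennreal (2 + 4 * (2 * pi) ^ CARD('n) * C powr (2 * p / (p - 1)) * (p - 1))"
proof -
  let ?M = "fan_nu2 CARD('n) \<Otimes>\<^sub>M (lborel :: (complex ^ 'n) measure)"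
  define \<sigma> where "\<sigma> = 2 * p / (2 * p - 1)"
  define r where "r = 2 * p / (p - 1)"
  define \<gamma> where "\<gamma> = (2 * p - 1) / (p - 1)"
  define e where "e = - 1 / (p - 1)"
  define D where "D = 4 * (2 * pi) ^ CARD('n) * C powr r"
  have D: "D \<ge> 0" by (simp add: D_def)
  have e: "e < 0" and \<gamma>: "\<gamma> > 0" and \<sigma>: "\<sigma> > 1" and r: "r > 0" using p by (auto simp: e_def \<gamma>_def \<sigma>_def r_def)
  \<comment> \<open>The first two relations determine \<gamma>: with X = y^(-1/\<gamma>), the
    contributions y^2 X^2 from below X and y X^e from above it are both y^\<sigma>.\<close>
  have rel1: "2 - 2 / \<gamma> = \<sigma>" "1 - e / \<gamma> = \<sigma>" "- 1 / e = p - 1"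
    using p by (simp_all add: \<gamma>_def \<sigma>_def e_def field_simps)
  \<comment> \<open>The power of \<alpha> left after collecting the layer factor \<alpha>, the bound
    (C / \<alpha>)^r on the measure and s^(1-\<sigma>); that it is e - 1 with e < 0 makes the tail
    integrable.\<close>
  have rel2: "1 - r - \<gamma> * (1 - \<sigma>) = e - 1"
  proof -
    have "1 - \<sigma> = - 1 / (2 * p - 1)" using p by (simp add: \<sigma>_def field_simps)
    then have "\<gamma> * (1 - \<sigma>) = e" using p by (simp add: \<gamma>_def e_def)
    moreover have "r = 2 - 2 * e" using p by (simp add: r_def e_def field_simps)
    ultimately show ?thesis by simp
  qed
  have [measurable]: "g \<in> borel_measurable borel" using g by auto
  define S where "S x = strichartz g (fst x) (snd x)" for x
  let ?G = "\<lambda>\<alpha> x. 2 * (norm (g x))\<^sup>2 * indicator {x. norm (g x) \<le> \<alpha> powr - \<gamma>} x +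
    2 * (2 * pi) ^ CARD('n) * (C / \<alpha>) powr r * (\<alpha> powr - \<gamma>) powr (1 - \<sigma>) * (norm (g x) * indicator {x. norm (g x) > \<alpha> powr - \<gamma>} x)"
  let ?l = "\<lambda>\<alpha> (x :: (real \<times> real) \<times> (complex ^ 'n)). if 0 < \<alpha> \<and> \<alpha> < norm (m (fst x)) then 2 * \<alpha> else 0"
  have Sm [measurable]: "S \<in> borel_measurable ?M"
    unfolding S_def[abs_def] by (rule borel_measurable_strichartz) simp
  have mm [measurable]: "m \<in> borel_measurable (fan_nu2 CARD('n))"
    using m by (subst measurable_cong_sets[OF sets_fan_nu2 refl])
  interpret nu: sigma_finite_measure "fan_nu2 CARD('n)" by (rule sigma_finite_fan_nu2) simp
  interpret nuw: pair_sigma_finite "fan_nu2 CARD('n)" "lborel :: (complex ^ 'n) measure" ..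
  have "sigma_finite_measure ?M" by (rule sigma_finite_pair_measure) unfold_locales
  then interpret M: sigma_finite_measure ?M .
  interpret P: pair_sigma_finite ?M "lborel :: real measure" ..
  define E where "E \<alpha> = {a \<in> heis_fan CARD('n). norm (m a) > \<alpha>}" for \<alpha>
  have Em: "E \<alpha> \<in> sets (fan_nu2 CARD('n))" for \<alpha>
  proof -
    have "{a \<in> space (fan_nu2 CARD('n)). norm (m a) > \<alpha>} \<in> sets (fan_nu2 CARD('n))" by measurable
    then show ?thesis by (simp add: E_def space_fan_nu2)
  qed
  have B: "emeasure (fan_mu CARD('n)) (E \<alpha>) \<le> ennreal ((C / \<alpha>) powr r)" if \<alpha>: "\<alpha> > 0" for \<alpha>
  proof -
    let ?\<mu> = "measure (fan_mu CARD('n)) (E \<alpha>)"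
    have "1/2 - 1 / (2 * p) = 1 / r" using p by (simp add: r_def field_simps)
    then have "?\<mu> powr (1 / r) \<le> C / \<alpha>"
      using weak(2)[OF \<alpha>] \<alpha> by (simp add: E_def pos_le_divide_eq mult.commute)
    then have "(?\<mu> powr (1 / r)) powr r \<le> (C / \<alpha>) powr r" using r by (intro powr_mono2) auto
    then have "?\<mu> \<le> (C / \<alpha>) powr r" using r by (simp add: powr_powr)
    moreover have "emeasure (fan_mu CARD('n)) (E \<alpha>) = ennreal ?\<mu>"
      using weak(1)[OF \<alpha>] by (intro emeasure_eq_ennreal_measure) (auto simp: E_def)
    ultimately show ?thesis by (simp add: ennreal_leI)
  qed
  define h where "h \<alpha> x = (if \<alpha> > 0 then 2 * \<alpha> * (?G \<alpha> x) else 0)" for \<alpha> x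
  have hm: "(\<lambda>(\<alpha>, x). h \<alpha> x) \<in> borel_measurable (lborel \<Otimes>\<^sub>M lborel)"
    unfolding h_def indicator_def mem_Collect_eq by measurable
  have "(\<integral>\<^sup>+x. ennreal ((norm (m (fst x) * S x))\<^sup>2) \<partial>?M) =
      (\<integral>\<^sup>+x. \<integral>\<^sup>+\<alpha>. ennreal (?l \<alpha> x) * ennreal ((norm (S x))\<^sup>2) \<partial>lborel \<partial>?M)"
  proof (rule nn_integral_cong)
    fix x
    have "ennreal ((norm (m (fst x) * S x))\<^sup>2) = ennreal ((norm (m (fst x)))\<^sup>2) * ennreal ((norm (S x))\<^sup>2)"
      by (simp add: norm_mult power_mult_distrib ennreal_mult)
    also have "ennreal ((norm (m (fst x)))\<^sup>2) = (\<integral>\<^sup>+\<alpha>. ennreal (2 * \<alpha>) * indicator {0<..<norm (m (fst x))} \<alpha> \<partial>lborel)"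
      by (rule nn_integral_layer[symmetric]) simp
    also have "\<dots> = (\<integral>\<^sup>+\<alpha>. ennreal (?l \<alpha> x) \<partial>lborel)"
      by (intro nn_integral_cong) (simp add: indicator_def)
    also have "\<dots> * ennreal ((norm (S x))\<^sup>2) = (\<integral>\<^sup>+\<alpha>. ennreal (?l \<alpha> x) * ennreal ((norm (S x))\<^sup>2) \<partial>lborel)"
      by (rule nn_integral_multc[symmetric]) measurable
    finally show "ennreal ((norm (m (fst x) * S x))\<^sup>2) = (\<integral>\<^sup>+\<alpha>. ennreal (?l \<alpha> x) * ennreal ((norm (S x))\<^sup>2) \<partial>lborel)" .
  qed
  also have "\<dots> = (\<integral>\<^sup>+\<alpha>. \<integral>\<^sup>+x. ennreal (?l \<alpha> x) * ennreal ((norm (S x))\<^sup>2) \<partial>?M \<partial>lborel)"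
    by (rule P.Fubini'[symmetric]) measurable
  also have "\<dots> \<le> (\<integral>\<^sup>+\<alpha>. \<integral>\<^sup>+x. ennreal (h \<alpha> x) \<partial>lborel \<partial>lborel)"
  proof (rule nn_integral_mono)
    fix \<alpha> :: real
    show "(\<integral>\<^sup>+x. ennreal (?l \<alpha> x) * ennreal ((norm (S x))\<^sup>2) \<partial>?M) \<le> (\<integral>\<^sup>+x. ennreal (h \<alpha> x) \<partial>lborel)"
    proof (cases "\<alpha> > 0")
      case False
      then show ?thesis by (simp add: h_def)
    next
      case True
      have "(\<integral>\<^sup>+x. ennreal (?l \<alpha> x) * ennreal ((norm (S x))\<^sup>2) \<partial>?M)
          = (\<integral>\<^sup>+x. ennreal (2 * \<alpha>) * (ennreal ((norm (S x))\<^sup>2) * indicator (E \<alpha>) (fst x)) \<partial>?M)"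
        by (intro nn_integral_cong) (use True in \<open>auto simp: indicator_def E_def dest: space_fan\<close>)
      also have "\<dots> = ennreal (2 * \<alpha>) * (\<integral>\<^sup>+x. ennreal ((norm (S x))\<^sup>2) * indicator (E \<alpha>) (fst x) \<partial>?M)"
        by (rule nn_integral_cmult) (use Em in measurable)
      also have "\<dots> \<le> ennreal (2 * \<alpha>) * (\<integral>\<^sup>+x. ennreal (?G \<alpha> x) \<partial>lborel)"
        unfolding S_def
        by (intro mult_left_mono strichartz_level_bound[OF g \<sigma> _ _ Em _ B[OF True]])
          (use True g\<sigma> in \<open>auto simp: \<sigma>_def\<close>)
      also have "\<dots> = (\<integral>\<^sup>+x. ennreal (2 * \<alpha>) * ennreal (?G \<alpha> x) \<partial>lborel)"
        by (rule nn_integral_cmult[symmetric]) (unfold indicator_def mem_Collect_eq, measurable)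
      also have "\<dots> = (\<integral>\<^sup>+x. ennreal (h \<alpha> x) \<partial>lborel)"
      proof (rule nn_integral_cong)
        have "0 \<le> 2 * \<alpha>" using True by simp
        then show "ennreal (2 * \<alpha>) * ennreal (?G \<alpha> x) = ennreal (h \<alpha> x)" for x
          unfolding h_def if_P[OF True] by (rule ennreal_mult'[symmetric])
      qed
      finally show ?thesis .
    qed
  qed
  also have "\<dots> = (\<integral>\<^sup>+x. \<integral>\<^sup>+\<alpha>. ennreal (h \<alpha> x) \<partial>lborel \<partial>lborel)"
    by (rule lborel_pair.Fubini'[symmetric]) (use measurable_compose[OF hm measurable_ennreal] in \<open>simp add: case_prod_beta'\<close>)
  also have "\<dots> \<le> (\<integral>\<^sup>+x. ennreal ((2 + D * (p - 1)) * norm (g x) powr \<sigma>) \<partial>lborel)"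
  proof (rule nn_integral_mono)
    fix x :: "'n heis"
    define y where "y = norm (g x)"
    show "(\<integral>\<^sup>+\<alpha>. ennreal (h \<alpha> x) \<partial>lborel) \<le> ennreal ((2 + D * (p - 1)) * norm (g x) powr \<sigma>)"
    proof (cases "y = 0")
      case True
      then have "h \<alpha> x = 0" for \<alpha> by (simp add: h_def y_def)
      then show ?thesis by simp
    next
      case False
      then have y: "y > 0" by (simp add: y_def)
      \<comment> \<open>The level at which the splitting height \<alpha>^(-\<gamma>) equals |g x|:
        for positive \<alpha> \<le> X the point x belongs to the lower part of g, for larger
        \<alpha> to the upper one.\<close>
      define X where "X = y powr (- 1 / \<gamma>)"
      have X: "X > 0" using y by (simp add: X_def)
      have iff: "y \<le> \<alpha> powr - \<gamma> \<longleftrightarrow> \<alpha> \<le> X" if "\<alpha> > 0" for \<alpha>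
      proof -
        have Xy: "X powr - \<gamma> = y" using y \<gamma> by (simp add: X_def powr_powr)
        show ?thesis
        proof
          assume "\<alpha> \<le> X"
          then have "X powr - \<gamma> \<le> \<alpha> powr - \<gamma>" using that \<gamma> by (intro powr_mono2') auto
          then show "y \<le> \<alpha> powr - \<gamma>" by (simp add: Xy)
        next
          assume a: "y \<le> \<alpha> powr - \<gamma>"
          show "\<alpha> \<le> X"
          proof (rule ccontr)
            assume "\<not> \<alpha> \<le> X"
            then have "\<alpha> powr - \<gamma> < X powr - \<gamma>" using X \<gamma> by (intro powr_less_mono2_neg) auto
            then show False using a Xy by simp
          qed
        qed
      qed
      have "(\<integral>\<^sup>+\<alpha>. ennreal (h \<alpha> x) \<partial>lborel) \<le>
          (\<integral>\<^sup>+\<alpha>. ennreal (y\<^sup>2) * (ennreal (4 * \<alpha>) * indicator {0..X} \<alpha>) + ennreal (D * y) * (ennreal (\<alpha> powr (e - 1)) * indicator {X..} \<alpha>) \<partial>lborel)"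
      proof (rule nn_integral_mono)
        fix \<alpha> :: real
        show "ennreal (h \<alpha> x) \<le> ennreal (y\<^sup>2) * (ennreal (4 * \<alpha>) * indicator {0..X} \<alpha>) + ennreal (D * y) * (ennreal (\<alpha> powr (e - 1)) * indicator {X..} \<alpha>)"
        proof (cases "\<alpha> > 0")
          case False
          then show ?thesis by (simp add: h_def)
        next
          case a: True
          show ?thesis
          proof (cases "\<alpha> \<le> X")
            case True
            then have "h \<alpha> x = y\<^sup>2 * (4 * \<alpha>)" using a iff[OF a] by (simp add: h_def y_def[symmetric])
            then have "ennreal (h \<alpha> x) = ennreal (y\<^sup>2) * (ennreal (4 * \<alpha>) * indicator {0..X} \<alpha>)"
              using a True by (simp add: ennreal_mult)
            then show ?thesis by simp
          next
            case False
            have "\<alpha> * ((C / \<alpha>) powr r * (\<alpha> powr - \<gamma>) powr (1 - \<sigma>)) = C powr r * (\<alpha> powr 1 * \<alpha> powr - r * \<alpha> powr (- \<gamma> * (1 - \<sigma>)))"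
              using a C by (simp add: powr_divide powr_powr powr_minus_divide)
            also have "\<dots> = C powr r * \<alpha> powr (e - 1)"
              unfolding powr_add[symmetric] rel2[symmetric] by simp
            finally have eq: "\<alpha> * ((C / \<alpha>) powr r * (\<alpha> powr - \<gamma>) powr (1 - \<sigma>)) = C powr r * \<alpha> powr (e - 1)" .
            have "h \<alpha> x = 4 * (2 * pi) ^ CARD('n) * (\<alpha> * ((C / \<alpha>) powr r * (\<alpha> powr - \<gamma>) powr (1 - \<sigma>))) * y"
              using a iff[OF a] False by (simp add: h_def y_def[symmetric])
            also have "\<dots> = (D * y) * \<alpha> powr (e - 1)" unfolding eq D_def by simp
            finally have "ennreal (h \<alpha> x) = ennreal (D * y) * (ennreal (\<alpha> powr (e - 1)) * indicator {X..} \<alpha>)"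
              using a False D y by (simp add: ennreal_mult)
            then show ?thesis by simp
          qed
        qed
      qed
      also have "\<dots> = ennreal (y\<^sup>2) * (\<integral>\<^sup>+\<alpha>. ennreal (4 * \<alpha>) * indicator {0..X} \<alpha> \<partial>lborel) +
          ennreal (D * y) * (\<integral>\<^sup>+\<alpha>. ennreal (\<alpha> powr (e - 1)) * indicator {X..} \<alpha> \<partial>lborel)"
        by (simp add: nn_integral_add nn_integral_cmult)
      also have "\<dots> = ennreal (y\<^sup>2 * (2 * X\<^sup>2) + D * y * (X powr e / - e))"
        unfolding nn_integral_linear_Icc[OF less_imp_le[OF X]] nn_integral_powr_atLeast[OF X e]
        using D y e by (simp add: ennreal_mult'[symmetric] ennreal_plus[symmetric] divide_nonneg_neg mult_nonneg_nonpos del: ennreal_plus)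
      also have "y\<^sup>2 * (2 * X\<^sup>2) + D * y * (X powr e / - e) = (2 + D * (p - 1)) * y powr \<sigma>"
      proof -
        have "y\<^sup>2 * X\<^sup>2 = y powr \<sigma>"
        proof -
          have "y\<^sup>2 * X\<^sup>2 = y powr 2 * (y powr (- 1 / \<gamma>)) powr 2"
            using y by (simp add: X_def powr_numeral)
          also have "\<dots> = y powr (2 - 2 / \<gamma>)" unfolding powr_powr powr_add[symmetric] by simp
          finally show ?thesis unfolding rel1 .
        qed
        moreover have "y * X powr e = y powr \<sigma>"
        proof -
          have "y * X powr e = y powr 1 * (y powr (- 1 / \<gamma>)) powr e" using y by (simp add: X_def)
          also have "\<dots> = y powr (1 - e / \<gamma>)" unfolding powr_powr powr_add[symmetric] by simp
          finally show ?thesis unfolding rel1 .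
        qed
        moreover have "X powr e / - e = X powr e * (p - 1)" unfolding rel1(3)[symmetric] by simp
        moreover have "y\<^sup>2 * (2 * X\<^sup>2) + D * y * (X powr e * (p - 1)) = 2 * (y\<^sup>2 * X\<^sup>2) + D * (p - 1) * (y * X powr e)"
          by simp
        ultimately show ?thesis by (simp only: distrib_right)
      qed
      finally show ?thesis by (simp add: y_def)
    qed
  qed
  also have "\<dots> = ennreal (\<integral>x. (2 + D * (p - 1)) * norm (g x) powr \<sigma> \<partial>lborel)"
    by (rule nn_integral_eq_integral) (use g\<sigma> D p in \<open>auto simp: \<sigma>_def intro!: integrable_mult_right\<close>)
  also have "\<dots> \<le> ennreal (2 + D * (p - 1))"
    using g\<sigma>(2) D p by (intro ennreal_leI) (simp add: \<sigma>_def mult_left_le)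
  finally show ?thesis unfolding S_def D_def r_def .
qed

section \<open>Bounds for the multiplier and the nonlinearity\<close>

lemma integrable_bounded_support:
  fixes f :: "'a::euclidean_space \<Rightarrow> 'b::{banach, second_countable_topology}"
  assumes "f \<in> borel_measurable borel" "\<And>x. norm (f x) \<le> c * indicator (cball 0 r) x"
  shows "integrable lborel f"
proof (rule Bochner_Integration.integrable_bound)
  show "integrable lborel (\<lambda>x :: 'a. c * indicator (cball 0 r) x)"
    using emeasure_lborel_cball_finite[of "0 :: 'a" r] by (intro integrable_mult_right integrable_real_indicator) auto
  show "AE x in lborel. norm (f x) \<le> norm (c * indicator (cball 0 r) x)"
    unfolding real_norm_def by (intro AE_I2 order_trans[OF assms(2) abs_ge_self])
qed (use assms(1) in simp)

text \<open>Duality: the \<open>L\<^bsup>2p\<^esup>\<close> norm of \<open>k\<close> is tested against the normalized truncations of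
  \<open>k \<bar>k\<bar>\<^bsup>2p-2\<^esup>\<close>.\<close>

lemma fourier_multiplier_Lp_bound:
  fixes h k :: "'n::finite heis L2" and m :: "real \<times> real \<Rightarrow> complex"
  assumes p: "p > 1" and K: "K \<ge> 0"
    and m: "m \<in> borel_measurable (restrict_space borel (heis_fan CARD('n)))"
    and paley: "\<And>g :: 'n heis \<Rightarrow> complex. g \<in> L2_fun \<Longrightarrow> integrable lborel g \<Longrightarrow>
      integrable lborel (\<lambda>x. norm (g x) powr (2 * p / (2 * p - 1))) \<Longrightarrow>
      (\<integral>x. norm (g x) powr (2 * p / (2 * p - 1)) \<partial>lborel) \<le> 1 \<Longrightarrow>
      (\<integral>\<^sup>+x. ennreal ((norm (m (fst x) * strichartz g (fst x) (snd x)))\<^sup>2) \<partial>(fan_nu2 CARD('n) \<Otimes>\<^sub>M lborel)) \<le> ennreal K"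
    and h: "strichartz_L2 h H" and k: "strichartz_L2 k (\<lambda>x. m (fst x) * H x)"
  shows "(\<integral>\<^sup>+x. ennreal (norm (rep_L2 k x) powr (2 * p)) \<partial>lborel) \<le> ennreal ((K * (norm h)\<^sup>2) powr p)"
proof -
  let ?M = "fan_nu2 CARD('n) \<Otimes>\<^sub>M (lborel :: (complex ^ 'n) measure)"
  let ?F = "\<lambda>g (x :: (real \<times> real) \<times> (complex ^ 'n)). m (fst x) * strichartz g (fst x) (snd x)"
  let ?P = "\<lambda>g H (x :: (real \<times> real) \<times> (complex ^ 'n)). (m (fst x) * H x) \<bullet> strichartz g (fst x) (snd x)"
  define \<sigma> where "\<sigma> = 2 * p / (2 * p - 1)"
  have \<sigma>: "\<sigma> > 0" using p by (simp add: \<sigma>_def)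
  define k0 where "k0 = rep_L2 k"
  have k0: "k0 \<in> L2_fun" "k = L2_of k0" by (simp_all add: k0_def rep_L2_fun)
  then have [measurable]: "k0 \<in> borel_measurable borel" by (simp add: L2_fun_def)
  have [measurable]: "m \<in> borel_measurable (fan_nu2 CARD('n))"
    using m by (subst measurable_cong_sets[OF sets_fan_nu2 refl])
  note Hsq = strichartz_L2_sq_integrable[OF h]
  note [measurable] = sq_integrable_measurable[OF Hsq]
  define b where "b N x = (if norm x \<le> real N \<and> norm (k0 x) \<le> real N then 1 else 0 :: real)" for N :: nat and x
  have [measurable]: "b N \<in> borel_measurable borel" for N unfolding b_def by measurable
  have bt: "norm (b N x * norm (k0 x) powr t) \<le> real N powr t * indicator (cball 0 (real N)) x" if "t \<ge> 0" for N x t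
    using that by (auto simp: b_def intro: powr_mono2)
  have kint: "integrable lborel (\<lambda>x. b N x * norm (k0 x) powr (2 * p))" for N
    using p by (intro integrable_bounded_support[OF _ bt]) auto
  define I where "I N = (\<integral>x. b N x * norm (k0 x) powr (2 * p) \<partial>lborel)" for N
  have I_nonneg: "I N \<ge> 0" for N unfolding I_def by (intro integral_nonneg_AE AE_I2) (simp add: b_def)
  have I_le: "I N \<le> (K * (norm h)\<^sup>2) powr p" for N
  proof (cases "I N = 0")
    case True
    then show ?thesis by simp
  next
    case False
    then have I: "I N > 0" using I_nonneg[of N] by simp
    \<comment> \<open>Since (2p - 1) \<sigma> = 2p, dividing by J gives |g|^\<sigma> the integral 1.
      The case I N = 0 is treated apart because J would vanish.\<close>
    define J where "J = I N powr (1 / \<sigma>)"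
    have J: "J > 0" using I by (simp add: J_def)
    define g where "g x = of_real (b N x * norm (k0 x) powr (2 * p - 2) / J) * k0 x" for x
    have [measurable]: "g \<in> borel_measurable borel" unfolding g_def by measurable
    have pw: "norm (k0 x) powr (2 * p - 2) * norm (k0 x) = norm (k0 x) powr (2 * p - 1)" for x
      using powr_mult_base[of "norm (k0 x)" "2 * p - 2"] by (simp add: mult.commute)
    have ng: "norm (g x) = b N x * norm (k0 x) powr (2 * p - 1) / J" for x
      unfolding g_def norm_mult norm_of_real using J pw[of x] by (simp add: b_def)
    have ngb: "norm (g x) \<le> (real N powr (2 * p - 1) / J) * indicator (cball 0 (real N)) x" for x
    proof -
      have "norm (g x) = norm (b N x * norm (k0 x) powr (2 * p - 1)) / J"
        unfolding ng by (simp add: b_def)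
      also have "\<dots> \<le> (real N powr (2 * p - 1) * indicator (cball 0 (real N)) x) / J"
        using J p by (intro divide_right_mono bt) auto
      finally show ?thesis by simp
    qed
    have g_int: "integrable lborel g" by (rule integrable_bounded_support[OF _ ngb]) simp
    have "integrable lborel (\<lambda>x. (norm (g x))\<^sup>2)"
    proof (rule integrable_bounded_support)
      show "norm ((norm (g x))\<^sup>2) \<le> (real N powr (2 * p - 1) / J)\<^sup>2 * indicator (cball 0 (real N)) x" for x
        using power_mono[OF ngb norm_ge_zero, of x 2] by (auto simp: indicator_def)
    qed simp
    then have g_L2: "g \<in> L2_fun" by (simp add: L2_fun_def)
    have g\<sigma>: "norm (g x) powr \<sigma> = b N x * norm (k0 x) powr (2 * p) / I N" for x
    proof -
      have "J powr \<sigma> = I N" using \<sigma> I by (simp add: J_def powr_powr)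
      moreover have "(2 * p - 1) * \<sigma> = 2 * p" using p by (simp add: \<sigma>_def)
      ultimately show ?thesis
        unfolding ng using J by (simp add: b_def powr_divide powr_powr)
    qed
    have g\<sigma>i: "integrable lborel (\<lambda>x. norm (g x) powr \<sigma>)" unfolding g\<sigma> using kint by simp
    have g\<sigma>v: "(\<integral>x. norm (g x) powr \<sigma> \<partial>lborel) \<le> 1" unfolding g\<sigma> using I by (simp add: I_def[symmetric])
    have pal: "(\<integral>\<^sup>+x. ennreal ((norm (?F g x))\<^sup>2) \<partial>?M) \<le> ennreal K"
      using paley[OF g_L2 g_int] g\<sigma>i g\<sigma>v by (simp add: \<sigma>_def)
    \<comment> \<open>As 1 - 1/\<sigma> = 1/(2p), the pairing is I^(1/(2p)); its square will be
      bounded by K times the squared norm of h, with no power of I on the right.\<close>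
    have ip: "k \<bullet> L2_of g = I N powr (1 / (2 * p))"
    proof -
      have "k \<bullet> L2_of g = (\<integral>x. k0 x \<bullet> g x \<partial>lborel)"
        unfolding k0(2) by (simp add: inner_L2.abs_eq L2_rel_refl k0 g_L2)
      also have "(\<lambda>x. k0 x \<bullet> g x) = (\<lambda>x. b N x * norm (k0 x) powr (2 * p) / J)"
      proof
        fix x
        have "k0 x \<bullet> g x = (b N x * norm (k0 x) powr (2 * p - 2) / J) * (norm (k0 x) * norm (k0 x))"
          unfolding g_def scaleR_conv_of_real[symmetric] inner_scaleR_right by (simp add: dot_square_norm power2_eq_square)
        also have "\<dots> = b N x * (norm (k0 x) powr (2 * p - 1) * norm (k0 x)) / J"
          unfolding pw[symmetric] by simp
        also have "norm (k0 x) powr (2 * p - 1) * norm (k0 x) = norm (k0 x) powr (2 * p)"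
          using powr_mult_base[of "norm (k0 x)" "2 * p - 1"] by (simp add: mult.commute)
        finally show "k0 x \<bullet> g x = b N x * norm (k0 x) powr (2 * p) / J" .
      qed
      also have "(\<integral>x. b N x * norm (k0 x) powr (2 * p) / J \<partial>lborel) = I N / J" by (simp add: I_def)
      also have "I N / J = I N powr 1 / I N powr (1 / \<sigma>)" using I by (simp add: J_def)
      also have "\<dots> = I N powr (1 - 1 / \<sigma>)" by (rule powr_diff[symmetric])
      also have "1 - 1 / \<sigma> = 1 / (2 * p)" using p by (simp add: \<sigma>_def field_simps)
      finally show ?thesis .
    qed
    have [measurable]: "(\<lambda>x. strichartz g (fst x) (snd x)) \<in> borel_measurable ?M"
      by (rule borel_measurable_strichartz) simp
    \<comment> \<open>In Parseval's formula the factor m moves from the transform of k to that of g,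
      where \<open>paley\<close> controls it.\<close>
    have "ennreal (I N powr (1 / (2 * p))) \<le> (\<integral>\<^sup>+x. ennreal (norm (H x)) * ennreal (norm (?F g x)) \<partial>?M)"
    proof -
      have "ennreal (I N powr (1 / (2 * p))) = ennreal (norm (\<integral>x. ?P g H x \<partial>?M))"
        unfolding strichartz_parseval(2)[OF k g_L2 g_int, symmetric] ip by simp
      also have "\<dots> \<le> (\<integral>\<^sup>+x. ennreal (norm (?P g H x)) \<partial>?M)"
        by (rule integral_norm_bound_ennreal[OF strichartz_parseval(1)[OF k g_L2 g_int]])
      also have "\<dots> \<le> (\<integral>\<^sup>+x. ennreal (norm (H x)) * ennreal (norm (?F g x)) \<partial>?M)"
      proof (rule nn_integral_mono)
        fix x :: "(real \<times> real) \<times> (complex ^ 'n)"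
        have "norm (?P g H x) \<le> norm (m (fst x) * H x) * norm (strichartz g (fst x) (snd x))"
          using Cauchy_Schwarz_ineq2[of "m (fst x) * H x"] by simp
        also have "\<dots> = norm (H x) * norm (?F g x)" by (simp add: norm_mult)
        finally show "ennreal (norm (?P g H x)) \<le> ennreal (norm (H x)) * ennreal (norm (?F g x))"
          by (simp add: ennreal_mult[symmetric] ennreal_leI)
      qed
      finally show ?thesis .
    qed
    then have "ennreal (I N powr (1 / (2 * p))) ^ 2 \<le> (\<integral>\<^sup>+x. ennreal (norm (H x)) * ennreal (norm (?F g x)) \<partial>?M) ^ 2"
      by (rule power_mono) simp
    also have "\<dots> \<le> (\<integral>\<^sup>+x. ennreal (norm (H x)) ^ 2 \<partial>?M) * (\<integral>\<^sup>+x. ennreal (norm (?F g x)) ^ 2 \<partial>?M)"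
      by (rule Cauchy_Schwarz_nn_integral) measurable
    also have "(\<integral>\<^sup>+x. ennreal (norm (H x)) ^ 2 \<partial>?M) = ennreal ((norm h)\<^sup>2)"
      unfolding strichartz_L2_norm[OF h] sq_integrable_nn_eq[OF Hsq, symmetric] by (simp add: ennreal_power)
    also have "(\<integral>\<^sup>+x. ennreal (norm (?F g x)) ^ 2 \<partial>?M) =
        (\<integral>\<^sup>+x. ennreal ((norm (?F g x))\<^sup>2) \<partial>?M)"
      by (simp add: ennreal_power)
    also have "ennreal ((norm h)\<^sup>2) * \<dots> \<le> ennreal ((norm h)\<^sup>2) * ennreal K"
      by (rule mult_left_mono[OF pal]) simp
    also have "\<dots> = ennreal (K * (norm h)\<^sup>2)" using K by (simp add: ennreal_mult[symmetric] mult.commute)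
    finally have "(I N powr (1 / (2 * p)))\<^sup>2 \<le> K * (norm h)\<^sup>2"
      using K by (simp add: ennreal_power ennreal_le_iff)
    moreover have "(I N powr (1 / (2 * p)))\<^sup>2 = I N powr (1 / p)"
      by (simp add: power2_eq_square flip: powr_add)
    ultimately have "(I N powr (1 / p)) powr p \<le> (K * (norm h)\<^sup>2) powr p"
      using p by (intro powr_mono2) auto
    then show ?thesis using p I by (simp add: powr_powr)
  qed
  have "(\<lambda>N. \<integral>\<^sup>+x. ennreal (b N x * norm (k0 x) powr (2 * p)) \<partial>lborel) \<longlonglongrightarrow> (\<integral>\<^sup>+x. ennreal (norm (k0 x) powr (2 * p)) \<partial>lborel)"
  proof (rule nn_integral_LIMSEQ)
    show "incseq (\<lambda>N x. ennreal (b N x * norm (k0 x) powr (2 * p)))"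
      by (intro incseq_SucI le_funI ennreal_leI mult_right_mono) (auto simp: b_def)
    show "(\<lambda>N. ennreal (b N x * norm (k0 x) powr (2 * p))) \<longlonglongrightarrow> ennreal (norm (k0 x) powr (2 * p))" for x
    proof (rule tendsto_eventually)
      obtain N0 where N0: "norm x + norm (k0 x) \<le> real N0" using real_arch_simple by blast
      have "b N x = 1" if "N \<ge> N0" for N
      proof -
        have "norm x + norm (k0 x) \<le> real N" using N0 that by linarith
        then have "norm x \<le> real N" "norm (k0 x) \<le> real N" using norm_ge_zero[of x] norm_ge_zero[of "k0 x"] by linarith+
        then show ?thesis by (simp add: b_def)
      qed
      then show "\<forall>\<^sub>F N in sequentially. ennreal (b N x * norm (k0 x) powr (2 * p)) = ennreal (norm (k0 x) powr (2 * p))"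
        unfolding eventually_sequentially by (intro exI[of _ N0]) simp
    qed
  qed measurable
  moreover have "(\<integral>\<^sup>+x. ennreal (b N x * norm (k0 x) powr (2 * p)) \<partial>lborel) \<le> ennreal ((K * (norm h)\<^sup>2) powr p)" for N
  proof -
    have "(\<integral>\<^sup>+x. ennreal (b N x * norm (k0 x) powr (2 * p)) \<partial>lborel) = ennreal (I N)"
      unfolding I_def by (rule nn_integral_eq_integral[OF kint]) (simp add: b_def)
    then show ?thesis using I_le by (simp add: ennreal_leI)
  qed
  ultimately show ?thesis unfolding k0_def using LIMSEQ_le_const2 by blast
qed

section \<open>Pointwise estimates for the power nonlinearity\<close>

lemma abs_powr_diff_le:
  fixes s t p :: real
  assumes p: "p > 1" and "s \<ge> 0" "t \<ge> 0"
  shows "\<bar>s powr p - t powr p\<bar> \<le> p * \<bar>s - t\<bar> * max s t powr (p - 1)"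
proof -
  have *: "t powr p - s powr p \<le> p * (t - s) * t powr (p - 1)" if st: "0 \<le> s" "s < t" for s t
  proof -
    have "\<exists>l z. s < z \<and> z < t \<and> ((\<lambda>x. x powr p) has_real_derivative l) (at z) \<and> t powr p - s powr p = (t - s) * l"
    proof (rule MVT[OF st(2)])
      show "continuous_on {s..t} (\<lambda>x. x powr p)"
        using st p by (intro continuous_on_powr' continuous_intros) auto
      show "(\<lambda>x. x powr p) differentiable (at x)" if "s < x" "x < t" for x
        unfolding real_differentiable_def using that st
        by (intro exI[of _ "p * x powr (p - 1)"]) (auto intro!: derivative_eq_intros)
    qed
    then obtain l x where z: "s < x" "x < t" "((\<lambda>x. x powr p) has_real_derivative l) (at x)" "t powr p - s powr p = (t - s) * l"
      by blast
    have "((\<lambda>x. x powr p) has_real_derivative p * x powr (p - 1)) (at x)"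
      using z st by (auto intro!: derivative_eq_intros)
    then have "l = p * x powr (p - 1)" using z(3) DERIV_unique by blast
    then have x: "s < x" "x < t" "t powr p - s powr p = (t - s) * (p * x powr (p - 1))" using z by auto
    have "x powr (p - 1) \<le> t powr (p - 1)" using x st p by (intro powr_mono2) auto
    then show ?thesis unfolding x(3) using st p by (simp add: mult_left_mono mult.assoc mult.left_commute)
  qed
  consider "s < t" | "t < s" | "s = t" by linarith
  then show ?thesis
  proof cases
    case 1
    then have "s powr p \<le> t powr p" using assms by (intro powr_mono2) auto
    then show ?thesis using *[of s t] 1 assms by (simp add: max_def)
  next
    case 2
    then have "t powr p \<le> s powr p" using assms by (intro powr_mono2) auto
    then show ?thesis using *[of t s] 2 assms by (simp add: max_def)
  qed simp
qed

text \<open>A pointwise stand-in for Hoelder's inequality: after scaling by D and R, the product X^2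
  Y^(2p-2) is at most max(X, Y)^(2p). The scales are meant to be the norm of the difference and the
  radius of the ball, so that each power on the right has an integral bounded by a constant.\<close>

lemma square_abs_powr_diff_le:
  fixes a b :: complex and D R :: real
  assumes p: "p > 1" and D: "D > 0" and R: "R > 0"
  shows "(norm a powr p - norm b powr p)\<^sup>2 \<le> p\<^sup>2 * D\<^sup>2 * R powr (2 * p - 2) *
    (2 * (norm (a - b) / D) powr (2 * p) + (norm a / R) powr (2 * p) + (norm b / R) powr (2 * p))"
proof -
  have key: "x\<^sup>2 * y powr (2 * p - 2) \<le> D\<^sup>2 * R powr (2 * p - 2) * ((x / D) powr (2 * p) + (y / R) powr (2 * p))"
    if "x \<ge> 0" "y \<ge> 0" for x y
  proof -
    define X where "X = x / D"
    define Y where "Y = y / R"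
    have XY: "X \<ge> 0" "Y \<ge> 0" using that D R by (auto simp: X_def Y_def)
    define Z where "Z = max X Y"
    have "X\<^sup>2 * Y powr (2 * p - 2) \<le> Z\<^sup>2 * Z powr (2 * p - 2)"
      using XY p by (intro mult_mono power_mono powr_mono2) (auto simp: Z_def)
    also have "\<dots> = Z powr (2 * p)"
    proof (cases "Z = 0")
      case False
      then have "Z > 0" using XY by (auto simp: Z_def max_def split: if_splits)
      then show ?thesis by (simp add: powr_numeral[symmetric] powr_add[symmetric] del: powr_numeral)
    qed simp
    also have "\<dots> \<le> X powr (2 * p) + Y powr (2 * p)" by (auto simp: Z_def max_def)
    finally have "X\<^sup>2 * Y powr (2 * p - 2) \<le> X powr (2 * p) + Y powr (2 * p)" .
    then have "D\<^sup>2 * R powr (2 * p - 2) * (X\<^sup>2 * Y powr (2 * p - 2)) \<le> D\<^sup>2 * R powr (2 * p - 2) * (X powr (2 * p) + Y powr (2 * p))"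
      by (intro mult_left_mono) auto
    moreover have "D\<^sup>2 * R powr (2 * p - 2) * (X\<^sup>2 * Y powr (2 * p - 2)) = x\<^sup>2 * y powr (2 * p - 2)"
      using D R that by (simp add: X_def Y_def power_divide powr_divide)
    ultimately show ?thesis unfolding X_def Y_def by simp
  qed
  define d where "d = norm (a - b)"
  have "\<bar>norm a powr p - norm b powr p\<bar> \<le> p * \<bar>norm a - norm b\<bar> * max (norm a) (norm b) powr (p - 1)"
    using p by (intro abs_powr_diff_le) auto
  also have "\<dots> \<le> p * d * max (norm a) (norm b) powr (p - 1)"
    unfolding d_def using p norm_triangle_ineq3[of a b] by (intro mult_right_mono mult_left_mono) auto
  finally have "(norm a powr p - norm b powr p)\<^sup>2 \<le> (p * d * max (norm a) (norm b) powr (p - 1))\<^sup>2"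
    by (rule abs_le_square_iff[THEN iffD1, OF order_trans[OF _ abs_ge_self]])
  also have "\<dots> = p\<^sup>2 * (d\<^sup>2 * max (norm a) (norm b) powr (2 * p - 2))"
    by (simp add: power_mult_distrib power2_eq_square[of "_ powr _"] flip: powr_add)
  also have "\<dots> \<le> p\<^sup>2 * (d\<^sup>2 * (norm a powr (2 * p - 2) + norm b powr (2 * p - 2)))"
    by (intro mult_left_mono) (auto simp: max_def)
  also have "\<dots> \<le> p\<^sup>2 * (D\<^sup>2 * R powr (2 * p - 2) * ((d / D) powr (2 * p) + (norm a / R) powr (2 * p)) +
      D\<^sup>2 * R powr (2 * p - 2) * ((d / D) powr (2 * p) + (norm b / R) powr (2 * p)))"
    unfolding distrib_left[of "d\<^sup>2"] by (intro mult_left_mono add_mono key) (auto simp: d_def)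
  finally show ?thesis by (simp add: d_def algebra_simps)
qed

section \<open>Mild solutions\<close>

text \<open>Picard iteration. The semigroup is extended to negative times by the identity and the time
  variable of the integral equation is clamped to \<open>[0, Ts]\<close>, so that the iteration map acts on
  bounded continuous functions on the whole line.\<close>

lemma local_mild_solution:
  fixes S :: "real \<Rightarrow> 'e::{banach, second_countable_topology} \<Rightarrow> 'e" and N :: "'e \<Rightarrow> 'e" and u0 :: 'e
  assumes lin: "\<And>s. s \<ge> 0 \<Longrightarrow> linear (S s)" and contr: "\<And>s f. s \<ge> 0 \<Longrightarrow> norm (S s f) \<le> norm f"
    and S0: "\<And>f. S 0 f = f" and semi: "\<And>s t f. s \<ge> 0 \<Longrightarrow> t \<ge> 0 \<Longrightarrow> S (s + t) f = S s (S t f)"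
    and cont: "\<And>f. ((\<lambda>s. S s f) \<longlongrightarrow> f) (at_right 0)"
    and lip: "\<And>R. R > 0 \<Longrightarrow> \<exists>L. \<forall>u v. norm u \<le> R \<longrightarrow> norm v \<le> R \<longrightarrow> norm (N u - N v) \<le> L * norm (u - v)"
  shows "\<exists>Ts>0. \<exists>u. continuous_on UNIV u \<and> bounded (range u) \<and>
    (\<forall>\<tau>\<in>{0<..<Ts}. set_integrable lborel {0<..<\<tau>} (\<lambda>s. S (\<tau> - s) (N (u s))) \<and>
      u \<tau> = S \<tau> u0 + (LINT s:{0<..<\<tau>}|lborel. S (\<tau> - s) (N (u s))))"
proof -
  define P where "P s f = S (max 0 s) f" for s f
  have P_diff: "P s f - P s g = P s (f - g)" for s f g
    using linear_diff[OF lin[of "max 0 s"]] by (simp add: P_def)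
  have P_le: "norm (P s f) \<le> norm f" for s f using contr[of "max 0 s" f] by (simp add: P_def)
  \<comment> \<open>The operator at the smaller time factors out and is a contraction, so the
    increment is governed by |s - t| alone; one-sided continuity at 0 thereby becomes continuity at
    every time.\<close>
  have S_inc: "norm (S s f - S t f) \<le> norm (S \<bar>s - t\<bar> f - f)" if "s \<ge> 0" "t \<ge> 0" for s t f
  proof -
    have *: "norm (S s f - S t f) \<le> norm (S (s - t) f - f)" if "0 \<le> t" "t \<le> s" for s t
    proof -
      have "S s f = S t (S (s - t) f)" using semi[of t "s - t" f] that by simp
      then have "S s f - S t f = S t (S (s - t) f - f)" using linear_diff[OF lin[of t]] that by simp
      then show ?thesis using contr[of t] that by simp
    qed
    show ?thesis
    proof (cases "t \<le> s")
      case True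
      then show ?thesis using *[of t s] that by simp
    next
      case False
      then show ?thesis using *[of s t] that by (simp add: norm_minus_commute)
    qed
  qed
  have S_small: "((\<lambda>h. S \<bar>h\<bar> f) \<longlongrightarrow> f) (at 0)" for f
  proof -
    have "filterlim (\<lambda>h::real. \<bar>h\<bar>) (at_right 0) (at 0)"
      unfolding filterlim_at by (auto intro!: tendsto_eq_intros simp: eventually_at_filter)
    from filterlim_compose[OF cont this] show ?thesis .
  qed
  have P_cont: "((\<lambda>j. P (a j) f) \<longlongrightarrow> P b f) sequentially" if "a \<longlonglongrightarrow> b" for a :: "nat \<Rightarrow> real" and b f
  proof -
    have "isCont (\<lambda>h. S \<bar>h\<bar> f) 0" using S_small[of f] by (simp add: isCont_def S0)
    moreover have "(\<lambda>j. max 0 (a j) - max 0 b) \<longlonglongrightarrow> 0"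
      using tendsto_diff[OF tendsto_max[OF tendsto_const that] tendsto_const, of 0 "max 0 b"] by simp
    ultimately have "(\<lambda>j. S \<bar>max 0 (a j) - max 0 b\<bar> f) \<longlonglongrightarrow> S \<bar>0\<bar> f" by (rule isCont_tendsto_compose)
    then have lim: "(\<lambda>j. norm (S \<bar>max 0 (a j) - max 0 b\<bar> f - f)) \<longlonglongrightarrow> 0"
      by (simp add: S0 tendsto_norm_zero LIM_zero)
    have "(\<lambda>j. P (a j) f - P b f) \<longlonglongrightarrow> 0"
      by (rule Lim_null_comparison[OF _ lim], intro always_eventually allI) (simp add: P_def S_inc)
    then show ?thesis by (simp add: LIM_zero_iff)
  qed
  have P_cont2: "(\<lambda>j. P (a j) (f j)) \<longlonglongrightarrow> P b g" if "a \<longlonglongrightarrow> b" "f \<longlonglongrightarrow> g" for a :: "nat \<Rightarrow> real" and b f g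
  proof -
    have "(\<lambda>j. P (a j) (f j) - P (a j) g) \<longlonglongrightarrow> 0"
    proof (rule Lim_null_comparison, intro always_eventually allI)
      show "norm (P (a j) (f j) - P (a j) g) \<le> norm (f j - g)" for j unfolding P_diff by (rule P_le)
      show "(\<lambda>j. norm (f j - g)) \<longlonglongrightarrow> 0" using that(2) by (simp add: LIM_zero tendsto_norm_zero)
    qed
    from tendsto_add[OF this P_cont[OF that(1), of g]] show ?thesis by simp
  qed
  \<comment> \<open>The first term of the integral equation has norm at most that of u0; the extra 1
    is the room for the integral.\<close>
  define R where "R = norm u0 + 1"
  have R: "R > 0" unfolding R_def using norm_ge_zero[of u0] by linarith
  obtain L0 where L0: "\<And>u v. norm u \<le> R \<Longrightarrow> norm v \<le> R \<Longrightarrow> norm (N u - N v) \<le> L0 * norm (u - v)"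
    using lip[OF R] by blast
  define L where "L = max 0 L0"
  have L: "L \<ge> 0" by (simp add: L_def)
  have LN: "norm (N u - N v) \<le> L * norm (u - v)" if "norm u \<le> R" "norm v \<le> R" for u v
    using L0[OF that] mult_right_mono[of L0 L "norm (u - v)"] by (simp add: L_def)
  define B where "B = norm (N 0) + L * R"
  have B0: "B \<ge> 0" using L R by (simp add: B_def)
  have NB: "norm (N u) \<le> B" if "norm u \<le> R" for u
  proof -
    have "norm (N u) \<le> norm (N u - N 0) + norm (N 0)" using norm_triangle_sub[of "N u" "N 0"] by simp
    also have "norm (N u - N 0) \<le> L * R" using LN[of u 0] that R L mult_left_mono[OF that L] by simp
    finally show ?thesis by (simp add: B_def)
  qed
  \<comment> \<open>Ts B \<le> 1 keeps the iteration in the ball of radius R, and Ts L \<le> 1/2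
    makes it a contraction; the summand 1 keeps the denominator positive when B = L = 0.\<close>
  define Ts where "Ts = 1 / (B + 2 * L + 1)"
  have Ts: "Ts > 0" "Ts * B \<le> 1" "Ts * L \<le> 1/2"
    using B0 L by (auto simp: Ts_def field_simps)
  define c where "c \<tau> = max 0 (min Ts \<tau>)" for \<tau>
  have c: "0 \<le> c \<tau>" "c \<tau> \<le> Ts" for \<tau> using Ts by (auto simp: c_def)
  have c_cont: "(\<lambda>j. c (a j)) \<longlonglongrightarrow> c b" if "a \<longlonglongrightarrow> b" for a :: "nat \<Rightarrow> real" and b
    unfolding c_def by (intro tendsto_intros that)
  \<comment> \<open>Writing the moving limit of integration as an indicator makes continuity in
    \<tau> an instance of dominated convergence; pointwise convergence can fail only at the endpoint
    s = c \<tau>, a null set.\<close>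
  define F where "F v \<tau> s = indicator {0<..<c \<tau>} s *\<^sub>R P (c \<tau> - s) (N (v s))" for v \<tau> s
  define good where "good v \<longleftrightarrow> continuous_on UNIV v \<and> (\<forall>s. norm (v s) \<le> R)" for v :: "real \<Rightarrow> 'e"
  have F_le: "norm (F v \<tau> s) \<le> B * indicator {0..Ts} s" if "good v" for v \<tau> s
  proof -
    have "norm (P (c \<tau> - s) (N (v s))) \<le> B"
      using order_trans[OF P_le NB] that by (auto simp: good_def)
    then show ?thesis using B0 c[of \<tau>] by (auto simp: F_def indicator_def)
  qed
  have Nv: "(\<lambda>j. N (v (a j))) \<longlonglongrightarrow> N (v b)" if v: "good v" and "a \<longlonglongrightarrow> b" for v and a :: "nat \<Rightarrow> real" and b
  proof -
    have vl: "(\<lambda>j. v (a j)) \<longlonglongrightarrow> v b"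
      using v that(2) continuous_on_tendsto_compose[of UNIV v a b] by (simp add: good_def)
    have "(\<lambda>j. N (v (a j)) - N (v b)) \<longlonglongrightarrow> 0"
    proof (rule Lim_null_comparison, intro always_eventually allI)
      show "norm (N (v (a j)) - N (v b)) \<le> L * norm (v (a j) - v b)" for j
        using v by (intro LN) (auto simp: good_def)
      show "(\<lambda>j. L * norm (v (a j) - v b)) \<longlonglongrightarrow> 0"
        using vl by (intro tendsto_mult_right_zero) (simp add: LIM_zero tendsto_norm_zero)
    qed
    then show ?thesis by (simp add: LIM_zero_iff)
  qed
  have F_meas: "F v \<tau> \<in> borel_measurable lborel" if v: "good v" for v \<tau>
  proof -
    have "continuous_on UNIV (\<lambda>s. P (c \<tau> - s) (N (v s)))"
      unfolding continuous_on_sequentially o_def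
      by (auto intro!: P_cont2 Nv[OF v] tendsto_intros)
    then have [measurable]: "(\<lambda>s. P (c \<tau> - s) (N (v s))) \<in> borel_measurable borel"
      by (rule borel_measurable_continuous_onI)
    show ?thesis unfolding F_def by measurable
  qed
  have ind: "integrable lborel (\<lambda>s. K * indicator {0..Ts} s)" for K :: real
    by (intro integrable_mult_right integrable_real_indicator) (use Ts in simp_all)
  note dom = ind[of B]
  have F_int: "integrable lborel (F v \<tau>)" if "good v" for v \<tau>
    by (rule Bochner_Integration.integrable_bound[OF dom F_meas[OF that]])
      (intro AE_I2 order_trans[OF F_le[OF that]], simp)
  define Phi where "Phi v \<tau> = P (c \<tau>) u0 + (\<integral>s. F v \<tau> s \<partial>lborel)" for v \<tau>
  have Phi_cont: "continuous_on UNIV (Phi v)" if v: "good v" for v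
    unfolding continuous_on_sequentially o_def Phi_def
  proof (intro ballI allI impI tendsto_add)
    fix a :: "nat \<Rightarrow> real" and b
    assume "(\<forall>j. a j \<in> UNIV) \<and> a \<longlonglongrightarrow> b"
    then have ab: "a \<longlonglongrightarrow> b" by simp
    note ca = c_cont[OF ab]
    show "(\<lambda>j. P (c (a j)) u0) \<longlonglongrightarrow> P (c b) u0" by (rule P_cont[OF ca])
    show "(\<lambda>j. \<integral>s. F v (a j) s \<partial>lborel) \<longlonglongrightarrow> (\<integral>s. F v b s \<partial>lborel)"
    proof (rule integral_dominated_convergence[OF F_meas[OF v] F_meas[OF v] dom])
      show "AE s in lborel. norm (F v (a j) s) \<le> B * indicator {0..Ts} s" for j
        using F_le[OF v] by simp
      show "AE s in lborel. (\<lambda>j. F v (a j) s) \<longlonglongrightarrow> F v b s"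
        using AE_lborel_singleton[of "c b"]
      proof eventually_elim
        case (elim s)
        have "(\<lambda>j. P (c (a j) - s) (N (v s))) \<longlonglongrightarrow> P (c b - s) (N (v s))"
          by (intro P_cont tendsto_intros ca)
        moreover have "(\<lambda>j. indicator {0<..<c (a j)} s :: real) \<longlonglongrightarrow> indicator {0<..<c b} s"
        proof (rule tendsto_eventually)
          show "\<forall>\<^sub>F j in sequentially. indicator {0<..<c (a j)} s = (indicator {0<..<c b} s :: real)"
          proof (cases "s < c b")
            case True
            from order_tendstoD(1)[OF ca True] show ?thesis
              by eventually_elim (use True in \<open>auto simp: indicator_def\<close>)
          next
            case False
            then have "c b < s" using elim by simp
            from order_tendstoD(2)[OF ca this] show ?thesis
              by eventually_elim (use False in \<open>auto simp: indicator_def\<close>)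
          qed
        qed
        ultimately show ?case unfolding F_def by (intro tendsto_scaleR)
      qed
    qed
  qed
  have Phi_le: "norm (Phi v \<tau>) \<le> R" if v: "good v" for v \<tau>
  proof -
    have "norm (Phi v \<tau>) \<le> norm u0 + norm (\<integral>s. F v \<tau> s \<partial>lborel)"
      unfolding Phi_def by (intro order_trans[OF norm_triangle_ineq] add_right_mono P_le)
    also have "norm (\<integral>s. F v \<tau> s \<partial>lborel) \<le> (\<integral>s. B * indicator {0..Ts} s \<partial>lborel)"
      by (intro order_trans[OF integral_norm_bound] integral_mono' dom F_le[OF v]) (use B0 in auto)
    also have "\<dots> \<le> 1" using Ts by (simp add: mult.commute)
    finally show ?thesis by (simp add: R_def)
  qed
  have Phi_good: "good (Phi v)" if "good v" for v using Phi_cont[OF that] Phi_le[OF that] by (simp add: good_def)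
  have Phi_contr: "norm (Phi v \<tau> - Phi w \<tau>) \<le> 1/2 * d"
    if v: "good v" and w: "good w" and d: "\<And>s. norm (v s - w s) \<le> d" for v w \<tau> d
  proof -
    have d0: "d \<ge> 0" using d[of 0] norm_ge_zero order_trans by blast
    have "Phi v \<tau> - Phi w \<tau> = (\<integral>s. F v \<tau> s - F w \<tau> s \<partial>lborel)"
      unfolding Phi_def using F_int[OF v] F_int[OF w] by simp
    also have "norm \<dots> \<le> (\<integral>s. (L * d) * indicator {0..Ts} s \<partial>lborel)"
    proof (intro order_trans[OF integral_norm_bound] integral_mono')
      show "integrable lborel (\<lambda>s. (L * d) * indicator {0..Ts} s)" by (rule ind)
      show "norm (F v \<tau> s - F w \<tau> s) \<le> (L * d) * indicator {0..Ts} s" for s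
      proof -
        have "norm (P (c \<tau> - s) (N (v s)) - P (c \<tau> - s) (N (w s))) \<le> norm (N (v s) - N (w s))"
          unfolding P_diff by (rule P_le)
        also have "\<dots> \<le> L * norm (v s - w s)" using v w by (intro LN) (auto simp: good_def)
        also have "\<dots> \<le> L * d" using d L by (intro mult_left_mono)
        finally have "norm (P (c \<tau> - s) (N (v s)) - P (c \<tau> - s) (N (w s))) \<le> L * d" .
        then show ?thesis using c[of \<tau>] L d0 by (auto simp: F_def indicator_def)
      qed
    qed (use L d0 in auto)
    also have "\<dots> = (Ts * L) * d" using Ts by simp
    also have "\<dots> \<le> 1/2 * d" using Ts d0 by (intro mult_right_mono) auto
    finally show ?thesis .
  qed
  \<comment> \<open>Banach's theorem is applied in the bounded continuous functions with the
    supremum norm. \<open>Bcontfun\<close> is meaningful only on arguments known to be bounded and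
    continuous, hence the restriction to the ball in \<open>apply_Phi\<close>.\<close>
  define \<Phi> where "\<Phi> V = Bcontfun (Phi (apply_bcontfun V))" for V
  have good_V: "good (apply_bcontfun V)" if "V \<in> cball 0 R" for V :: "real \<Rightarrow>\<^sub>C 'e"
    using that order_trans[OF norm_bounded[of V]] by (auto simp: good_def dist_norm)
  have apply_Phi: "apply_bcontfun (\<Phi> V) = Phi (apply_bcontfun V)" if "V \<in> cball 0 R" for V
    unfolding \<Phi>_def
  proof (rule Bcontfun_inverse)
    show "Phi (apply_bcontfun V) \<in> bcontfun"
      by (rule bcontfun_normI[OF Phi_cont Phi_le]) (auto intro: good_V[OF that])
  qed
  have "\<exists>!V\<in>cball 0 R. \<Phi> V = V"
  proof (rule Banach_fix[where c = "1/2"])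
    show "complete (cball (0 :: real \<Rightarrow>\<^sub>C 'e) R)" by (simp add: complete_eq_closed)
    show "\<Phi> ` cball 0 R \<subseteq> cball 0 R"
    proof clarify
      fix V :: "real \<Rightarrow>\<^sub>C 'e" assume V: "V \<in> cball 0 R"
      have "norm (\<Phi> V) \<le> R"
        by (rule norm_bound) (simp add: apply_Phi[OF V] Phi_le[OF good_V[OF V]])
      then show "\<Phi> V \<in> cball 0 R" by (simp add: dist_norm)
    qed
    show "dist (\<Phi> V) (\<Phi> W) \<le> 1/2 * dist V W" if "V \<in> cball 0 R" "W \<in> cball 0 R" for V W
    proof (rule dist_bound)
      fix \<tau>
      have "norm (apply_bcontfun V s - apply_bcontfun W s) \<le> dist V W" for s
        using dist_bounded[of V s W] by (simp add: dist_norm)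
      from Phi_contr[OF good_V good_V this, OF that]
      show "dist (apply_bcontfun (\<Phi> V) \<tau>) (apply_bcontfun (\<Phi> W) \<tau>) \<le> 1/2 * dist V W"
        unfolding apply_Phi[OF that(1)] apply_Phi[OF that(2)] by (simp add: dist_norm)
    qed
  qed (use R in auto)
  then obtain V where V: "V \<in> cball 0 R" "\<Phi> V = V" by blast
  define u where "u = apply_bcontfun V"
  have gu: "good u" unfolding u_def by (rule good_V[OF V(1)])
  have fix_u: "u = Phi u" using apply_Phi[OF V(1)] V(2) by (simp add: u_def)
  have "set_integrable lborel {0<..<\<tau>} (\<lambda>s. S (\<tau> - s) (N (u s))) \<and>
      u \<tau> = S \<tau> u0 + (LINT s:{0<..<\<tau>}|lborel. S (\<tau> - s) (N (u s)))" if "\<tau> \<in> {0<..<Ts}" for \<tau>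
  proof -
    have ct: "c \<tau> = \<tau>" using that by (simp add: c_def)
    have F_eq: "F u \<tau> = (\<lambda>s. indicator {0<..<\<tau>} s *\<^sub>R S (\<tau> - s) (N (u s)))"
      by (auto simp: F_def ct P_def indicator_def fun_eq_iff)
    have "u \<tau> = P \<tau> u0 + (\<integral>s. F u \<tau> s \<partial>lborel)"
      using fun_cong[OF fix_u, of \<tau>] by (simp add: Phi_def ct)
    then show ?thesis
      using F_int[OF gu, of \<tau>] that unfolding set_integrable_def set_lebesgue_integral_def F_eq
      by (simp add: P_def)
  qed
  moreover have "bounded (range u)" using gu by (auto simp: good_def bounded_iff)
  ultimately show ?thesis using Ts(1) gu unfolding good_def by blast
qed

text \<open>The form in which the L^(2p) bounds enter \<open>square_abs_powr_diff_le\<close>: with D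
  = E for the difference of two images, and with D = R for a single image. The scaling undoes the
  quadratic dependence on E inside the power.\<close>

lemma nn_integral_scaled_powr_le:
  fixes f :: "'a::euclidean_space \<Rightarrow> complex"
  assumes p: "p > 1" and K: "K \<ge> 0" and E: "0 \<le> E" "E \<le> D" and D: "D > 0"
    and [measurable]: "f \<in> borel_measurable borel"
    and f: "(\<integral>\<^sup>+x. ennreal (norm (f x) powr (2 * p)) \<partial>lborel) \<le> ennreal ((K * E\<^sup>2) powr p)"
  shows "(\<integral>\<^sup>+x. ennreal ((norm (f x) / D) powr (2 * p)) \<partial>lborel) \<le> ennreal (K powr p)"
proof -
  have "(\<integral>\<^sup>+x. ennreal ((norm (f x) / D) powr (2 * p)) \<partial>lborel) = (\<integral>\<^sup>+x. ennreal (D powr - (2 * p)) * ennreal (norm (f x) powr (2 * p)) \<partial>lborel)"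
    using D by (intro nn_integral_cong) (simp add: powr_divide powr_minus_divide ennreal_mult[symmetric])
  also have "\<dots> = ennreal (D powr - (2 * p)) * (\<integral>\<^sup>+x. ennreal (norm (f x) powr (2 * p)) \<partial>lborel)"
    by (rule nn_integral_cmult) measurable
  also have "\<dots> \<le> ennreal (D powr - (2 * p)) * ennreal ((K * D\<^sup>2) powr p)"
  proof -
    have "(K * E\<^sup>2) powr p \<le> (K * D\<^sup>2) powr p"
      using K E p by (intro powr_mono2 mult_left_mono power_mono) auto
    from order_trans[OF f ennreal_leI[OF this]] show ?thesis by (rule mult_left_mono) simp
  qed
  also have "\<dots> = ennreal (K powr p)"
  proof -
    have "(D\<^sup>2) powr p = D powr (2 * p)" using D by (simp add: powr_powr[of D 2 p, simplified] powr_numeral[symmetric] del: powr_numeral)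
    then have "D powr - (2 * p) * (K * D\<^sup>2) powr p = K powr p"
      using D K by (simp add: powr_mult powr_minus_divide)
    then show ?thesis by (simp add: ennreal_mult[symmetric])
  qed
  finally show ?thesis .
qed

lemma fourier_multiplier_op_Lp_bounds:
  fixes T :: "'n::finite heis L2 \<Rightarrow> 'n heis L2" and m :: "real \<times> real \<Rightarrow> complex"
  assumes p: "p > 1"
    and m: "m \<in> borel_measurable (restrict_space borel (heis_fan CARD('n)))"
    and weak: "\<exists>C. \<forall>\<alpha>>0.
           emeasure (fan_mu CARD('n)) {a \<in> heis_fan CARD('n). norm (m a) > \<alpha>} < \<infinity> \<and>
           \<alpha> * measure (fan_mu CARD('n)) {a \<in> heis_fan CARD('n). norm (m a) > \<alpha>}
             powr (1/2 - 1 / (2 * p)) \<le> C"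
    and T: "fourier_multiplier_op m T"
  obtains K where "K \<ge> 0"
    "\<And>f. (\<integral>\<^sup>+x. ennreal (norm (rep_L2 (T f) x) powr (2 * p)) \<partial>lborel) \<le> ennreal ((K * (norm f)\<^sup>2) powr p)"
    "\<And>f g. (\<integral>\<^sup>+x. ennreal (norm (rep_L2 (T f) x - rep_L2 (T g) x) powr (2 * p)) \<partial>lborel) \<le> ennreal ((K * (norm (f - g))\<^sup>2) powr p)"
proof -
  obtain C0 where C0: "\<And>\<alpha>. \<alpha> > 0 \<Longrightarrow> emeasure (fan_mu CARD('n)) {a \<in> heis_fan CARD('n). norm (m a) > \<alpha>} < \<infinity>"
    "\<And>\<alpha>. \<alpha> > 0 \<Longrightarrow> \<alpha> * measure (fan_mu CARD('n)) {a \<in> heis_fan CARD('n). norm (m a) > \<alpha>} powr (1/2 - 1 / (2 * p)) \<le> C0"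
    using weak by blast
  \<comment> \<open>Enlarged so as to be positive, as the Paley bound requires.\<close>
  define C where "C = max C0 1"
  have C: "C > 0" "\<And>\<alpha>. \<alpha> > 0 \<Longrightarrow> \<alpha> * measure (fan_mu CARD('n)) {a \<in> heis_fan CARD('n). norm (m a) > \<alpha>} powr (1/2 - 1 / (2 * p)) \<le> C"
    using order_trans[OF C0(2)] by (auto simp: C_def)
  define K where "K = 2 + 4 * (2 * pi) ^ CARD('n) * C powr (2 * p / (p - 1)) * (p - 1)"
  have K: "K \<ge> 0" using p by (simp add: K_def)
  note paley = strichartz_paley[OF p _ _ _ _ m C(1) C0(1) C(2), folded K_def]
  have bound: "(\<integral>\<^sup>+x. ennreal (norm (rep_L2 k x) powr (2 * p)) \<partial>lborel) \<le> ennreal ((K * (norm h)\<^sup>2) powr p)"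
    if "strichartz_L2 h H" "strichartz_L2 k (\<lambda>x. m (fst x) * H x)" for h k :: "'n heis L2" and H
    by (rule fourier_multiplier_Lp_bound[OF p K m _ that]) (rule paley)
  have 1: "(\<integral>\<^sup>+x. ennreal (norm (rep_L2 (T f) x) powr (2 * p)) \<partial>lborel) \<le> ennreal ((K * (norm f)\<^sup>2) powr p)" for f
  proof -
    obtain G where "strichartz_L2 f G" "strichartz_L2 (T f) (\<lambda>x. m (fst x) * G x)"
      using T unfolding fourier_multiplier_op_def by blast
    then show ?thesis by (rule bound)
  qed
  have 2: "(\<integral>\<^sup>+x. ennreal (norm (rep_L2 (T f) x - rep_L2 (T g) x) powr (2 * p)) \<partial>lborel) \<le> ennreal ((K * (norm (f - g))\<^sup>2) powr p)" for f g
  proof -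
    obtain F where F: "strichartz_L2 f F" "strichartz_L2 (T f) (\<lambda>x. m (fst x) * F x)"
      using T unfolding fourier_multiplier_op_def by blast
    obtain G where G: "strichartz_L2 g G" "strichartz_L2 (T g) (\<lambda>x. m (fst x) * G x)"
      using T unfolding fourier_multiplier_op_def by blast
    have "strichartz_L2 (T f - T g) (\<lambda>x. m (fst x) * (F x - G x))"
      using strichartz_L2_diff[OF F(2) G(2)] by (simp add: right_diff_distrib)
    then have "(\<integral>\<^sup>+x. ennreal (norm (rep_L2 (T f - T g) x) powr (2 * p)) \<partial>lborel) \<le> ennreal ((K * (norm (f - g))\<^sup>2) powr p)"
      by (rule bound[OF strichartz_L2_diff[OF F(1) G(1)]])
    moreover have "AE x in lborel. rep_L2 (T f - T g) x = rep_L2 (T f) x - rep_L2 (T g) x"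
    proof -
      have "L2_of (rep_L2 (T f - T g)) = L2_of (\<lambda>x. rep_L2 (T f) x - rep_L2 (T g) x)"
        by (simp add: L2_of_diff rep_L2_fun)
      then show ?thesis by (subst (asm) L2_of_eq_iff) (auto intro: rep_L2_fun L2_fun_diff)
    qed
    then have "(\<integral>\<^sup>+x. ennreal (norm (rep_L2 (T f - T g) x) powr (2 * p)) \<partial>lborel) =
        (\<integral>\<^sup>+x. ennreal (norm (rep_L2 (T f) x - rep_L2 (T g) x) powr (2 * p)) \<partial>lborel)"
      by (intro nn_integral_cong_AE) auto
    ultimately show ?thesis by simp
  qed
  show ?thesis by (rule that[OF K 1 2])
qed

lemma abs_powr_L2_fun:
  assumes f: "f \<in> L2_fun" and fin: "(\<integral>\<^sup>+x. ennreal (norm (f x) powr (2 * p)) \<partial>lborel) < \<infinity>"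
  shows "abs_powr p f \<in> L2_fun"
proof (rule L2_funI_nn)
  have [measurable]: "f \<in> borel_measurable borel" using f by (simp add: L2_fun_def)
  show "abs_powr p f \<in> borel_measurable lborel" unfolding abs_powr_def by measurable
  have "(norm (abs_powr p f x))\<^sup>2 = norm (f x) powr (2 * p)" for x
    by (simp add: abs_powr_def power2_eq_square flip: powr_add)
  then show "(\<integral>\<^sup>+x. ennreal ((norm (abs_powr p f x))\<^sup>2) \<partial>lborel) < \<infinity>" using fin by simp
qed

text \<open>The pointwise estimate is integrated with D the norm of u - v. Its three powers have
  integrals at most K^p, and their weights 2, 1 and 1 add up to the 4 in the constant.\<close>

lemma abs_powr_locally_lipschitz:
  fixes T :: "'a::euclidean_space L2 \<Rightarrow> 'b::euclidean_space L2"
  assumes p: "p > 1" and K: "K \<ge> 0"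
    and b1: "\<And>f. (\<integral>\<^sup>+x. ennreal (norm (rep_L2 (T f) x) powr (2 * p)) \<partial>lborel) \<le> ennreal ((K * (norm f)\<^sup>2) powr p)"
    and b2: "\<And>f g. (\<integral>\<^sup>+x. ennreal (norm (rep_L2 (T f) x - rep_L2 (T g) x) powr (2 * p)) \<partial>lborel) \<le> ennreal ((K * (norm (f - g))\<^sup>2) powr p)"
    and R: "R > 0" and u: "norm u \<le> R" and v: "norm v \<le> R"
  shows "norm (L2_of (abs_powr p (rep_L2 (T u))) - L2_of (abs_powr p (rep_L2 (T v)))) \<le>
    sqrt (4 * p\<^sup>2 * R powr (2 * p - 2) * K powr p) * norm (u - v)"
proof (cases "u = v")
  \<comment> \<open>For u = v the claim is trivial; otherwise D is positive, as the scaling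
    requires.\<close>
  case False
  define D where "D = norm (u - v)"
  have D: "D > 0" using False by (simp add: D_def)
  have L2: "abs_powr p (rep_L2 (T w)) \<in> L2_fun" for w
    using b1[of w] by (intro abs_powr_L2_fun rep_L2_fun) (auto intro: le_less_trans)
  let ?a = "rep_L2 (T u)" and ?b = "rep_L2 (T v)"
  have rm [measurable]: "?a \<in> borel_measurable borel" "?b \<in> borel_measurable borel"
    using rep_L2_fun[of "T u"] rep_L2_fun[of "T v"] by (auto simp: L2_fun_def)
  let ?A = "\<integral>\<^sup>+x. ennreal ((norm (?a x - ?b x) / D) powr (2 * p)) \<partial>lborel"
  let ?B = "\<integral>\<^sup>+x. ennreal ((norm (?a x) / R) powr (2 * p)) \<partial>lborel"
  let ?C = "\<integral>\<^sup>+x. ennreal ((norm (?b x) / R) powr (2 * p)) \<partial>lborel"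
  define c where "c = p\<^sup>2 * D\<^sup>2 * R powr (2 * p - 2)"
  have c: "c \<ge> 0" by (simp add: c_def)
  have A: "?A \<le> ennreal (K powr p)" by (rule nn_integral_scaled_powr_le[OF p K _ _ D _ b2]) (simp_all add: D_def)
  have B: "?B \<le> ennreal (K powr p)" by (rule nn_integral_scaled_powr_le[OF p K _ u R _ b1]) simp_all
  have C: "?C \<le> ennreal (K powr p)" by (rule nn_integral_scaled_powr_le[OF p K _ v R _ b1]) simp_all
  have "ennreal ((norm (L2_of (abs_powr p ?a) - L2_of (abs_powr p ?b)))\<^sup>2) =
      (\<integral>\<^sup>+x. ennreal ((norm (abs_powr p ?a x - abs_powr p ?b x))\<^sup>2) \<partial>lborel)"
    using norm_L2_of_nn[OF L2_fun_diff[OF L2 L2], of u v] by (simp add: L2_of_diff L2)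
  also have "\<dots> \<le> (\<integral>\<^sup>+x. ennreal c * (2 * ennreal ((norm (?a x - ?b x) / D) powr (2 * p)) + ennreal ((norm (?a x) / R) powr (2 * p)) + ennreal ((norm (?b x) / R) powr (2 * p))) \<partial>lborel)"
  proof (rule nn_integral_mono)
    fix x
    have "(norm (abs_powr p ?a x - abs_powr p ?b x))\<^sup>2 = (norm (?a x) powr p - norm (?b x) powr p)\<^sup>2"
      unfolding abs_powr_def of_real_diff[symmetric] norm_of_real by simp
    also have "\<dots> \<le> c * (2 * (norm (?a x - ?b x) / D) powr (2 * p) + (norm (?a x) / R) powr (2 * p) + (norm (?b x) / R) powr (2 * p))"
      unfolding c_def by (rule square_abs_powr_diff_le[OF p D R])
    finally show "ennreal ((norm (abs_powr p ?a x - abs_powr p ?b x))\<^sup>2) \<le>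
        ennreal c * (2 * ennreal ((norm (?a x - ?b x) / D) powr (2 * p)) + ennreal ((norm (?a x) / R) powr (2 * p)) + ennreal ((norm (?b x) / R) powr (2 * p)))"
      using c by (auto simp: ennreal_mult ennreal_plus dest: ennreal_leI)
  qed
  also have "\<dots> = ennreal c * (2 * ?A + ?B + ?C)"
    by (simp add: nn_integral_add nn_integral_cmult)
  also have "\<dots> \<le> ennreal c * (2 * ennreal (K powr p) + ennreal (K powr p) + ennreal (K powr p))"
    by (intro mult_left_mono add_mono A B C) auto
  also have "\<dots> = ennreal (c * (4 * K powr p))"
  proof -
    have "2 * x + x + x = 4 * x" for x :: ennreal
      using distrib_right[of 2 2 x] by (simp add: mult_2 add.assoc)
    then show ?thesis using c by (simp add: ennreal_mult)
  qed
  finally have "(norm (L2_of (abs_powr p ?a) - L2_of (abs_powr p ?b)))\<^sup>2 \<le> c * (4 * K powr p)"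
    using c by (simp add: ennreal_le_iff)
  then have "norm (L2_of (abs_powr p ?a) - L2_of (abs_powr p ?b)) \<le> sqrt (c * (4 * K powr p))"
    by (rule real_le_rsqrt)
  also have "c * (4 * K powr p) = (4 * p\<^sup>2 * R powr (2 * p - 2) * K powr p) * D\<^sup>2" by (simp add: c_def)
  also have "sqrt \<dots> = sqrt (4 * p\<^sup>2 * R powr (2 * p - 2) * K powr p) * D"
    unfolding real_sqrt_mult[of _ "D\<^sup>2"] using D by simp
  finally show ?thesis unfolding D_def .
qed simp

lemma continuous_bounded_Linfty_L2:
  assumes "continuous_on UNIV u" "bounded (range u)"
  shows "Linfty_L2 b u"
proof -
  obtain C where "\<And>s. norm (u s) \<le> C" using assms(2) by (auto simp: bounded_iff)
  moreover have "u \<in> borel_measurable lborel" using borel_measurable_continuous_onI[OF assms(1)] by simp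
  ultimately show ?thesis unfolding Linfty_L2_def
    by (intro conjI measurable_restrict_space1 exI[of _ C]) auto
qed

theorem theorem4p1:
  fixes p d :: real
    and u0 :: "'n::finite heis L2"
    and m :: "real \<times> real \<Rightarrow> complex"
    and T :: "'n heis L2 \<Rightarrow> 'n heis L2"
    and S :: "real \<Rightarrow> 'n heis L2 \<Rightarrow> 'n heis L2"
  assumes "1 < p" and "0 < d"
    and "m \<in> borel_measurable (restrict_space borel (heis_fan CARD('n)))"
    and "bounded (m ` heis_fan CARD('n))"
    and "\<exists>C. \<forall>\<alpha>>0.
           emeasure (fan_mu CARD('n)) {a \<in> heis_fan CARD('n). norm (m a) > \<alpha>} < \<infinity> \<and>
           \<alpha> * measure (fan_mu CARD('n)) {a \<in> heis_fan CARD('n). norm (m a) > \<alpha>}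
             powr (1/2 - 1 / (2 * p)) \<le> C"
    and "fourier_multiplier_op m T"
    and "sublaplacian_semigroup d S"
  shows "(\<exists>Ts>0. \<exists>u. Linfty_L2 Ts u \<and>
            (\<forall>s\<in>{0<..<Ts}. abs_powr p (rep_L2 (T (u s))) \<in> L2_fun) \<and>
            (\<forall>\<tau>\<in>{0<..<Ts}.
               set_integrable lborel {0<..<\<tau>} (\<lambda>s. L2_of (abs_powr p (rep_L2 (T (u s))))) \<and>
               u \<tau> = u0 + (LINT s:{0<..<\<tau>}|lborel. L2_of (abs_powr p (rep_L2 (T (u s)))))))
       \<and> (\<exists>Ts>0. \<exists>u. Linfty_L2 Ts u \<and>
            (\<forall>s\<in>{0<..<Ts}. abs_powr p (rep_L2 (T (u s))) \<in> L2_fun) \<and>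
            (\<forall>\<tau>\<in>{0<..<Ts}.
               set_integrable lborel {0<..<\<tau>} (\<lambda>s. S (\<tau> - s) (L2_of (abs_powr p (rep_L2 (T (u s)))))) \<and>
               u \<tau> = S \<tau> u0 +
                 (LINT s:{0<..<\<tau>}|lborel. S (\<tau> - s) (L2_of (abs_powr p (rep_L2 (T (u s))))))))"
proof -
  note p = assms(1)
  obtain K where K: "K \<ge> 0"
    and b1: "\<And>f. (\<integral>\<^sup>+x. ennreal (norm (rep_L2 (T f) x) powr (2 * p)) \<partial>lborel) \<le> ennreal ((K * (norm f)\<^sup>2) powr p)"
    and b2: "\<And>f g. (\<integral>\<^sup>+x. ennreal (norm (rep_L2 (T f) x - rep_L2 (T g) x) powr (2 * p)) \<partial>lborel) \<le> ennreal ((K * (norm (f - g))\<^sup>2) powr p)"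
    using fourier_multiplier_op_Lp_bounds[OF p assms(3,5,6)] by blast
  define N where "N u = L2_of (abs_powr p (rep_L2 (T u)))" for u
  have L2: "abs_powr p (rep_L2 (T w)) \<in> L2_fun" for w
    using b1[of w] by (intro abs_powr_L2_fun rep_L2_fun) (auto intro: le_less_trans)
  have lip: "\<exists>L. \<forall>u v. norm u \<le> R \<longrightarrow> norm v \<le> R \<longrightarrow> norm (N u - N v) \<le> L * norm (u - v)" if "R > 0" for R
    unfolding N_def using abs_powr_locally_lipschitz[OF p K b1 b2 that] by blast
  have S: "contraction_semigroup S" using assms(7) by (simp add: sublaplacian_semigroup_def)
  \<comment> \<open>The first problem is the integral equation for the constant semigroup of
    identities.\<close>
  have "\<exists>Ts>0. \<exists>u :: real \<Rightarrow> 'n heis L2. continuous_on UNIV u \<and> bounded (range u) \<and>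
    (\<forall>\<tau>\<in>{0<..<Ts}. set_integrable lborel {0<..<\<tau>} (\<lambda>s. N (u s)) \<and>
      u \<tau> = u0 + (LINT s:{0<..<\<tau>}|lborel. N (u s)))"
    by (rule local_mild_solution[of "\<lambda>s f. f"]) (use lip in \<open>auto simp: linear_ident\<close>)
  moreover have "\<exists>Ts>0. \<exists>u. continuous_on UNIV u \<and> bounded (range u) \<and>
    (\<forall>\<tau>\<in>{0<..<Ts}. set_integrable lborel {0<..<\<tau>} (\<lambda>s. S (\<tau> - s) (N (u s))) \<and>
      u \<tau> = S \<tau> u0 + (LINT s:{0<..<\<tau>}|lborel. S (\<tau> - s) (N (u s))))"
    by (rule local_mild_solution) (use S lip in \<open>auto simp: contraction_semigroup_def\<close>)
  ultimately show ?thesis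
    unfolding N_def using L2 continuous_bounded_Linfty_L2 by blast
qed

end
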